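(* There exists a sequence of Willmore immersions $\Phi_k : \mathbb{S}^2 \to \mathbb{R}^3$ such that $W(\Phi_k) = 16\pi$ for all $k$ and $\Phi_k \to \Phi_\infty$ smoothly on $\mathbb{S}^2\setminus\{0\}$ (i.e. in $C^\infty_{\mathrm{loc}}(\mathbb{S}^2\setminus\{0\})$), where $\Phi_\infty$ is the inversion of a Lopez surface. Further, $$\lim_{k\to\infty} E(\Phi_k) = E(\Phi_\infty) + E(\Psi_\infty),$$ where $\Psi_\infty : \mathbb{C}\to\mathbb{R}^3$ is the immersion of an Enneper surface.
   Context: Here $\mathbb{S}^2$ is identified with $\mathbb{C}\cup\{\infty\}$ and $0$ is the corresponding point of $\mathbb{S}^2$. For an immersion $\Phi$ (possibly branched) of a surface $\Sigma$ into $\mathbb{R}^3$, $g=\Phi^*\xi$ is the induced metric ($\xi$ the Euclidean metric), $A$ the second fundamental form, $\vec n$ the Gauss map, $H=\frac12 \mathrm{Tr}_g A$ the mean curvature, $\mathring{A}$ the tracefree part of $A$, $$W(\Phi)=\int_\Sigma H^2\,d\mathrm{vol}_g,\qquad E(\Phi)=\int_\Sigma |A|_g^2\,d\mathrm{vol}_g=\int_\Sigma|\nabla_g\vec n|^2\,d\mathrm{vol}_g .$$ A Willmore immersion is a critical point of $W$, i.e. it satisfies $\Delta_g H+|\mathring A|^2H=0$. Lopez surface: a branched minimal immersion of $\mathbb{C}\setminus\{0\}$ with one simple planar end (at $\infty$) and one planar end of multiplicity $3$ (at $0$), namely $$\Psi_0(z)=2\,\Re\left(\frac{3}{2z^3}\begin{pmatrix}1\\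 i\\0\end{pmatrix}+\frac{a^2z}{8}\begin{pmatrix}1\\-i\\0\end{pmatrix}+\frac{3a}{2z}\begin{pmatrix}0\\0\\1\end{pmatrix}\right),\qquad a\in\mathbb{C}\setminus\{0\}.$$ Its inversion is $\iota_p\circ\Psi_0$, with $\iota_p(x)=\frac{x-p}{|x-p|^2}$ and $p\in\mathbb{R}^3$ at positive distance from the surface, extended to $\mathbb{S}^2$ (with a branch point of multiplicity $3$ at $0$). Enneper surface: up to similarity of $\mathbb{R}^3$ and rescaling of the parameter, the minimal immersion $$z\mapsto 2\,\Re\left(\frac z2\begin{pmatrix}1\\ i\\0\end{pmatrix}+\frac{z^2}{2}\begin{pmatrix}0\\0\\1\end{pmatrix}-\frac{z^3}{6}\begin{pmatrix}1\\-i\\0\end{pmatrix}\right),\quad z\in\mathbb{C}.$$ *)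

theory Defs
  imports "HOL-Analysis.Analysis"
begin

section \<open>Smooth functions of a complex parameter\<close>

text \<open>The plane \<open>\<complex> = \<real>\<^sup>2\<close> carries the coordinates \<open>x\<^sub>1 = Re z\<close>, \<open>x\<^sub>2 = Im z\<close>; coordinate indices are
  elements of the two-element type \<^typ>\<open>2\<close>, so that tensors are \<open>2 \<times> 2\<close> matrices.\<close>

definition coord_vec :: "2 \<Rightarrow> complex" where
  "coord_vec i = (if i = 1 then 1 else \<i>)"

definition pd :: "2 \<Rightarrow> (complex \<Rightarrow> 'b::real_normed_vector) \<Rightarrow> complex \<Rightarrow> 'b" where
  "pd i f z = frechet_derivative f (at z) (coord_vec i)"

primrec iter_pd :: "2 list \<Rightarrow> (complex \<Rightarrow> 'b::real_normed_vector) \<Rightarrow> complex \<Rightarrow> 'b" where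
  "iter_pd [] f = f"
| "iter_pd (i # is) f = pd i (iter_pd is f)"

definition smooth_on :: "complex set \<Rightarrow> (complex \<Rightarrow> 'b::real_normed_vector) \<Rightarrow> bool" where
  "smooth_on U f \<longleftrightarrow> open U \<and> (\<forall>is. \<forall>z\<in>U. iter_pd is f differentiable (at z))"

definition Cinf_loc_tendsto ::
  "complex set \<Rightarrow> (nat \<Rightarrow> complex \<Rightarrow> 'b::real_normed_vector) \<Rightarrow> (complex \<Rightarrow> 'b) \<Rightarrow> bool" where
  "Cinf_loc_tendsto U f g \<longleftrightarrow> (\<forall>k. smooth_on U (f k)) \<and> smooth_on U g \<and>
     (\<forall>K is. compact K \<and> K \<subseteq> U \<longrightarrow>
        uniform_limit K (\<lambda>k. iter_pd is (f k)) (iter_pd is g) sequentially)"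


section \<open>Geometry of parametrized surfaces in space\<close>

definition immersion_on :: "complex set \<Rightarrow> (complex \<Rightarrow> real^3) \<Rightarrow> bool" where
  "immersion_on U f \<longleftrightarrow> smooth_on U f \<and> (\<forall>z\<in>U. inj (frechet_derivative f (at z)))"

definition metric :: "(complex \<Rightarrow> real^3) \<Rightarrow> complex \<Rightarrow> real^2^2" where
  "metric f z = (\<chi> i j. pd i f z \<bullet> pd j f z)"

definition area_density :: "(complex \<Rightarrow> real^3) \<Rightarrow> complex \<Rightarrow> real" where
  "area_density f z = sqrt (det (metric f z))"

definition gauss_map :: "(complex \<Rightarrow> real^3) \<Rightarrow> complex \<Rightarrow> real^3" where
  "gauss_map f z = sgn (cross3 (pd 1 f z) (pd 2 f z))"

definition second_ff :: "(complex \<Rightarrow> real^3) \<Rightarrow> complex \<Rightarrow> real^2^2" where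
  "second_ff f z = (\<chi> i j. pd i (pd j f) z \<bullet> gauss_map f z)"

text \<open>Trace and squared norm of a covariant 2-tensor \<open>T\<close> with respect to the metric \<open>g\<close>, i.e.
  \<open>g\<^sup>i\<^sup>j T\<^sub>i\<^sub>j\<close> and \<open>g\<^sup>i\<^sup>k g\<^sup>j\<^sup>l T\<^sub>i\<^sub>j T\<^sub>k\<^sub>l\<close>.\<close>

definition tensor_trace :: "real^2^2 \<Rightarrow> real^2^2 \<Rightarrow> real" where
  "tensor_trace g T = (\<Sum>i\<in>UNIV. \<Sum>j\<in>UNIV. matrix_inv g $ i $ j * T $ i $ j)"

definition tensor_norm_sq :: "real^2^2 \<Rightarrow> real^2^2 \<Rightarrow> real" where
  "tensor_norm_sq g T = (\<Sum>i\<in>UNIV. \<Sum>j\<in>UNIV. \<Sum>k\<in>UNIV. \<Sum>l\<in>UNIV.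
     matrix_inv g $ i $ k * matrix_inv g $ j $ l * T $ i $ j * T $ k $ l)"

definition mean_curvature :: "(complex \<Rightarrow> real^3) \<Rightarrow> complex \<Rightarrow> real" where
  "mean_curvature f z = tensor_trace (metric f z) (second_ff f z) / 2"

definition tracefree_ff :: "(complex \<Rightarrow> real^3) \<Rightarrow> complex \<Rightarrow> real^2^2" where
  "tracefree_ff f z = second_ff f z - mean_curvature f z *\<^sub>R metric f z"

definition laplace_beltrami ::
  "(complex \<Rightarrow> real^3) \<Rightarrow> (complex \<Rightarrow> real) \<Rightarrow> complex \<Rightarrow> real" where
  "laplace_beltrami f u z = (\<Sum>i\<in>UNIV.
     pd i (\<lambda>w. \<Sum>j\<in>UNIV. area_density f w * matrix_inv (metric f w) $ i $ j * pd j u w) z)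
     / area_density f z"

definition willmore_on :: "complex set \<Rightarrow> (complex \<Rightarrow> real^3) \<Rightarrow> bool" where
  "willmore_on U f \<longleftrightarrow> immersion_on U f \<and>
     (\<forall>z\<in>U. laplace_beltrami f (mean_curvature f) z
        + tensor_norm_sq (metric f z) (tracefree_ff f z) * mean_curvature f z = 0)"

text \<open>The energies are integrals of nonnegative functions and are taken in \<open>[0, \<infinity>]\<close>, so that a
  finite value really expresses integrability.\<close>

definition W_energy :: "(complex \<Rightarrow> real^3) \<Rightarrow> ennreal" where
  "W_energy f = (\<integral>\<^sup>+ z. ennreal ((mean_curvature f z)\<^sup>2 * area_density f z) \<partial>lborel)"

definition E_energy :: "(complex \<Rightarrow> real^3) \<Rightarrow> ennreal" where
  "E_energy f =
     (\<integral>\<^sup>+ z. ennreal (tensor_norm_sq (metric f z) (second_ff f z) * area_density f z) \<partial>lborel)"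


section \<open>The sphere\<close>

text \<open>The unit sphere is identified with \<open>\<complex> \<union> {\<infinity>}\<close> by stereographic projection from the north pole;
  \<open>stereo_inf\<close> is the chart \<open>w = 1 / z\<close> around \<open>\<infinity>\<close>. Maps on the sphere are functions on \<^typ>\<open>real^3\<close>
  of which only the values on \<open>sphere 0 1\<close> matter.\<close>

definition stereo :: "complex \<Rightarrow> real^3" where
  "stereo z = (1 / (1 + (cmod z)\<^sup>2)) *\<^sub>R vector [2 * Re z, 2 * Im z, (cmod z)\<^sup>2 - 1]"

definition stereo_inf :: "complex \<Rightarrow> real^3" where
  "stereo_inf w = (1 / (1 + (cmod w)\<^sup>2)) *\<^sub>R vector [2 * Re w, - 2 * Im w, 1 - (cmod w)\<^sup>2]"

lemma stereo_in_sphere: "stereo z \<in> sphere 0 1"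
proof -
  have p: "0 < 1 + (cmod z)\<^sup>2" by (simp add: add_pos_nonneg)
  have "(2 * Re z)\<^sup>2 + (2 * Im z)\<^sup>2 + ((cmod z)\<^sup>2 - 1)\<^sup>2 = (1 + (cmod z)\<^sup>2)\<^sup>2"
    unfolding cmod_power2 by algebra
  then have "norm (vector [2 * Re z, 2 * Im z, (cmod z)\<^sup>2 - 1] :: real^3) = sqrt ((1 + (cmod z)\<^sup>2)\<^sup>2)"
    by (simp only: norm_eq_sqrt_inner inner_vec_def sum_3 vector_3 inner_real_def power2_eq_square)
  then show ?thesis
    using p by (simp add: stereo_def)
qed

lemma stereo_inf_eq_stereo:
  assumes "w \<noteq> 0"
  shows "stereo_inf w = stereo (1 / w)"
proof -
  define n where "n = (cmod w)\<^sup>2"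
  have n: "0 < n" using assms by (simp add: n_def)
  have R: "Re (1 / w) = Re w / n" and I: "Im (1 / w) = - Im w / n"
    by (simp_all add: Re_divide Im_divide n_def cmod_power2)
  have c: "(cmod (1 / w))\<^sup>2 = 1 / n"
    by (simp add: norm_divide power_divide n_def)
  have d: "1 / (1 + 1 / n) = n / (1 + n)"
    using n by (simp add: field_simps)
  show ?thesis
    using n unfolding stereo_def stereo_inf_def vec_eq_iff forall_3 R I c d n_def[symmetric]
    by (simp add: diff_divide_distrib right_diff_distrib)
qed

lemma stereo_inf_0: "stereo_inf 0 = axis 3 1"
  by (simp add: stereo_inf_def vec_eq_iff forall_3 axis_def)

lemma sphere_eq_charts: "sphere 0 1 = insert (stereo_inf 0) (range stereo)"
proof -
  have "x \<in> range stereo" if x: "norm x = 1" and ne: "x \<noteq> axis 3 1" for x :: "real^3"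
  proof -
    have s: "(x$1)\<^sup>2 + (x$2)\<^sup>2 + (x$3)\<^sup>2 = 1"
      using x by (simp add: norm_eq_1 inner_vec_def sum_3 power2_eq_square)
    have "x$3 \<noteq> 1"
      using s ne by (auto simp: vec_eq_iff forall_3 axis_def sum_power2_eq_zero_iff)
    define t where "t = 1 - x$3"
    have t: "t \<noteq> 0" and x3: "x$3 = 1 - t" using \<open>x$3 \<noteq> 1\<close> by (simp_all add: t_def)
    define z where "z = Complex (x$1 / t) (x$2 / t)"
    have "(cmod z)\<^sup>2 = ((x$1)\<^sup>2 + (x$2)\<^sup>2) / t\<^sup>2"
      by (simp add: z_def cmod_power2 power_divide add_divide_distrib)
    also have "(x$1)\<^sup>2 + (x$2)\<^sup>2 = (2 - t) * t"
      using s unfolding x3 by algebra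
    finally have c: "(cmod z)\<^sup>2 = 2 / t - 1"
      using t by (simp add: power2_eq_square diff_divide_distrib)
    have "stereo z = x"
      using t unfolding stereo_def c vec_eq_iff forall_3
      by (simp add: z_def x3 algebra_simps)
    then show ?thesis by (metis rangeI)
  qed
  moreover have "axis 3 1 \<in> sphere (0::real^3) 1"
    by (simp add: norm_axis_1)
  moreover have "range stereo \<subseteq> sphere 0 1"
    using stereo_in_sphere by blast
  ultimately have "x \<in> sphere 0 1 \<longleftrightarrow> x \<in> insert (axis 3 1) (range stereo)" for x :: "real^3"
    unfolding insert_iff mem_sphere_0 subset_iff by blast
  then show ?thesis
    unfolding stereo_inf_0 by (rule set_eqI)
qed

definition sphere_charts :: "(complex \<Rightarrow> real^3) set" where
  "sphere_charts = {stereo, stereo_inf}"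

definition willmore_immersion_sphere :: "(real^3 \<Rightarrow> real^3) \<Rightarrow> bool" where
  "willmore_immersion_sphere \<Phi> \<longleftrightarrow> (\<forall>\<sigma>\<in>sphere_charts. willmore_on UNIV (\<Phi> \<circ> \<sigma>))"

definition smooth_convergence_sphere ::
  "(real^3) set \<Rightarrow> (nat \<Rightarrow> real^3 \<Rightarrow> real^3) \<Rightarrow> (real^3 \<Rightarrow> real^3) \<Rightarrow> bool" where
  "smooth_convergence_sphere V \<Phi> \<Phi>' \<longleftrightarrow>
     (\<forall>\<sigma>\<in>sphere_charts. Cinf_loc_tendsto (\<sigma> -` V) (\<lambda>k. \<Phi> k \<circ> \<sigma>) (\<Phi>' \<circ> \<sigma>))"

text \<open>The chart \<open>stereo\<close> misses a single point, hence a null set for the area measure.\<close>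

definition W_sphere :: "(real^3 \<Rightarrow> real^3) \<Rightarrow> ennreal" where
  "W_sphere \<Phi> = W_energy (\<Phi> \<circ> stereo)"

definition E_sphere :: "(real^3 \<Rightarrow> real^3) \<Rightarrow> ennreal" where
  "E_sphere \<Phi> = E_energy (\<Phi> \<circ> stereo)"


section \<open>Lopez and Enneper surfaces\<close>

definition Re_vec :: "complex^3 \<Rightarrow> real^3" where
  "Re_vec v = (\<chi> i. Re (v $ i))"

definition inversion :: "real^3 \<Rightarrow> real^3 \<Rightarrow> real^3" where
  "inversion p x = (1 / (norm (x - p))\<^sup>2) *\<^sub>R (x - p)"

definition lopez :: "complex \<Rightarrow> complex \<Rightarrow> real^3" where
  "lopez a z = 2 *\<^sub>R Re_vec (
     (3 / (2 * z ^ 3)) *s vector [1, \<i>, 0] +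
     (a\<^sup>2 * z / 8) *s vector [1, - \<i>, 0] +
     (3 * a / (2 * z)) *s vector [0, 0, 1])"

text \<open>The inverted surface is defined on \<open>\<complex> - {0}\<close> and is extended by continuity to \<open>0\<close> and \<open>\<infinity>\<close>.\<close>

definition is_inverted_lopez :: "(real^3 \<Rightarrow> real^3) \<Rightarrow> bool" where
  "is_inverted_lopez \<Phi> \<longleftrightarrow> (\<exists>a p. a \<noteq> 0 \<and> infdist p (lopez a ` (- {0})) > 0 \<and>
     (\<forall>z. z \<noteq> 0 \<longrightarrow> \<Phi> (stereo z) = inversion p (lopez a z)) \<and>
     continuous_on (sphere 0 1) \<Phi>)"

definition enneper :: "complex \<Rightarrow> real^3" where
  "enneper z = 2 *\<^sub>R Re_vec (
     (z / 2) *s vector [1, \<i>, 0] +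
     (z\<^sup>2 / 2) *s vector [0, 0, 1] -
     (z ^ 3 / 6) *s vector [1, - \<i>, 0])"

definition is_enneper :: "(complex \<Rightarrow> real^3) \<Rightarrow> bool" where
  "is_enneper \<Psi> \<longleftrightarrow> (\<exists>r T b \<mu>. r > 0 \<and> orthogonal_transformation T \<and> \<mu> \<noteq> 0 \<and>
     (\<forall>z. \<Psi> z = b + r *\<^sub>R T (enneper (\<mu> * z))))"

end

theory Submission
  imports Defs "HOL-Complex_Analysis.Complex_Analysis"
begin

text \<open>The surfaces are inversions, at one fixed point, of minimal surfaces with four simple planar ends
  that are invariant under a rotation of order three. Their Weierstrass spinors are \<open>(3 \<i> z, \<i> (z\<^sup>3 + 2 e))\<close>
  over \<open>z\<^sup>3 - e\<close>; as \<open>e \<rightarrow> 0\<close> three of these ends merge into the triple end of the Lopez surface. The inverted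
  surface is a quotient of real polynomials whose denominator stays positive up to \<open>e = 0\<close>, which gives smooth
  convergence.

  If \<open>X\<close> is a conformal minimal immersion with conformal factor \<open>\<rho>\<close> and \<open>f = X / |X|\<^sup>2\<close>, then the mean curvature of \<open>f\<close>
  is \<open>-2\<close> times the support function of \<open>X\<close>; the Willmore equation for \<open>f\<close> is the Jacobi equation for the support
  function. Moreover the integrands of \<open>W\<close> and \<open>E\<close> are \<open>\<Delta> (ln |X|\<^sup>2)\<close> and \<open>\<Delta> (2 ln |X|\<^sup>2 + ln \<rho>)\<close> in
  flat coordinates. Removing the harmonic singularities at the ends turns them into Laplacians of smooth functions on
  \<open>\<complex>\<close> with logarithmic growth \<open>c ln |z|\<close>, whose integral is the flux \<open>2 \<pi> c\<close> at infinity. The energies are thus read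
  off from the degrees of polynomials: \<open>E\<close> equals \<open>56 \<pi>\<close> along the family, \<open>48 \<pi>\<close> for the inverted Lopez
  surface and \<open>8 \<pi>\<close> for the Enneper surface.\<close>

section \<open>Calculus of partial derivatives\<close>

text \<open>At \<open>e = 0\<close> the spinors and their denominator acquire the common factor
  \<open>z\<close>. Cancelling it lowers the growth degree of the squared spinor norm from 6 to 4,
  which costs \<open>8 pi\<close> of \<open>E\<close>, while the degree 8 that governs
  \<open>W\<close> stays. Geometrically, at scale \<open>z = e * y\<close> the spinors over their
  denominator tend to \<open>(-3 \<i> y, -2 \<i>)\<close>, which are Enneper data; the proof
  compares energies only and takes no rescaled limit. The obstacle is that every curvature formula
  comes from the minimal surface, which is infinite at its ends, whereas the sphere contains the
  ends. Each ingredient is therefore rewritten until the poles cancel, and identities known off the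
  finitely many ends are carried across them by continuity. The centre of inversion
  \<open>(0, 0, 6)\<close> lies on the axis of the threefold rotation: a surface point on that axis
  has such restricted parameter that avoidance of the centre can be checked by elementary estimates,
  uniformly for \<open>0 \<le> e \<le> 1/8\<close>.\<close>

lemma coord_vec_simps [simp]: "coord_vec 1 = 1" "coord_vec 2 = \<i>"
  by (simp_all add: coord_vec_def)

lemma pd_eq: "(f has_derivative f') (at z) \<Longrightarrow> pd i f z = f' (coord_vec i)"
  unfolding pd_def by (metis frechet_derivative_at)

lemma pd_cong:
  assumes "open U" "z \<in> U" "\<And>w. w \<in> U \<Longrightarrow> f w = g w"
  shows "pd i f z = pd i g z"
proof -
  have "(f has_derivative h) (at z) \<longleftrightarrow> (g has_derivative h) (at z)" for h
    using assms by (metis has_derivative_transform_within_open)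
  then show ?thesis by (simp add: pd_def frechet_derivative_def)
qed

lemma differentiable_cong_open:
  assumes "open U" "z \<in> U" "\<And>w. w \<in> U \<Longrightarrow> f w = g w" "f differentiable (at z)"
  shows "g differentiable (at z)"
  using assms unfolding differentiable_def by (metis has_derivative_transform_within_open)

lemma pd_linear:
  assumes "bounded_linear L" "f differentiable (at z)"
  shows "pd i (\<lambda>w. L (f w)) z = L (pd i f z)"
proof -
  from assms(2) obtain f' where "(f has_derivative f') (at z)" by (auto simp: differentiable_def)
  with bounded_linear.has_derivative[OF assms(1) this] show ?thesis by (simp add: pd_eq)
qed

lemma pd_bilinear:
  assumes "bounded_bilinear B" "f differentiable (at z)" "g differentiable (at z)"
  shows "pd i (\<lambda>w. B (f w) (g w)) z = B (f z) (pd i g z) + B (pd i f z) (g z)"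
proof -
  from assms obtain f' g' where "(f has_derivative f') (at z)" "(g has_derivative g') (at z)"
    by (auto simp: differentiable_def)
  with bounded_bilinear.FDERIV[OF assms(1) this] show ?thesis by (simp add: pd_eq)
qed

lemma differentiable_linear:
  assumes "bounded_linear L" "f differentiable (at z)"
  shows "(\<lambda>w. L (f w)) differentiable (at z)"
  using assms bounded_linear.has_derivative unfolding differentiable_def by blast

lemma differentiable_bilinear:
  assumes "bounded_bilinear B" "f differentiable (at z)" "g differentiable (at z)"
  shows "(\<lambda>w. B (f w) (g w)) differentiable (at z)"
  using assms bounded_bilinear.FDERIV unfolding differentiable_def by blast

lemma pd_add:
  assumes "f differentiable (at z)" "g differentiable (at z)"
  shows "pd i (\<lambda>w. f w + g w) z = pd i f z + pd i g z"
proof -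
  from assms obtain f' g' where d: "(f has_derivative f') (at z)" "(g has_derivative g') (at z)"
    by (auto simp: differentiable_def)
  from pd_eq[OF has_derivative_add[OF d]] show ?thesis by (simp add: pd_eq[OF d(1)] pd_eq[OF d(2)])
qed

lemma pd_inverse:
  fixes f :: "complex \<Rightarrow> real"
  assumes "f differentiable (at z)" "f z \<noteq> 0"
  shows "pd i (\<lambda>w. inverse (f w)) z = - (inverse (f z) * inverse (f z) * pd i f z)"
proof -
  from assms obtain f' where f': "(f has_derivative f') (at z)"
    by (auto simp: differentiable_def)
  have "((\<lambda>w. inverse (f w)) has_derivative (\<lambda>h. - (inverse (f z) * f' h * inverse (f z)))) (at z)"
    by (rule Deriv.has_derivative_inverse[OF assms(2) f'])
  from pd_eq[OF this] pd_eq[OF f'] show ?thesis by simp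
qed

lemma pd_const [simp]: "pd i (\<lambda>w. c) = (\<lambda>_. 0)"
  by (rule ext) (simp add: pd_eq[OF has_derivative_const])

lemma pd_ident [simp]: "pd i (\<lambda>w. w) = (\<lambda>_. coord_vec i)"
  by (rule ext) (simp add: pd_eq[OF has_derivative_ident])

lemma iter_pd_snoc: "iter_pd (is @ [i]) f = iter_pd is (pd i f)"
  by (induction "is") auto

section \<open>Convergence with all derivatives\<close>

text \<open>Continuity of the limit belongs to the notion because it bounds the limit on compact
  sets, as uniform convergence of products requires.\<close>

definition loc_unif :: "complex set \<Rightarrow> (nat \<Rightarrow> complex \<Rightarrow> 'b::real_normed_vector) \<Rightarrow> (complex \<Rightarrow> 'b) \<Rightarrow> bool" where
  "loc_unif U f g \<longleftrightarrow> continuous_on U g \<and>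
     (\<forall>K. compact K \<and> K \<subseteq> U \<longrightarrow> uniform_limit K f g sequentially)"

text \<open>The recursion differentiates first and then asks for one order less, so the product and
  quotient rules become inductions over all functions at once. Differentiability is recorded
  separately, since \<open>pd\<close> is total and has a value even where no derivative
  exists.\<close>

primrec conv_upto :: "nat \<Rightarrow> complex set \<Rightarrow> (nat \<Rightarrow> complex \<Rightarrow> 'b::real_normed_vector) \<Rightarrow> (complex \<Rightarrow> 'b) \<Rightarrow> bool" where
  "conv_upto 0 U f g \<longleftrightarrow> loc_unif U f g"
| "conv_upto (Suc n) U f g \<longleftrightarrow> loc_unif U f g \<and>
     (\<forall>z\<in>U. (\<forall>k. f k differentiable (at z)) \<and> g differentiable (at z)) \<and>
     (\<forall>i. conv_upto n U (\<lambda>k. pd i (f k)) (pd i g))"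

definition smooth_conv :: "complex set \<Rightarrow> (nat \<Rightarrow> complex \<Rightarrow> 'b::real_normed_vector) \<Rightarrow> (complex \<Rightarrow> 'b) \<Rightarrow> bool" where
  "smooth_conv U f g \<longleftrightarrow> (\<forall>n. conv_upto n U f g)"

lemma conv_upto_Suc_imp: "conv_upto (Suc n) U f g \<Longrightarrow> conv_upto n U f g"
proof (induction n arbitrary: f g)
  case 0
  then show ?case by simp
next
  case (Suc n)
  from Suc.prems have "conv_upto n U (\<lambda>k. pd i (f k)) (pd i g)" for i
    by (intro Suc.IH) (simp add: conv_upto.simps(2)[of "Suc n"] del: conv_upto.simps)
  with Suc.prems show ?case by simp
qed

text \<open>Derivatives of products and quotients are known by formula only at points of
  \<open>U\<close>; since \<open>U\<close> is open, agreement there survives every further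
  differentiation.\<close>

lemma conv_upto_cong:
  assumes "open U" "\<And>k z. z \<in> U \<Longrightarrow> f k z = f' k z" "\<And>z. z \<in> U \<Longrightarrow> g z = g' z"
    "conv_upto n U f g"
  shows "conv_upto n U f' g'"
  using assms(2-)
proof (induction n arbitrary: f g f' g')
  case 0
  have "uniform_limit K f g sequentially \<longleftrightarrow> uniform_limit K f' g' sequentially" if "K \<subseteq> U" for K
    using 0 that by (intro uniform_limit_cong) (auto intro!: always_eventually)
  with 0 show ?case by (auto simp: loc_unif_def cong: continuous_on_cong)
next
  case (Suc n)
  have "uniform_limit K f g sequentially \<longleftrightarrow> uniform_limit K f' g' sequentially" if "K \<subseteq> U" for K
    using Suc.prems that by (intro uniform_limit_cong) (auto intro!: always_eventually)
  with Suc.prems have 1: "loc_unif U f' g'" by (auto simp: loc_unif_def cong: continuous_on_cong)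
  have 2: "conv_upto n U (\<lambda>k. pd i (f' k)) (pd i g')" for i
  proof (rule Suc.IH)
    show "conv_upto n U (\<lambda>k. pd i (f k)) (pd i g)" using Suc.prems by simp
    show "pd i (f k) z = pd i (f' k) z" if "z \<in> U" for k z
      using assms(1) that Suc.prems(1) by (rule pd_cong)
    show "pd i g z = pd i g' z" if "z \<in> U" for z
      using assms(1) that Suc.prems(2) by (rule pd_cong)
  qed
  have 3: "(\<forall>k. f' k differentiable (at z)) \<and> g' differentiable (at z)" if "z \<in> U" for z
    using differentiable_cong_open[OF assms(1) that, of "f _" "f' _"]
      differentiable_cong_open[OF assms(1) that, of g g'] Suc.prems that by auto
  show ?case using 1 2 3 by simp
qed

lemma loc_unif_linear:
  assumes "bounded_linear L" "loc_unif U f g"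
  shows "loc_unif U (\<lambda>k z. L (f k z)) (\<lambda>z. L (g z))"
  using assms(2) unfolding loc_unif_def
  by (auto intro!: bounded_linear.uniform_limit[OF assms(1)] bounded_linear.continuous_on[OF assms(1)])

lemma loc_unif_bilinear:
  assumes "bounded_bilinear B" "loc_unif U f g" "loc_unif U f' g'"
  shows "loc_unif U (\<lambda>k z. B (f k z) (f' k z)) (\<lambda>z. B (g z) (g' z))"
proof -
  have "uniform_limit K (\<lambda>k z. B (f k z) (f' k z)) (\<lambda>z. B (g z) (g' z)) sequentially"
    if "compact K" "K \<subseteq> U" for K
  proof (rule bounded_bilinear.bounded_uniform_limit[OF assms(1)])
    show "bounded (g' ` K)" "bounded (g ` K)"
      using assms that unfolding loc_unif_def
      by (meson compact_continuous_image compact_imp_bounded continuous_on_subset)+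
  qed (use assms that in \<open>auto simp: loc_unif_def\<close>)
  with assms(2,3) show ?thesis
    unfolding loc_unif_def by (auto intro!: bounded_bilinear.continuous_on[OF assms(1)])
qed

lemma loc_unif_add:
  assumes "loc_unif U f g" "loc_unif U f' g'"
  shows "loc_unif U (\<lambda>k z. f k z + f' k z) (\<lambda>z. g z + g' z)"
  using assms unfolding loc_unif_def by (auto intro!: uniform_limit_intros continuous_intros)

lemma loc_unif_inverse:
  fixes f :: "nat \<Rightarrow> complex \<Rightarrow> real"
  assumes "loc_unif U f g" "\<And>z. z \<in> U \<Longrightarrow> g z \<noteq> 0"
  shows "loc_unif U (\<lambda>k z. inverse (f k z)) (\<lambda>z. inverse (g z))"
proof -
  have "uniform_limit K (\<lambda>k z. inverse (f k z)) (\<lambda>z. inverse (g z)) sequentially"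
    if K: "compact K" "K \<subseteq> U" for K
  proof (cases "K = {}")
    case False
    have "continuous_on K (\<lambda>z. norm (g z))"
      using assms K by (auto simp: loc_unif_def intro!: continuous_intros intro: continuous_on_subset)
    from continuous_attains_inf[OF K(1) False this] obtain x where
      x: "x \<in> K" "\<And>y. y \<in> K \<Longrightarrow> norm (g x) \<le> norm (g y)" by auto
    have "uniform_limit K (\<lambda>k z. inverse (f k z)) (inverse \<circ> g) sequentially"
      by (rule uniform_lim_inverse[where b = "norm (g x)"])
         (use assms K x in \<open>auto simp: loc_unif_def\<close>)
    then show ?thesis by (simp add: o_def)
  qed auto
  with assms show ?thesis
    unfolding loc_unif_def by (auto intro!: continuous_intros)
qed

lemma conv_upto_const:
  assumes "c \<longlonglongrightarrow> d"
  shows "conv_upto n U (\<lambda>k z. c k) (\<lambda>z. d)"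
  using assms
proof (induction n arbitrary: c d)
  have *: "loc_unif U (\<lambda>k z. c k) (\<lambda>z. d)" if "c \<longlonglongrightarrow> d" for c and d :: 'a
    using that by (auto simp: loc_unif_def uniform_limit_iff tendsto_iff)
  case 0
  then show ?case by (simp add: *)
next
  case (Suc n)
  have *: "loc_unif U (\<lambda>k z. c k) (\<lambda>z. d)"
    using Suc.prems by (auto simp: loc_unif_def uniform_limit_iff tendsto_iff)
  show ?case using Suc.IH[of "\<lambda>_. 0" 0] by (simp add: *)
qed

lemma conv_upto_ident: "conv_upto n U (\<lambda>k z. z) (\<lambda>z. z)"
  by (cases n) (auto simp: loc_unif_def uniform_limit_iff conv_upto_const)

lemma conv_upto_linear:
  assumes "open U" "bounded_linear L" "conv_upto n U f g"
  shows "conv_upto n U (\<lambda>k z. L (f k z)) (\<lambda>z. L (g z))"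
  using assms(3)
proof (induction n arbitrary: f g)
  case 0
  then show ?case using loc_unif_linear[OF assms(2)] by simp
next
  case (Suc n)
  have "conv_upto n U (\<lambda>k. pd i (\<lambda>z. L (f k z))) (pd i (\<lambda>z. L (g z)))" for i
    by (rule conv_upto_cong[OF assms(1) _ _ Suc.IH[of "\<lambda>k. pd i (f k)" "pd i g"]])
       (use Suc.prems in \<open>auto simp: pd_linear[OF assms(2)]\<close>)
  moreover have "loc_unif U (\<lambda>k z. L (f k z)) (\<lambda>z. L (g z))"
    using Suc.prems by (intro loc_unif_linear[OF assms(2)]) simp
  ultimately show ?case using Suc.prems by (auto intro!: differentiable_linear[OF assms(2)])
qed

lemma conv_upto_add:
  assumes "open U" "conv_upto n U f g" "conv_upto n U f' g'"
  shows "conv_upto n U (\<lambda>k z. f k z + f' k z) (\<lambda>z. g z + g' z)"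
  using assms(2,3)
proof (induction n arbitrary: f g f' g')
  case 0
  then show ?case using loc_unif_add by simp
next
  case (Suc n)
  have "conv_upto n U (\<lambda>k. pd i (\<lambda>z. f k z + f' k z)) (pd i (\<lambda>z. g z + g' z))" for i
    by (rule conv_upto_cong[OF assms(1) _ _ Suc.IH[of "\<lambda>k. pd i (f k)" "pd i g" "\<lambda>k. pd i (f' k)" "pd i g'"]])
       (use Suc.prems in \<open>auto simp: pd_add\<close>)
  moreover have "loc_unif U (\<lambda>k z. f k z + f' k z) (\<lambda>z. g z + g' z)"
    using Suc.prems by (intro loc_unif_add) simp_all
  ultimately show ?case using Suc.prems by (auto intro!: differentiable_add)
qed

lemma conv_upto_bilinear:
  assumes "open U" "bounded_bilinear B" "conv_upto n U f g" "conv_upto n U f' g'"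
  shows "conv_upto n U (\<lambda>k z. B (f k z) (f' k z)) (\<lambda>z. B (g z) (g' z))"
  using assms(3,4)
proof (induction n arbitrary: f g f' g')
  case 0
  then show ?case using loc_unif_bilinear[OF assms(2)] by simp
next
  case (Suc n)
  have "conv_upto n U (\<lambda>k. pd i (\<lambda>z. B (f k z) (f' k z))) (pd i (\<lambda>z. B (g z) (g' z)))" for i
  proof (rule conv_upto_cong[OF assms(1)])
    show "conv_upto n U (\<lambda>k z. B (f k z) (pd i (f' k) z) + B (pd i (f k) z) (f' k z))
      (\<lambda>z. B (g z) (pd i g' z) + B (pd i g z) (g' z))"
      by (intro conv_upto_add[OF assms(1)] Suc.IH)
         (use Suc.prems conv_upto_Suc_imp[OF Suc.prems(1)] conv_upto_Suc_imp[OF Suc.prems(2)] in auto)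
  qed (use Suc.prems in \<open>auto simp: pd_bilinear[OF assms(2)]\<close>)
  moreover have "loc_unif U (\<lambda>k z. B (f k z) (f' k z)) (\<lambda>z. B (g z) (g' z))"
    using Suc.prems by (intro loc_unif_bilinear[OF assms(2)]) simp_all
  ultimately show ?case using Suc.prems by (auto intro!: differentiable_bilinear[OF assms(2)])
qed

lemma differentiable_inverse_real:
  fixes f :: "complex \<Rightarrow> real"
  assumes "f differentiable (at z)" "f z \<noteq> 0"
  shows "(\<lambda>w. inverse (f w)) differentiable (at z)"
  using assms by (intro differentiable_inverse) auto

text \<open>The derivative of \<open>1/f\<close> is \<open>-(1/f)^2\<close> times that of
  \<open>f\<close>, so the induction hypothesis for \<open>1/f\<close> itself supplies the next
  order.\<close>

lemma conv_upto_inverse: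
  fixes f :: "nat \<Rightarrow> complex \<Rightarrow> real"
  assumes "open U" "\<And>k z. z \<in> U \<Longrightarrow> f k z \<noteq> 0" "\<And>z. z \<in> U \<Longrightarrow> g z \<noteq> 0"
    and "conv_upto n U f g"
  shows "conv_upto n U (\<lambda>k z. inverse (f k z)) (\<lambda>z. inverse (g z))"
  using assms(4)
proof (induction n)
  case 0
  then show ?case using loc_unif_inverse assms by simp
next
  case (Suc n)
  note IH = Suc.IH[OF conv_upto_Suc_imp[OF Suc.prems]]
  have "conv_upto n U (\<lambda>k. pd i (\<lambda>z. inverse (f k z))) (pd i (\<lambda>z. inverse (g z)))" for i
  proof (rule conv_upto_cong[OF assms(1)])
    show "conv_upto n U (\<lambda>k z. - (inverse (f k z) * inverse (f k z) * pd i (f k) z))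
      (\<lambda>z. - (inverse (g z) * inverse (g z) * pd i g z))"
      by (intro conv_upto_linear[OF assms(1) bounded_linear_minus[OF bounded_linear_ident]]
                conv_upto_bilinear[OF assms(1) bounded_bilinear_mult] IH)
         (use Suc.prems in auto)
  qed (use Suc.prems assms in \<open>auto simp: pd_inverse\<close>)
  then show ?case using Suc.prems loc_unif_inverse assms
    by (simp add: differentiable_inverse_real)
qed

text \<open>Reverse induction on the list: \<open>conv_upto\<close> peels off the derivative taken
  first, and that is the last entry of the list.\<close>

lemma conv_upto_iter_pd:
  assumes "conv_upto (length is + m) U f g"
  shows "conv_upto m U (\<lambda>k. iter_pd is (f k)) (iter_pd is g)"
  using assms
proof (induction "is" arbitrary: f g rule: rev_induct)
  case Nil
  then show ?case by simp
next
  case (snoc i "is")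
  then show ?case by (simp add: iter_pd_snoc)
qed

lemma Cinf_loc_tendsto_if_smooth_conv:
  assumes "open U" "smooth_conv U f g"
  shows "Cinf_loc_tendsto U f g"
proof -
  have "conv_upto 1 U (\<lambda>k. iter_pd is (f k)) (iter_pd is g)" for "is"
    using assms by (intro conv_upto_iter_pd) (simp add: smooth_conv_def)
  then show ?thesis
    using assms(1) unfolding Cinf_loc_tendsto_def smooth_on_def
    by (simp add: loc_unif_def)
qed

lemma smooth_conv_const: "c \<longlonglongrightarrow> d \<Longrightarrow> smooth_conv U (\<lambda>k z. c k) (\<lambda>z. d)"
  by (simp add: smooth_conv_def conv_upto_const)

lemma smooth_conv_const': "smooth_conv U (\<lambda>k z. d) (\<lambda>z. d)"
  by (simp add: smooth_conv_const)

lemma smooth_conv_ident: "smooth_conv U (\<lambda>k z. z) (\<lambda>z. z)"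
  by (simp add: smooth_conv_def conv_upto_ident)

context
  fixes U :: "complex set"
  assumes U: "open U"
begin

lemma smooth_conv_linear:
  "bounded_linear L \<Longrightarrow> smooth_conv U f g \<Longrightarrow> smooth_conv U (\<lambda>k z. L (f k z)) (\<lambda>z. L (g z))"
  using U by (simp add: smooth_conv_def conv_upto_linear)

lemma smooth_conv_bilinear:
  "bounded_bilinear B \<Longrightarrow> smooth_conv U f g \<Longrightarrow> smooth_conv U f' g' \<Longrightarrow>
    smooth_conv U (\<lambda>k z. B (f k z) (f' k z)) (\<lambda>z. B (g z) (g' z))"
  using U by (simp add: smooth_conv_def conv_upto_bilinear)

lemma smooth_conv_add:
  "smooth_conv U f g \<Longrightarrow> smooth_conv U f' g' \<Longrightarrow>
    smooth_conv U (\<lambda>k z. f k z + f' k z) (\<lambda>z. g z + g' z)"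
  using U by (simp add: smooth_conv_def conv_upto_add)

lemma smooth_conv_inverse:
  fixes g :: "complex \<Rightarrow> real"
  assumes "smooth_conv U f g" "\<And>k z. z \<in> U \<Longrightarrow> f k z \<noteq> 0" "\<And>z. z \<in> U \<Longrightarrow> g z \<noteq> 0"
  shows "smooth_conv U (\<lambda>k z. inverse (f k z)) (\<lambda>z. inverse (g z))"
  using assms U by (simp add: smooth_conv_def conv_upto_inverse)

lemmas smooth_conv_mult = smooth_conv_bilinear[OF bounded_bilinear_mult]
lemmas smooth_conv_scaleR = smooth_conv_bilinear[OF bounded_bilinear_scaleR]
lemmas smooth_conv_Re = smooth_conv_linear[OF bounded_linear_Re]
lemmas smooth_conv_Im = smooth_conv_linear[OF bounded_linear_Im]
lemmas smooth_conv_cnj = smooth_conv_linear[OF bounded_linear_cnj]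
lemmas smooth_conv_minus = smooth_conv_linear[OF bounded_linear_minus[OF bounded_linear_ident]]

lemma smooth_conv_diff:
  "smooth_conv U f g \<Longrightarrow> smooth_conv U f' g' \<Longrightarrow>
    smooth_conv U (\<lambda>k z. f k z - f' k z) (\<lambda>z. g z - g' z)"
  using smooth_conv_add[OF _ smooth_conv_minus, of f g f' g'] by simp

lemma smooth_conv_divide:
  fixes g :: "complex \<Rightarrow> real"
  assumes "smooth_conv U f g" "smooth_conv U f' g'" "\<And>k z. z \<in> U \<Longrightarrow> f' k z \<noteq> 0" "\<And>z. z \<in> U \<Longrightarrow> g' z \<noteq> 0"
  shows "smooth_conv U (\<lambda>k z. f k z / f' k z) (\<lambda>z. g z / g' z)"
  using smooth_conv_mult[OF assms(1) smooth_conv_inverse[OF assms(2-4)]]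
  by (simp add: divide_inverse)

lemma smooth_conv_power:
  fixes g :: "complex \<Rightarrow> 'a::{real_normed_algebra,comm_monoid_mult,monoid_mult}"
  assumes "smooth_conv U f g"
  shows "smooth_conv U (\<lambda>k z. f k z ^ n) (\<lambda>z. g z ^ n)"
  by (induction n) (auto intro!: smooth_conv_const' smooth_conv_mult assms)

lemma smooth_conv_vec3:
  fixes g :: "complex \<Rightarrow> real^3"
  assumes "\<And>i. smooth_conv U (\<lambda>k z. f k z $ i) (\<lambda>z. g z $ i)"
  shows "smooth_conv U f g"
proof -
  have v: "v = v$1 *\<^sub>R axis (1::3) (1::real) + v$2 *\<^sub>R axis (2::3) (1::real) + v$3 *\<^sub>R axis (3::3) (1::real)" for v :: "real^3"
    by (simp add: vec_eq_iff forall_3 axis_def)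
  have "smooth_conv U (\<lambda>k z. f k z$1 *\<^sub>R axis (1::3) (1::real) + f k z$2 *\<^sub>R axis (2::3) (1::real) + f k z$3 *\<^sub>R axis (3::3) (1::real))
    (\<lambda>z. g z$1 *\<^sub>R axis (1::3) (1::real) + g z$2 *\<^sub>R axis (2::3) (1::real) + g z$3 *\<^sub>R axis (3::3) (1::real))"
    by (intro smooth_conv_add smooth_conv_scaleR assms smooth_conv_const')
  then show ?thesis by (simp add: v[symmetric])
qed

lemma smooth_conv_cong:
  assumes "smooth_conv U f g" "\<And>k z. z \<in> U \<Longrightarrow> f k z = f' k z" "\<And>z. z \<in> U \<Longrightarrow> g z = g' z"
  shows "smooth_conv U f' g'"
  using assms(1) conv_upto_cong[OF U assms(2,3)] by (simp add: smooth_conv_def)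

end

lemmas smooth_conv_arith = smooth_conv_add smooth_conv_diff smooth_conv_mult smooth_conv_Re smooth_conv_Im
  smooth_conv_cnj smooth_conv_power smooth_conv_const' smooth_conv_ident

text \<open>Smoothness as convergence of a constant sequence: every closure rule for convergence is
  then also one for smoothness.\<close>

definition smooth :: "complex set \<Rightarrow> (complex \<Rightarrow> 'b::real_normed_vector) \<Rightarrow> bool" where
  "smooth U f \<longleftrightarrow> open U \<and> smooth_conv U (\<lambda>_. f) f"

lemma smooth_imp_smooth_on: "smooth U f \<Longrightarrow> smooth_on U f"
  using Cinf_loc_tendsto_if_smooth_conv[of U "\<lambda>_. f" f] by (simp add: smooth_def Cinf_loc_tendsto_def)

lemma smooth_pd: "smooth U f \<Longrightarrow> smooth U (pd i f)"
  unfolding smooth_def smooth_conv_def using conv_upto.simps(2)[of _ U "\<lambda>_. f" f] by blast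

lemma smooth_differentiable: "smooth U f \<Longrightarrow> z \<in> U \<Longrightarrow> f differentiable (at z)"
  unfolding smooth_def smooth_conv_def by (meson conv_upto.simps(2))

lemma smooth_continuous_on: "smooth U f \<Longrightarrow> continuous_on U f"
  unfolding smooth_def smooth_conv_def by (meson conv_upto.simps(1) loc_unif_def)

lemma smooth_cong: "smooth U f \<Longrightarrow> (\<And>z. z \<in> U \<Longrightarrow> f z = g z) \<Longrightarrow> smooth U g"
  unfolding smooth_def by (metis smooth_conv_cong)

text \<open>One differentiation suffices: the first derivatives are the quotients
  \<open>pd i f / f\<close>, already smooth by the quotient rule.\<close>

lemma smooth_ln:
  assumes f: "smooth U f" and pos: "\<And>z. z \<in> U \<Longrightarrow> f z > (0::real)"
  shows "smooth U (\<lambda>z. ln (f z))"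
proof -
  have U: "open U" using f by (simp add: smooth_def)
  have d: "((\<lambda>w. ln (f w)) has_derivative (\<lambda>v. f' v * inverse (f z))) (at z)"
    if "(f has_derivative f') (at z)" "z \<in> U" for f' z
    using has_derivative_ln[OF pos[OF that(2)] that(1)] .
  have df: "(\<lambda>w. ln (f w)) differentiable (at z)" if "z \<in> U" for z
    using d smooth_differentiable[OF f that] that by (metis differentiable_def)
  have pdl: "pd i (\<lambda>w. ln (f w)) z = pd i f z / f z" if z: "z \<in> U" for i z
  proof -
    from smooth_differentiable[OF f z] obtain f' where f': "(f has_derivative f') (at z)"
      by (auto simp: differentiable_def)
    show ?thesis using pd_eq[OF d[OF f' z]] pd_eq[OF f'] by (simp add: divide_inverse)
  qed
  have lu: "loc_unif U (\<lambda>_ z. ln (f z)) (\<lambda>z. ln (f z))"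
    using smooth_continuous_on[OF f] pos
    by (auto simp: loc_unif_def uniform_limit_iff intro!: continuous_intros dest: less_imp_neq[symmetric])
  have "smooth_conv U (\<lambda>_ z. pd i f z / f z) (\<lambda>z. pd i f z / f z)" for i
    using smooth_pd[OF f, of i] f pos
    by (intro smooth_conv_divide) (auto simp: smooth_def dest: less_imp_neq[symmetric])
  then have "smooth_conv U (\<lambda>_. pd i (\<lambda>w. ln (f w))) (pd i (\<lambda>w. ln (f w)))" for i
    by (rule smooth_conv_cong[OF U _ pdl[symmetric] pdl[symmetric]])
  then have "conv_upto n U (\<lambda>_ z. ln (f z)) (\<lambda>z. ln (f z))" for n
    using lu df by (cases n) (auto simp: smooth_conv_def)
  then show ?thesis using U by (simp add: smooth_def smooth_conv_def)
qed

section \<open>Jets and the Laplacian\<close>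

definition has_grad :: "(complex \<Rightarrow> 'b::real_normed_vector) \<Rightarrow> (2 \<Rightarrow> 'b) \<Rightarrow> complex \<Rightarrow> bool" where
  "has_grad f d z \<longleftrightarrow> (f has_derivative (\<lambda>v. Re v *\<^sub>R d 1 + Im v *\<^sub>R d 2)) (at z)"

lemma has_grad_pd: "has_grad f d z \<Longrightarrow> pd i f z = d i"
  using exhaust_2[of i] by (auto simp: has_grad_def pd_eq)

lemma has_grad_differentiable: "has_grad f d z \<Longrightarrow> f differentiable (at z)"
  by (auto simp: has_grad_def differentiable_def)

lemma has_grad_if_differentiable:
  assumes "f differentiable (at z)"
  shows "has_grad f (\<lambda>i. pd i f z) z"
proof -
  from assms obtain f' where f': "(f has_derivative f') (at z)" by (auto simp: differentiable_def)
  interpret f': linear f' using f' has_derivative_linear by blast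
  have "f' v = Re v *\<^sub>R pd 1 f z + Im v *\<^sub>R pd 2 f z" for v
  proof -
    have "f' v = f' (Re v *\<^sub>R 1 + Im v *\<^sub>R \<i>)"
      by (rule arg_cong[where f = f']) (simp add: complex_eq_iff)
    then show ?thesis by (simp add: f'.add f'.scale pd_eq[OF f'])
  qed
  then have "f' = (\<lambda>v. Re v *\<^sub>R pd 1 f z + Im v *\<^sub>R pd 2 f z)" by blast
  then show ?thesis using f' by (simp add: has_grad_def)
qed

lemma has_gradI:
  assumes "f differentiable (at z)" "\<And>i. pd i f z = d i"
  shows "has_grad f d z"
  using has_grad_if_differentiable[OF assms(1)] assms(2) by (simp add: has_grad_def)

text \<open>First and second derivatives are carried as explicit functions on \<open>V\<close>, so
  that the Laplacian of a composite expression is read off by composing jets. In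
  \<open>h z i j\<close> the derivative in direction \<open>i\<close> is taken first.\<close>

definition jet2 :: "complex set \<Rightarrow> (complex \<Rightarrow> 'b::real_normed_vector) \<Rightarrow> (complex \<Rightarrow> 2 \<Rightarrow> 'b) \<Rightarrow>
    (complex \<Rightarrow> 2 \<Rightarrow> 2 \<Rightarrow> 'b) \<Rightarrow> bool" where
  "jet2 V u g h \<longleftrightarrow> open V \<and>
     (\<forall>z\<in>V. has_grad u (g z) z \<and> (\<forall>i. has_grad (\<lambda>w. g w i) (h z i) z))"

definition Lap :: "(complex \<Rightarrow> real) \<Rightarrow> complex \<Rightarrow> real" where
  "Lap u z = pd 1 (pd 1 u) z + pd 2 (pd 2 u) z"

lemma jet2_pd:
  assumes "jet2 V u g h" "z \<in> V"
  shows "pd i u z = g z i" "pd j (pd i u) z = h z i j"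
proof -
  show "pd i u z = g z i" using assms by (auto simp: jet2_def has_grad_pd)
  have "pd j (pd i u) z = pd j (\<lambda>w. g w i) z"
    using assms by (intro pd_cong[of V]) (auto simp: jet2_def has_grad_pd)
  then show "pd j (pd i u) z = h z i j"
    using assms by (auto simp: jet2_def has_grad_pd)
qed

lemma jet2_Lap: "jet2 V u g h \<Longrightarrow> z \<in> V \<Longrightarrow> Lap u z = h z 1 1 + h z 2 2"
  by (simp add: Lap_def jet2_pd)

lemma jet2_if_smooth: "smooth V u \<Longrightarrow> jet2 V u (\<lambda>z i. pd i u z) (\<lambda>z i j. pd j (pd i u) z)"
  unfolding jet2_def
  by (auto intro!: has_grad_if_differentiable smooth_differentiable[of V] smooth_pd) (simp add: smooth_def)

lemma has_grad_bilinear: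
  assumes "bounded_bilinear B" "has_grad f d z" "has_grad f' d' z"
  shows "has_grad (\<lambda>w. B (f w) (f' w)) (\<lambda>i. B (f z) (d' i) + B (d i) (f' z)) z"
proof -
  note df = has_grad_differentiable[OF assms(2)] has_grad_differentiable[OF assms(3)]
  show ?thesis
    by (rule has_gradI[OF differentiable_bilinear[OF assms(1) df]])
       (simp only: pd_bilinear[OF assms(1) df] has_grad_pd[OF assms(2)] has_grad_pd[OF assms(3)])
qed

lemma has_grad_linear:
  assumes "bounded_linear L" "has_grad f d z"
  shows "has_grad (\<lambda>w. L (f w)) (\<lambda>i. L (d i)) z"
proof -
  note df = has_grad_differentiable[OF assms(2)]
  show ?thesis
    by (rule has_gradI[OF differentiable_linear[OF assms(1) df]])
       (simp only: pd_linear[OF assms(1) df] has_grad_pd[OF assms(2)])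
qed

lemma has_grad_add:
  assumes "has_grad f d z" "has_grad f' d' z"
  shows "has_grad (\<lambda>w. f w + f' w) (\<lambda>i. d i + d' i) z"
proof -
  note df = has_grad_differentiable[OF assms(1)] has_grad_differentiable[OF assms(2)]
  show ?thesis
    by (rule has_gradI[OF differentiable_add[OF df]])
       (simp only: pd_add[OF df] has_grad_pd[OF assms(1)] has_grad_pd[OF assms(2)])
qed

lemma has_grad_inverse:
  assumes "has_grad f d z" "f z \<noteq> (0::real)"
  shows "has_grad (\<lambda>w. inverse (f w)) (\<lambda>i. - (inverse (f z) * inverse (f z) * d i)) z"
proof -
  note df = has_grad_differentiable[OF assms(1)]
  show ?thesis
    by (rule has_gradI[OF differentiable_inverse_real[OF df assms(2)]])
       (simp only: pd_inverse[OF df assms(2)] has_grad_pd[OF assms(1)])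
qed

lemma has_grad_ln:
  assumes "has_grad f d z" "f z > (0::real)"
  shows "has_grad (\<lambda>w. ln (f w)) (\<lambda>i. inverse (f z) * d i) z"
  using has_derivative_ln[OF assms(2) assms(1)[unfolded has_grad_def]]
  by (simp add: has_grad_def algebra_simps)

lemma has_grad_cong:
  assumes "has_grad f d z" "open V" "z \<in> V" "\<And>w. w \<in> V \<Longrightarrow> f w = g w"
  shows "has_grad g d z"
  unfolding has_grad_def
  by (rule has_derivative_transform_within_open[OF assms(1)[unfolded has_grad_def] assms(2,3)])
     (rule assms(4))

lemma jet2_cong:
  assumes "jet2 V u g h" "\<And>z. z \<in> V \<Longrightarrow> u z = u' z" "\<And>z i. z \<in> V \<Longrightarrow> g z i = g' z i"
    "\<And>z i j. z \<in> V \<Longrightarrow> h z i j = h' z i j"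
  shows "jet2 V u' g' h'"
proof -
  have V: "open V" using assms(1) by (simp add: jet2_def)
  have "has_grad u' (g' z) z" if z: "z \<in> V" for z
  proof -
    have "g' z = g z" using assms(3)[OF z] by auto
    moreover have "has_grad u (g z) z" using assms(1) z by (simp add: jet2_def)
    ultimately show ?thesis using has_grad_cong[OF _ V z, of u "g z" u'] assms(2) by simp
  qed
  moreover have "has_grad (\<lambda>w. g' w i) (h' z i) z" if z: "z \<in> V" for z i
  proof -
    have "h' z i = h z i" using assms(4)[OF z] by auto
    moreover have "has_grad (\<lambda>w. g w i) (h z i) z" using assms(1) z by (simp add: jet2_def)
    ultimately show ?thesis
      using has_grad_cong[OF _ V z, of "\<lambda>w. g w i" "h z i" "\<lambda>w. g' w i"] assms(3) by simp
  qed
  ultimately show ?thesis using assms(1) by (simp add: jet2_def)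
qed

lemma jet2_bilinear:
  assumes "bounded_bilinear B" "jet2 V u g h" "jet2 V u' g' h'"
  shows "jet2 V (\<lambda>w. B (u w) (u' w)) (\<lambda>w i. B (u w) (g' w i) + B (g w i) (u' w))
    (\<lambda>w i j. (B (u w) (h' w i j) + B (g w j) (g' w i)) + (B (g w i) (g' w j) + B (h w i j) (u' w)))"
  unfolding jet2_def
proof (intro conjI ballI allI)
  fix z i assume z: "z \<in> V"
  have g: "has_grad u (g z) z" "has_grad u' (g' z) z"
    "has_grad (\<lambda>w. g w i) (h z i) z" "has_grad (\<lambda>w. g' w i) (h' z i) z"
    using assms(2,3) z by (simp_all add: jet2_def)
  show "has_grad (\<lambda>w. B (u w) (u' w)) (\<lambda>i. B (u z) (g' z i) + B (g z i) (u' z)) z"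
    using has_grad_bilinear[OF assms(1) g(1,2)] .
  show "has_grad (\<lambda>w. B (u w) (g' w i) + B (g w i) (u' w))
         (\<lambda>j. (B (u z) (h' z i j) + B (g z j) (g' z i)) + (B (g z i) (g' z j) + B (h z i j) (u' z))) z"
    using has_grad_add[OF has_grad_bilinear[OF assms(1) g(1,4)] has_grad_bilinear[OF assms(1) g(3,2)]] .
qed (use assms(2) in \<open>simp add: jet2_def\<close>)

lemma jet2_add:
  assumes "jet2 V u g h" "jet2 V u' g' h'"
  shows "jet2 V (\<lambda>w. u w + u' w) (\<lambda>w i. g w i + g' w i) (\<lambda>w i j. h w i j + h' w i j)"
  unfolding jet2_def
proof (intro conjI ballI allI)
  fix z i assume z: "z \<in> V"
  have g: "has_grad u (g z) z" "has_grad u' (g' z) z"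
    "has_grad (\<lambda>w. g w i) (h z i) z" "has_grad (\<lambda>w. g' w i) (h' z i) z"
    using assms z by (simp_all add: jet2_def)
  show "has_grad (\<lambda>w. u w + u' w) (\<lambda>i. g z i + g' z i) z"
    using has_grad_add[OF g(1,2)] .
  show "has_grad (\<lambda>w. g w i + g' w i) (\<lambda>j. h z i j + h' z i j) z"
    using has_grad_add[OF g(3,4)] .
qed (use assms in \<open>simp add: jet2_def\<close>)

lemma jet2_linear:
  assumes "bounded_linear L" "jet2 V u g h"
  shows "jet2 V (\<lambda>w. L (u w)) (\<lambda>w i. L (g w i)) (\<lambda>w i j. L (h w i j))"
  unfolding jet2_def
proof (intro conjI ballI allI)
  fix z i assume z: "z \<in> V"
  have g: "has_grad u (g z) z" "has_grad (\<lambda>w. g w i) (h z i) z"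
    using assms(2) z by (simp_all add: jet2_def)
  show "has_grad (\<lambda>w. L (u w)) (\<lambda>i. L (g z i)) z"
    using has_grad_linear[OF assms(1) g(1)] .
  show "has_grad (\<lambda>w. L (g w i)) (\<lambda>j. L (h z i j)) z"
    using has_grad_linear[OF assms(1) g(2)] .
qed (use assms(2) in \<open>simp add: jet2_def\<close>)

lemma jet2_inverse:
  fixes u :: "complex \<Rightarrow> real"
  assumes "jet2 V u g h" "\<And>z. z \<in> V \<Longrightarrow> u z \<noteq> 0"
  shows "jet2 V (\<lambda>w. inverse (u w)) (\<lambda>w i. - (inverse (u w) * inverse (u w) * g w i))
    (\<lambda>w i j. 2 * inverse (u w) ^ 3 * g w i * g w j - inverse (u w) * inverse (u w) * h w i j)"
  unfolding jet2_def
proof (intro conjI ballI allI)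
  fix z i assume z: "z \<in> V"
  then have *: "has_grad (\<lambda>w. inverse (u w)) (\<lambda>i. - (inverse (u z) * inverse (u z) * g z i)) z"
    using assms by (auto simp: jet2_def intro!: has_grad_inverse)
  then show "has_grad (\<lambda>w. inverse (u w)) (\<lambda>i. - (inverse (u z) * inverse (u z) * g z i)) z" .
  have g: "has_grad (\<lambda>w. g w i) (h z i) z" using assms z by (auto simp: jet2_def)
  show "has_grad (\<lambda>w. - (inverse (u w) * inverse (u w) * g w i))
         (\<lambda>j. 2 * inverse (u z) ^ 3 * g z i * g z j - inverse (u z) * inverse (u z) * h z i j) z"
    using has_grad_linear[OF bounded_linear_minus[OF bounded_linear_ident]
      has_grad_bilinear[OF bounded_bilinear_mult has_grad_bilinear[OF bounded_bilinear_mult * *] g]]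
    by (rule back_subst[of "\<lambda>d. has_grad _ d z"]) (auto simp: algebra_simps power3_eq_cube)
qed (use assms in \<open>auto simp: jet2_def\<close>)

lemma jet2_ln:
  fixes u :: "complex \<Rightarrow> real"
  assumes "jet2 V u g h" "\<And>z. z \<in> V \<Longrightarrow> u z > 0"
  shows "jet2 V (\<lambda>w. ln (u w)) (\<lambda>w i. inverse (u w) * g w i)
    (\<lambda>w i j. inverse (u w) * h w i j - inverse (u w) * inverse (u w) * g w i * g w j)"
  unfolding jet2_def
proof (intro conjI ballI allI)
  fix z i assume z: "z \<in> V"
  show "has_grad (\<lambda>w. ln (u w)) (\<lambda>i. inverse (u z) * g z i) z"
    using assms z by (auto simp: jet2_def intro!: has_grad_ln)
  have g: "has_grad (\<lambda>w. g w i) (h z i) z" using assms z by (auto simp: jet2_def)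
  have "has_grad (\<lambda>w. inverse (u w)) (\<lambda>i. - (inverse (u z) * inverse (u z) * g z i)) z"
    using assms(1) assms(2)[OF z] z by (auto simp: jet2_def intro!: has_grad_inverse)
  from has_grad_bilinear[OF bounded_bilinear_mult this g]
  show "has_grad (\<lambda>w. inverse (u w) * g w i)
         (\<lambda>j. inverse (u z) * h z i j - inverse (u z) * inverse (u z) * g z i * g z j) z"
    by (rule back_subst[of "\<lambda>d. has_grad _ d z"]) (auto simp: algebra_simps)
qed (use assms in \<open>auto simp: jet2_def\<close>)

lemma bounded_bilinear_cross3: "bounded_bilinear cross3"
  using bilinear_cross by (simp add: bilinear_conv_bounded_bilinear)

lemma smooth_bilinear:
  "bounded_bilinear B \<Longrightarrow> smooth U f \<Longrightarrow> smooth U g \<Longrightarrow> smooth U (\<lambda>z. B (f z) (g z))"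
  unfolding smooth_def using smooth_conv_bilinear[of U B "\<lambda>_. f" f "\<lambda>_. g" g] by blast

lemma smooth_add: "smooth U f \<Longrightarrow> smooth U g \<Longrightarrow> smooth U (\<lambda>z. f z + g z)"
  unfolding smooth_def using smooth_conv_add[of U "\<lambda>_. f" f "\<lambda>_. g" g] by blast

lemma smooth_linear: "bounded_linear L \<Longrightarrow> smooth U f \<Longrightarrow> smooth U (\<lambda>z. L (f z))"
  unfolding smooth_def using smooth_conv_linear[of U L "\<lambda>_. f" f] by blast

lemma smooth_divide:
  "smooth U f \<Longrightarrow> smooth U g \<Longrightarrow> (\<And>z. z \<in> U \<Longrightarrow> g z \<noteq> (0::real)) \<Longrightarrow> smooth U (\<lambda>z. f z / g z)"
  unfolding smooth_def using smooth_conv_divide[of U "\<lambda>_. f" f "\<lambda>_. g" g] by blast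

section \<open>Conformal parametrizations\<close>

definition conformal_at :: "(complex \<Rightarrow> real^3) \<Rightarrow> real \<Rightarrow> complex \<Rightarrow> bool" where
  "conformal_at f \<mu> z \<longleftrightarrow> 0 < \<mu> \<and> pd 1 f z \<bullet> pd 1 f z = \<mu> \<and> pd 2 f z \<bullet> pd 2 f z = \<mu> \<and> pd 1 f z \<bullet> pd 2 f z = 0"

lemma conformal_metric:
  assumes "conformal_at f \<mu> z"
  shows "metric f z $ i $ j = (if i = j then \<mu> else 0)"
    "matrix_inv (metric f z) $ i $ j = (if i = j then 1 / \<mu> else 0)"
    "area_density f z = \<mu>"
proof -
  have m: "metric f z = mat \<mu>"
    using assms exhaust_2 by (auto simp: metric_def conformal_at_def vec_eq_iff forall_2 mat_def inner_commute)
  have I: "mat \<mu> ** mat (1 / \<mu>) = (mat 1 :: real^2^2)" "mat (1 / \<mu>) ** mat \<mu> = (mat 1 :: real^2^2)"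
    using assms by (auto simp: conformal_at_def matrix_matrix_mult_def mat_def vec_eq_iff forall_2 sum_2)
  \<comment> \<open>\<open>matrix_inv\<close> is a choice among two-sided inverses; its value
    follows from their uniqueness.\<close>
  have "matrix_inv (mat \<mu> :: real^2^2) = mat (1 / \<mu>)"
  proof -
    define N :: "real^2^2" where "N = matrix_inv (mat \<mu>)"
    have "mat \<mu> ** N = mat 1 \<and> N ** mat \<mu> = mat 1"
      unfolding N_def matrix_inv_def by (rule someI_ex) (use I in blast)
    then have "N = N ** (mat \<mu> ** mat (1 / \<mu>))" "N ** mat \<mu> = mat 1" using I by simp_all
    then show ?thesis by (simp add: matrix_mul_assoc flip: N_def)
  qed
  then show "metric f z $ i $ j = (if i = j then \<mu> else 0)"
    "matrix_inv (metric f z) $ i $ j = (if i = j then 1 / \<mu> else 0)"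
    by (auto simp: m mat_def)
  show "area_density f z = \<mu>"
    using assms by (simp add: area_density_def m det_2 mat_def conformal_at_def)
qed

lemma conformal_trace:
  assumes "conformal_at f \<mu> z"
  shows "tensor_trace (metric f z) T = (T$1$1 + T$2$2) / \<mu>"
    "tensor_norm_sq (metric f z) T = ((T$1$1)\<^sup>2 + (T$1$2)\<^sup>2 + (T$2$1)\<^sup>2 + (T$2$2)\<^sup>2) / \<mu>\<^sup>2"
  by (simp_all add: tensor_trace_def tensor_norm_sq_def conformal_metric[OF assms] sum_2 add_divide_distrib power2_eq_square)

lemma norm_cross_conformal:
  assumes "conformal_at f \<mu> z"
  shows "norm (cross3 (pd 1 f z) (pd 2 f z)) = \<mu>"
proof -
  have "(norm (cross3 (pd 1 f z) (pd 2 f z)))\<^sup>2 = \<mu>\<^sup>2"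
    unfolding power2_norm_eq_inner using assms
    by (simp add: dot_cross conformal_at_def inner_commute power2_eq_square)
  then show ?thesis using assms by (simp add: conformal_at_def)
qed

lemma conformal_gauss_map:
  assumes "conformal_at f \<mu> z"
  shows "gauss_map f z = (1 / \<mu>) *\<^sub>R cross3 (pd 1 f z) (pd 2 f z)"
  by (simp add: gauss_map_def sgn_div_norm norm_cross_conformal[OF assms] inverse_eq_divide)

lemma conformal_mean_curvature:
  assumes "conformal_at f \<mu> z"
  shows "mean_curvature f z = ((pd 1 (pd 1 f) z + pd 2 (pd 2 f) z) \<bullet> cross3 (pd 1 f z) (pd 2 f z)) / (2 * \<mu>\<^sup>2)"
  by (simp add: mean_curvature_def conformal_trace[OF assms] second_ff_def conformal_gauss_map[OF assms]
      inner_add_left add_divide_distrib power2_eq_square)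

text \<open>In dimension two the area density and the inverse of a conformal metric cancel, leaving
  the flat Laplacian divided by the conformal factor.\<close>

lemma conformal_laplace_beltrami:
  assumes "open V" "z \<in> V" "\<And>w. w \<in> V \<Longrightarrow> conformal_at f (\<mu> w) w"
  shows "laplace_beltrami f u z = Lap u z / \<mu> z"
proof -
  have "pd i (\<lambda>w. \<Sum>j\<in>UNIV. area_density f w * matrix_inv (metric f w) $ i $ j * pd j u w) z
      = pd i (pd i u) z" for i :: 2
  proof (rule pd_cong[OF assms(1,2)])
    fix w assume w: "w \<in> V"
    then have "\<mu> w \<noteq> 0" using assms(3)[OF w] by (auto simp: conformal_at_def)
    then show "(\<Sum>j\<in>UNIV. area_density f w * matrix_inv (metric f w) $ i $ j * pd j u w) = pd i u w"
      using exhaust_2[of i] by (auto simp: conformal_metric[OF assms(3)[OF w]] sum_2)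
  qed
  then show ?thesis by (simp add: laplace_beltrami_def conformal_metric(3)[OF assms(3)[OF assms(2)]] sum_2 Lap_def)
qed

lemma conformal_inj:
  assumes "f differentiable (at z)" "conformal_at f \<mu> z"
  shows "inj (frechet_derivative f (at z))"
proof -
  have D: "frechet_derivative f (at z) = (\<lambda>v. Re v *\<^sub>R pd 1 f z + Im v *\<^sub>R pd 2 f z)"
    using frechet_derivative_at[OF has_grad_if_differentiable[OF assms(1), unfolded has_grad_def]] by simp
  interpret linear "frechet_derivative f (at z)"
    using assms(1) linear_frechet_derivative by blast
  have "v = 0" if "frechet_derivative f (at z) v = 0" for v
  proof -
    have "0 = frechet_derivative f (at z) v \<bullet> frechet_derivative f (at z) v" using that by simp
    also have "\<dots> = \<mu> * ((Re v)\<^sup>2 + (Im v)\<^sup>2)"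
      using assms(2) by (simp add: D conformal_at_def inner_add_left inner_add_right inner_commute
          power2_eq_square algebra_simps)
    finally show "v = 0" using assms(2) by (simp add: conformal_at_def sum_power2_eq_zero_iff complex_eq_iff)
  qed
  then show ?thesis using linear_injective_0 linear_axioms by blast
qed

section \<open>Orthogonal frames\<close>

text \<open>Models the two coordinate tangent vectors of a conformal chart. The third vector is
  their cross product, of length \<open>\<rho>\<close> and not \<open>sqrt \<rho>\<close>, whence
  the denominators \<open>\<rho> * \<rho>\<close> below.\<close>

locale frame =
  fixes a b :: "real^3" and \<rho> :: real
  assumes aa: "a \<bullet> a = \<rho>" and bb: "b \<bullet> b = \<rho>" and ab: "a \<bullet> b = 0" and pos: "0 < \<rho>"
begin

abbreviation "m \<equiv> cross3 a b"

lemma frame_simps: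
  "a \<bullet> a = \<rho>" "b \<bullet> b = \<rho>" "a \<bullet> b = 0" "b \<bullet> a = 0" "m \<bullet> a = 0" "m \<bullet> b = 0" "a \<bullet> m = 0" "b \<bullet> m = 0"
  "m \<bullet> m = \<rho> * \<rho>" "cross3 b a = - m" "cross3 b m = \<rho> *\<^sub>R a" "cross3 m b = - (\<rho> *\<^sub>R a)"
  "cross3 m a = \<rho> *\<^sub>R b" "cross3 a m = - (\<rho> *\<^sub>R b)"
proof -
  show "cross3 b m = \<rho> *\<^sub>R a" "cross3 a m = - (\<rho> *\<^sub>R b)"
    using aa bb ab by (simp_all add: Lagrange inner_commute)
  then show "cross3 m b = - (\<rho> *\<^sub>R a)" "cross3 m a = \<rho> *\<^sub>R b"
    using cross_skew[of m b] cross_skew[of m a] by simp_all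
qed (use aa bb ab in \<open>simp_all add: dot_cross_self dot_cross inner_commute cross_skew[of b a]\<close>)

lemma expand: "w = (w \<bullet> a / \<rho>) *\<^sub>R a + (w \<bullet> b / \<rho>) *\<^sub>R b + (w \<bullet> m / (\<rho> * \<rho>)) *\<^sub>R m"
proof -
  define y where "y = w - ((w \<bullet> a / \<rho>) *\<^sub>R a + (w \<bullet> b / \<rho>) *\<^sub>R b + (w \<bullet> m / (\<rho> * \<rho>)) *\<^sub>R m)"
  have y: "y \<bullet> a = 0" "y \<bullet> b = 0" "y \<bullet> m = 0"
    using pos by (simp_all add: y_def inner_diff_left inner_add_left frame_simps)
  \<comment> \<open>A vector orthogonal to \<open>a\<close> and \<open>b\<close> is parallel to
    \<open>m\<close>; being orthogonal to \<open>m\<close> as well, it vanishes.\<close>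
  have "cross3 y m = 0" using y by (simp add: Lagrange)
  then have "y = 0 \<or> m = 0" using norm_and_cross_eq_0[of y m] y by simp
  moreover have "m \<noteq> 0" using pos frame_simps(9) by force
  ultimately show ?thesis by (simp add: y_def)
qed

lemma norm_expand: "w \<bullet> w = ((w \<bullet> a)\<^sup>2 + (w \<bullet> b)\<^sup>2) / \<rho> + (w \<bullet> m)\<^sup>2 / (\<rho> * \<rho>)"
proof -
  have "w \<bullet> w = ((w \<bullet> a / \<rho>) *\<^sub>R a + (w \<bullet> b / \<rho>) *\<^sub>R b + (w \<bullet> m / (\<rho> * \<rho>)) *\<^sub>R m) \<bullet> w"
    using arg_cong[OF expand[of w], of "\<lambda>y. y \<bullet> w"] .
  then show ?thesis
    unfolding inner_add_left inner_scaleR_left inner_commute[of a w] inner_commute[of b w] inner_commute[of m w]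
    by (simp add: power2_eq_square add_divide_distrib)
qed

end

section \<open>Minimal surfaces and their inversions\<close>

lemma has_grad_vec:
  assumes "\<And>k. has_grad (\<lambda>w. f w k) (\<lambda>i. d i k) z"
  shows "has_grad (\<lambda>w. (\<chi> k. f w k) :: real^3) (\<lambda>i. \<chi> k. d i k) z"
proof -
  have v: "(\<chi> k. g k) = g 1 *\<^sub>R axis 1 1 + g 2 *\<^sub>R axis 2 1 + g 3 *\<^sub>R axis 3 (1::real)" for g :: "3 \<Rightarrow> real"
    by (simp add: vec_eq_iff forall_3 axis_def)
  have "has_grad (\<lambda>w. f w k *\<^sub>R (axis k 1 :: real^3)) (\<lambda>i. d i k *\<^sub>R axis k 1) z" for k
    using has_grad_linear[OF bounded_linear_scaleR_left assms] .
  then show ?thesis unfolding v by (intro has_grad_add)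
qed

lemma has_grad_Re_holomorphic:
  assumes "(\<psi> has_field_derivative \<psi>') (at z)"
  shows "has_grad (\<lambda>w. Re (c * \<psi> w)) (\<lambda>i. Re (c * coord_vec i * \<psi>')) z"
proof -
  have "((\<lambda>w. Re (c * \<psi> w)) has_derivative (\<lambda>h. Re (c * (\<psi>' * h)))) (at z)"
    using assms by (intro has_derivative_Re has_derivative_mult_right) (simp add: has_field_derivative_def)
  moreover have "(\<lambda>h. Re (c * (\<psi>' * h))) =
      (\<lambda>h. Re h *\<^sub>R Re (c * coord_vec 1 * \<psi>') + Im h *\<^sub>R Re (c * coord_vec 2 * \<psi>'))"
    by (rule ext) (simp add: algebra_simps)
  ultimately show ?thesis by (simp add: has_grad_def)
qed

context frame
begin

text \<open>With \<open>c\<close> and \<open>d\<close> the second derivatives \<open>X_11\<close>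
  and \<open>X_12\<close> and the hypotheses the differentiated conformality relations, this is what
  remains of the Jacobi equation for the support function \<open>X \<bullet> m / \<rho>\<close>
  after the Laplacian of \<open>\<rho>\<close> has cancelled and denominators are cleared. In frame
  coordinates \<open>c\<close> and \<open>d\<close> share their tangential coefficients up to a
  rotation, and the identity becomes polynomial.\<close>

lemma jacobi_algebra:
  assumes c: "c \<bullet> a = d \<bullet> b" "c \<bullet> b = - (d \<bullet> a)"
  shows "\<rho> * \<rho> * (4 * (X \<bullet> cross3 c d))
    - 2 * \<rho> * ((X \<bullet> (cross3 a d + cross3 c b)) * (2 * (c \<bullet> a)) + (X \<bullet> (cross3 d b - cross3 a c)) * (2 * (d \<bullet> a)))
    + (X \<bullet> m) * ((2 * (c \<bullet> a))\<^sup>2 + (2 * (d \<bullet> a))\<^sup>2) = 0"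
proof -
  define p q u v where "p = c \<bullet> a / \<rho>" and "q = d \<bullet> a / \<rho>" and "u = c \<bullet> m / (\<rho> * \<rho>)" and "v = d \<bullet> m / (\<rho> * \<rho>)"
  have pq: "c \<bullet> a = \<rho> * p" "d \<bullet> a = \<rho> * q" using pos by (simp_all add: p_def q_def)
  have c': "c = p *\<^sub>R a - q *\<^sub>R b + u *\<^sub>R m"
    by (subst expand[of c]) (simp add: c(2) p_def q_def u_def)
  have d': "d = q *\<^sub>R a + p *\<^sub>R b + v *\<^sub>R m"
    by (subst expand[of d]) (simp add: c(1) p_def q_def v_def)
  have cr: "cross3 c d = (p * p + q * q) *\<^sub>R m - (\<rho> * (u * p + v * q)) *\<^sub>R a - (\<rho> * (v * p - u * q)) *\<^sub>R b"
    "cross3 a d + cross3 c b = (2 * p) *\<^sub>R m - (\<rho> * u) *\<^sub>R a - (\<rho> * v) *\<^sub>R b"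
    "cross3 d b - cross3 a c = (2 * q) *\<^sub>R m - (\<rho> * v) *\<^sub>R a + (\<rho> * u) *\<^sub>R b"
    unfolding c' d'
    by (simp_all add: cross_add_left cross_add_right Cross3.left_diff_distrib Cross3.right_diff_distrib
        cross_mult_left cross_mult_right frame_simps algebra_simps scaleR_left_distrib scaleR_left_diff_distrib scaleR_right_distrib scaleR_right_diff_distrib)
      (simp_all add: vec_eq_iff)
  show ?thesis
    unfolding pq cr by (simp add: inner_add_right inner_diff_right power2_eq_square algebra_simps)
qed

end

section \<open>Minimal surfaces as real parts of holomorphic null curves\<close>

locale minimal_curve =
  fixes V :: "complex set" and \<phi> :: "3 \<Rightarrow> complex \<Rightarrow> complex"
  assumes V: "open V" and hol: "\<And>k. \<phi> k holomorphic_on V"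
    and null: "\<And>z. z \<in> V \<Longrightarrow> (\<Sum>k\<in>UNIV. (deriv (\<phi> k) z)\<^sup>2) = 0"
    and reg: "\<And>z. z \<in> V \<Longrightarrow> \<exists>k. deriv (\<phi> k) z \<noteq> 0"
begin

definition X :: "complex \<Rightarrow> real^3" where "X z = (\<chi> k. Re (\<phi> k z))"
text \<open>For holomorphic \<open>\<phi>\<close> the derivative of \<open>Re \<phi>\<close> in
  direction \<open>v\<close> is \<open>Re (v * \<phi>')\<close>. Writing all partial derivatives
  this way reduces harmonicity, as in \<open>X2_simps\<close>, to
  \<open>\<i> * \<i> = -1\<close>.\<close>

definition X1 :: "complex \<Rightarrow> 2 \<Rightarrow> real^3" where
  "X1 z i = (\<chi> k. Re (coord_vec i * deriv (\<phi> k) z))"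
definition X2 :: "complex \<Rightarrow> 2 \<Rightarrow> 2 \<Rightarrow> real^3" where
  "X2 z i j = (\<chi> k. Re (coord_vec i * coord_vec j * deriv (deriv (\<phi> k)) z))"
definition X3 :: "complex \<Rightarrow> 2 \<Rightarrow> 2 \<Rightarrow> 2 \<Rightarrow> real^3" where
  "X3 z i j l = (\<chi> k. Re (coord_vec i * coord_vec j * coord_vec l * deriv (deriv (deriv (\<phi> k))) z))"

text \<open>\<open>\<rho>\<close> is the conformal factor and \<open>m\<close> the normal of length
  \<open>\<rho>\<close>, so \<open>M / \<rho>\<close> is the support function; \<open>r\<close> is
  the squared distance from the centre of inversion, placed at the origin.\<close>

definition "\<rho> z = X1 z 1 \<bullet> X1 z 1"
definition "m z = cross3 (X1 z 1) (X1 z 2)"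
definition "M z = X z \<bullet> m z"
definition "r z = X z \<bullet> X z"

lemma has_field_derivatives:
  assumes "z \<in> V"
  shows "(\<phi> k has_field_derivative deriv (\<phi> k) z) (at z)"
    "(deriv (\<phi> k) has_field_derivative deriv (deriv (\<phi> k)) z) (at z)"
    "(deriv (deriv (\<phi> k)) has_field_derivative deriv (deriv (deriv (\<phi> k))) z) (at z)"
  using V hol assms by (auto intro!: holomorphic_derivI holomorphic_deriv)

lemma X_jet: "jet2 V X X1 X2"
proof -
  have "has_grad X (X1 z) z" if "z \<in> V" for z
    using has_grad_vec[OF has_grad_Re_holomorphic[OF has_field_derivatives(1)[OF that], of 1]]
    by (simp add: X_def[abs_def] X1_def[abs_def])
  moreover have "has_grad (\<lambda>w. X1 w i) (X2 z i) z" if "z \<in> V" for z i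
    using has_grad_vec[OF has_grad_Re_holomorphic[OF has_field_derivatives(2)[OF that], of "coord_vec i"]]
    by (simp add: X1_def[abs_def] X2_def[abs_def])
  ultimately show ?thesis using V by (simp add: jet2_def)
qed

lemma X1_jet: "jet2 V (\<lambda>z. X1 z i) (\<lambda>z. X2 z i) (\<lambda>z. X3 z i)"
proof -
  have "has_grad (\<lambda>w. X2 w i j) (X3 z i j) z" if "z \<in> V" for z j
    using has_grad_vec[OF has_grad_Re_holomorphic[OF has_field_derivatives(3)[OF that], of "coord_vec i * coord_vec j"]]
    by (simp add: X2_def[abs_def] X3_def[abs_def])
  then show ?thesis using X_jet by (simp add: jet2_def)
qed

lemma X2_simps [simp]: "X2 z 2 1 = X2 z 1 2" "X2 z 2 2 = - X2 z 1 1"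
  and X3_simps [simp]: "X3 z i 2 2 = - X3 z i 1 1"
  by (simp_all add: X2_def X3_def vec_eq_iff)

text \<open>The real part of the null condition says that the two tangent vectors have equal length,
  its imaginary part that they are orthogonal; regularity excludes length zero.\<close>

lemma frame_X: assumes "z \<in> V" shows "frame (X1 z 1) (X1 z 2) (\<rho> z)"
proof
  let ?d = "\<lambda>k. deriv (\<phi> k) z"
  have n: "(\<Sum>k\<in>UNIV. (Re (?d k))\<^sup>2 - (Im (?d k))\<^sup>2) = 0" "(\<Sum>k\<in>UNIV. Re (?d k) * Im (?d k)) = 0"
    using arg_cong[OF null[OF assms], of Re] arg_cong[OF null[OF assms], of Im]
    by (simp_all add: Re_power2 Im_power2 mult.assoc flip: sum_distrib_left)
  show "X1 z 2 \<bullet> X1 z 2 = \<rho> z" "X1 z 1 \<bullet> X1 z 2 = 0"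
    using n by (simp_all add: \<rho>_def X1_def inner_vec_def sum_subtractf sum_negf power2_eq_square)
  show "X1 z 1 \<bullet> X1 z 1 = \<rho> z" by (simp add: \<rho>_def)
  have "X1 z 1 \<noteq> 0"
  proof
    assume "X1 z 1 = 0"
    moreover from this have "X1 z 2 \<bullet> X1 z 2 = 0" using \<open>X1 z 2 \<bullet> X1 z 2 = \<rho> z\<close> by (simp add: \<rho>_def)
    ultimately have "?d k = 0" for k
      by (auto simp: X1_def vec_eq_iff complex_eq_iff)
    then show False using reg[OF assms] by blast
  qed
  then show "0 < \<rho> z" by (simp add: \<rho>_def)
qed

lemma null_deriv:
  assumes "z \<in> V"
  shows "X2 z 1 1 \<bullet> X1 z 1 = X2 z 1 2 \<bullet> X1 z 2" "X2 z 1 1 \<bullet> X1 z 2 = - (X2 z 1 2 \<bullet> X1 z 1)"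
proof -
  let ?d = "\<lambda>k. deriv (\<phi> k) z" and ?e = "\<lambda>k. deriv (deriv (\<phi> k)) z"
  have "((\<lambda>z. \<Sum>k\<in>UNIV. (deriv (\<phi> k) z)\<^sup>2) has_field_derivative (\<Sum>k\<in>UNIV. 2 * (?e k * ?d k))) (at z)"
    by (auto intro!: derivative_eq_intros has_field_derivatives[OF assms] simp: algebra_simps)
  \<comment> \<open>The null sum vanishes on the whole open set, so its derivative, twice the
    pairing of \<open>\<phi>'\<close> with \<open>\<phi>''\<close>, vanishes too.\<close>
  moreover have "((\<lambda>z. \<Sum>k\<in>UNIV. (deriv (\<phi> k) z)\<^sup>2) has_field_derivative 0) (at z)"
    using DERIV_const[of 0 "at z"]
    by (rule has_field_derivative_transform_within_open[OF _ V assms]) (simp add: null)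
  ultimately have *: "(\<Sum>k\<in>UNIV. ?e k * ?d k) = 0"
    using DERIV_unique by (fastforce simp flip: sum_distrib_left)
  show "X2 z 1 1 \<bullet> X1 z 1 = X2 z 1 2 \<bullet> X1 z 2" "X2 z 1 1 \<bullet> X1 z 2 = - (X2 z 1 2 \<bullet> X1 z 1)"
    using arg_cong[OF *, of Re] arg_cong[OF *, of Im]
    by (simp_all add: X1_def X2_def inner_vec_def sum.distrib sum_subtractf sum_negf)
qed

lemma null_deriv':
  assumes "z \<in> V"
  shows "X1 z 2 \<bullet> X2 z 1 2 = X1 z 1 \<bullet> X2 z 1 1" "X1 z 2 \<bullet> X2 z 1 1 = - (X1 z 1 \<bullet> X2 z 1 2)"
  using null_deriv[OF assms] by (simp_all add: inner_commute)

lemmas jet_inner = jet2_bilinear[OF bounded_bilinear_inner]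
lemmas jet_cross = jet2_bilinear[OF bounded_bilinear_cross3]
lemmas jet_mult = jet2_bilinear[OF bounded_bilinear_mult]

text \<open>This is the Gauss equation, \<open>-2 K = |A|^2\<close> on a minimal surface. The
  expansion of \<open>X_11\<close> and \<open>X_12\<close> in the frame splits the Laplacian of
  \<open>\<rho>\<close> into a tangential part, which cancels against the squared gradient of
  \<open>\<rho>\<close>, and the normal part on the right.\<close>

lemma Lap_ln_\<rho>:
  assumes z: "z \<in> V"
  shows "Lap (\<lambda>z. ln (\<rho> z)) z = 2 * ((X2 z 1 1 \<bullet> m z)\<^sup>2 + (X2 z 1 2 \<bullet> m z)\<^sup>2) / \<rho> z ^ 3"
proof -
  interpret F: frame "X1 z 1" "X1 z 2" "\<rho> z" by (rule frame_X[OF z])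
  note j = jet_inner[OF X1_jet[of 1] X1_jet[of 1], folded \<rho>_def]
  have pos': "\<rho> w > 0" if "w \<in> V" for w using frame_X[OF that] by (simp add: frame_def)
  show ?thesis
    using F.pos
    by (simp add: jet2_Lap[OF jet2_ln[OF j pos'] z])
      (simp add: F.norm_expand[of "X2 z 1 1"] F.norm_expand[of "X2 z 1 2"] null_deriv[OF z] null_deriv'[OF z] inner_commute
        m_def[symmetric] power2_eq_square power3_eq_cube field_simps)
qed

lemma \<rho>_pos: "z \<in> V \<Longrightarrow> \<rho> z > 0"
  using frame_X by (simp add: frame_def)

lemma r_eq:
  assumes z: "z \<in> V"
  shows "r z * \<rho> z * \<rho> z = \<rho> z * ((X z \<bullet> X1 z 1)\<^sup>2 + (X z \<bullet> X1 z 2)\<^sup>2) + (M z)\<^sup>2"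
proof -
  interpret F: frame "X1 z 1" "X1 z 2" "\<rho> z" by (rule frame_X[OF z])
  show ?thesis
    using F.norm_expand[of "X z"] F.pos
    by (simp add: r_def M_def m_def[symmetric] field_simps)
qed

text \<open>Since \<open>X\<close> is harmonic and conformal, \<open>r\<close> has Laplacian
  \<open>4 \<rho>\<close> and partial derivatives \<open>2 (X \<bullet> X_i)\<close>; by
  \<open>r_eq\<close> the resulting difference is the squared normal component of
  \<open>X\<close>.\<close>

lemma Lap_ln_r:
  assumes z: "z \<in> V" and nz: "\<And>w. w \<in> V \<Longrightarrow> X w \<noteq> 0"
  shows "Lap (\<lambda>z. ln (r z)) z = 4 * (M z)\<^sup>2 / (\<rho> z * (r z)\<^sup>2)"
proof -
  interpret F: frame "X1 z 1" "X1 z 2" "\<rho> z" by (rule frame_X[OF z])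
  note j = jet_inner[OF X_jet X_jet, folded r_def]
  have pos': "r w > 0" if "w \<in> V" for w using nz[OF that] by (simp add: r_def)
  have "4 * (M z)\<^sup>2 = 4 * \<rho> z * (\<rho> z * r z - ((X z \<bullet> X1 z 1)\<^sup>2 + (X z \<bullet> X1 z 2)\<^sup>2))"
    using r_eq[OF z] by (simp add: algebra_simps)
  then have *: "4 * (M z)\<^sup>2 / (\<rho> z * (r z)\<^sup>2) = 4 * (\<rho> z * r z - ((X z \<bullet> X1 z 1)\<^sup>2 + (X z \<bullet> X1 z 2)\<^sup>2)) / (r z)\<^sup>2"
    using F.pos by simp
  show ?thesis
    unfolding *
    using pos'[OF z]
    by (simp add: jet2_Lap[OF jet2_ln[OF j pos'] z] inner_commute F.frame_simps power2_eq_square field_simps)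
qed

lemma Jacobi_equation:
  assumes z: "z \<in> V"
  shows "Lap (\<lambda>z. M z * inverse (\<rho> z)) z + Lap (\<lambda>z. ln (\<rho> z)) z * (M z * inverse (\<rho> z)) = 0"
proof -
  interpret F: frame "X1 z 1" "X1 z 2" "\<rho> z" by (rule frame_X[OF z])
  note j\<rho> = jet_inner[OF X1_jet[of 1] X1_jet[of 1], folded \<rho>_def]
  note jm = jet_cross[OF X1_jet[of 1] X1_jet[of 2], folded m_def]
  note jM = jet_inner[OF X_jet jm, folded M_def]
  have nz: "\<rho> w \<noteq> 0" if "w \<in> V" for w using \<rho>_pos[OF that] by simp
  note jH = jet_mult[OF jM jet2_inverse[OF j\<rho> nz]]
  define c d where "c = X2 z 1 1" and "d = X2 z 1 2"
  have am: "X1 z 1 \<bullet> m z = 0" "X1 z 2 \<bullet> m z = 0"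
    by (simp_all add: m_def F.frame_simps)
  have dc: "cross3 d c = - cross3 c d" by (rule cross_skew)
  \<comment> \<open>Both triple products equal \<open>-(c \<bullet> m)\<close>, hence the terms
    pairing first derivatives of \<open>X\<close> and of \<open>m\<close> cancel, and the Laplacian
    of \<open>M\<close> is four times the triple product of \<open>X\<close>, \<open>c\<close> and
    \<open>d\<close>.\<close>
  have ac: "X1 z 1 \<bullet> cross3 c (X1 z 2) = - (c \<bullet> m z)" "X1 z 2 \<bullet> cross3 (X1 z 1) c = - (c \<bullet> m z)"
    using cross_triple[of "X1 z 1" "X1 z 2" c] cross_triple[of "X1 z 2" c "X1 z 1"] cross_triple[of c "X1 z 2" "X1 z 1"]
      cross_triple[of c "X1 z 1" "X1 z 2"]
    by (simp_all add: m_def inner_commute cross_skew[of "X1 z 2" "X1 z 1"] cross_skew[of "X1 z 2" c] cross_skew[of c "X1 z 1"])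
  have alg: "\<rho> z * \<rho> z * (4 * (X z \<bullet> cross3 c d))
    - 2 * \<rho> z * ((X z \<bullet> (cross3 (X1 z 1) d + cross3 c (X1 z 2))) * (2 * (c \<bullet> X1 z 1)) +
        (X z \<bullet> (cross3 d (X1 z 2) - cross3 (X1 z 1) c)) * (2 * (d \<bullet> X1 z 1)))
    + M z * ((2 * (c \<bullet> X1 z 1))\<^sup>2 + (2 * (d \<bullet> X1 z 1))\<^sup>2) = 0"
    using F.jacobi_algebra[of c d "X z"] null_deriv[OF z] by (simp add: c_def d_def M_def m_def)
  define h where "h = 2 * (c \<bullet> c) + 2 * (d \<bullet> d)"
  define M1 M2 g1 g2 where "M1 = X z \<bullet> (cross3 (X1 z 1) d + cross3 c (X1 z 2))"
    and "M2 = X z \<bullet> (cross3 d (X1 z 2) - cross3 (X1 z 1) c)" and "g1 = 2 * (c \<bullet> X1 z 1)" and "g2 = 2 * (d \<bullet> X1 z 1)"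
  have L1: "Lap (\<lambda>z. ln (\<rho> z)) z = h / \<rho> z - (g1\<^sup>2 + g2\<^sup>2) / (\<rho> z)\<^sup>2"
    using F.pos
    by (simp add: jet2_Lap[OF jet2_ln[OF j\<rho> \<rho>_pos] z] h_def g1_def g2_def c_def d_def inner_commute power2_eq_square field_simps)
  have L2: "Lap (\<lambda>z. M z * inverse (\<rho> z)) z = 4 * (X z \<bullet> cross3 c d) / \<rho> z - 2 * (M1 * g1 + M2 * g2) / (\<rho> z)\<^sup>2
     - M z * h / (\<rho> z)\<^sup>2 + 2 * M z * (g1\<^sup>2 + g2\<^sup>2) / (\<rho> z) ^ 3"
    using F.pos
    by (subst jet2_Lap[OF jH z])
       (simp_all only: h_def g1_def g2_def M1_def M2_def c_def[symmetric] d_def[symmetric] X2_simps X3_simps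
          inner_commute[of "X1 z 1" c] inner_commute[of "X1 z 1" d] inner_add_right inner_diff_right
          cross_minus_left cross_minus_right inner_minus_left inner_minus_right dc am ac dot_cross_self,
        simp_all add: inner_commute power2_eq_square power3_eq_cube field_simps)
  \<comment> \<open>The terms containing \<open>h\<close>, the Laplacian of \<open>\<rho>\<close>,
    cancel in this sum.\<close>
  have "Lap (\<lambda>z. M z * inverse (\<rho> z)) z + Lap (\<lambda>z. ln (\<rho> z)) z * (M z * inverse (\<rho> z)) =
    (\<rho> z * \<rho> z * (4 * (X z \<bullet> cross3 c d)) - 2 * \<rho> z * (M1 * g1 + M2 * g2) + M z * (g1\<^sup>2 + g2\<^sup>2)) / \<rho> z ^ 3"
    by (subst L1, subst L2) (use F.pos in \<open>simp add: field_simps power2_eq_square power3_eq_cube\<close>)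
  also have "\<dots> = 0" using alg by (simp add: M1_def M2_def g1_def g2_def)
  finally show ?thesis .
qed

end

context minimal_curve
begin

lemma conformal_X:
  assumes z: "z \<in> V"
  shows "conformal_at X (\<rho> z) z"
proof -
  interpret F: frame "X1 z 1" "X1 z 2" "\<rho> z" by (rule frame_X[OF z])
  show ?thesis
    using F.pos by (simp add: conformal_at_def jet2_pd[OF X_jet z] F.frame_simps)
qed

lemma E_density_X:
  assumes z: "z \<in> V"
  shows "tensor_norm_sq (metric X z) (second_ff X z) * area_density X z = Lap (\<lambda>z. ln (\<rho> z)) z"
proof -
  have "second_ff X z $ i $ j = X2 z j i \<bullet> m z / \<rho> z" for i j
    by (simp add: second_ff_def conformal_gauss_map[OF conformal_X[OF z]] jet2_pd[OF X_jet z] m_def)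
  note sf = this
  show ?thesis
    using \<rho>_pos[OF z]
    by (simp add: sf conformal_trace[OF conformal_X[OF z]] conformal_metric[OF conformal_X[OF z]] Lap_ln_\<rho>[OF z]
        power_divide power2_eq_square power3_eq_cube field_simps)
qed

end

section \<open>Curvature of the inverted surface\<close>

locale inverted_minimal_curve = minimal_curve +
  fixes f :: "complex \<Rightarrow> real^3"
  assumes nz: "\<And>z. z \<in> V \<Longrightarrow> X z \<noteq> 0" and f: "\<And>z. z \<in> V \<Longrightarrow> f z = inverse (r z) *\<^sub>R X z"
begin

definition "s z = inverse (r z)"

lemma r_pos: "z \<in> V \<Longrightarrow> r z > 0"
  using nz by (simp add: r_def)

lemma s_r: "z \<in> V \<Longrightarrow> s z * r z = 1"
  using r_pos by (force simp: s_def)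

abbreviation "\<xi> z i \<equiv> X z \<bullet> X1 z i"

lemma s_jet: "jet2 V s (\<lambda>z i. - 2 * (s z)\<^sup>2 * \<xi> z i)
   (\<lambda>z i j. 8 * s z ^ 3 * \<xi> z i * \<xi> z j - 2 * (s z)\<^sup>2 * (X1 z i \<bullet> X1 z j + X z \<bullet> X2 z i j))"
proof -
  note j = jet_inner[OF X_jet X_jet, folded r_def]
  have nz': "r z \<noteq> 0" if "z \<in> V" for z using r_pos[OF that] by simp
  show ?thesis
    by (rule jet2_cong[OF jet2_inverse[OF j]])
       (use nz' in \<open>auto simp: s_def inner_commute algebra_simps power2_eq_square\<close>)
qed

lemma f_jet: "jet2 V f (\<lambda>z i. s z *\<^sub>R X1 z i - (2 * (s z)\<^sup>2 * \<xi> z i) *\<^sub>R X z)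
   (\<lambda>z i j. s z *\<^sub>R X2 z i j - (2 * (s z)\<^sup>2 * \<xi> z j) *\<^sub>R X1 z i - (2 * (s z)\<^sup>2 * \<xi> z i) *\<^sub>R X1 z j
     + (8 * s z ^ 3 * \<xi> z i * \<xi> z j - 2 * (s z)\<^sup>2 * (X1 z i \<bullet> X1 z j + X z \<bullet> X2 z i j)) *\<^sub>R X z)"
  by (rule jet2_cong[OF jet2_bilinear[OF bounded_bilinear_scaleR s_jet X_jet]])
     (simp_all add: f s_def)

lemma f_grad: "z \<in> V \<Longrightarrow> pd i f z = s z *\<^sub>R X1 z i - (2 * (s z)\<^sup>2 * \<xi> z i) *\<^sub>R X z"
  using jet2_pd(1)[OF f_jet] .

text \<open>The differential of the inversion is \<open>s\<close> times a reflection; the deviation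
  from conformality is a multiple of \<open>1 - s r\<close>, which is zero.\<close>

lemma f_metric:
  assumes z: "z \<in> V"
  shows "pd i f z \<bullet> pd j f z = (s z)\<^sup>2 * (X1 z i \<bullet> X1 z j)"
proof -
  have "X z \<bullet> X z = r z" by (simp add: r_def)
  then have "pd i f z \<bullet> pd j f z = (s z)\<^sup>2 * (X1 z i \<bullet> X1 z j) - 4 * (s z)^3 * \<xi> z i * \<xi> z j * (1 - s z * r z)"
    unfolding f_grad[OF z]
    by (simp add: inner_diff_left inner_diff_right inner_commute power2_eq_square power3_eq_cube algebra_simps)
  then show ?thesis using s_r[OF z] by simp
qed

lemma conformal_f:
  assumes z: "z \<in> V"
  shows "conformal_at f ((s z)\<^sup>2 * \<rho> z) z"
proof -
  interpret F: frame "X1 z 1" "X1 z 2" "\<rho> z" by (rule frame_X[OF z])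
  show ?thesis
    using F.pos r_pos[OF z] by (simp add: conformal_at_def f_metric[OF z] F.frame_simps s_def)
qed

text \<open>The bracket is the reflection of \<open>m\<close> in the plane orthogonal to
  \<open>X\<close>; the minus sign records that inversion reverses orientation.\<close>

lemma f_cross:
  assumes z: "z \<in> V"
  shows "cross3 (pd 1 f z) (pd 2 f z) = - (s z)\<^sup>2 *\<^sub>R (m z - (2 * s z * M z) *\<^sub>R X z)"
proof -
  have rX: "X z \<bullet> X z = r z" by (simp add: r_def)
  \<comment> \<open>Evaluating the double cross product of \<open>X\<close> with \<open>m\<close> in
    two ways trades the mixed tangential products for \<open>m\<close> and \<open>X\<close>.\<close>
  have "cross3 (X z) (cross3 (X z) (m z)) = M z *\<^sub>R X z - r z *\<^sub>R m z"
    by (simp add: Lagrange M_def r_def)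
  moreover have "cross3 (X z) (m z) = \<xi> z 2 *\<^sub>R X1 z 1 - \<xi> z 1 *\<^sub>R X1 z 2"
    by (simp add: Lagrange m_def)
  ultimately have e: "\<xi> z 2 *\<^sub>R cross3 (X z) (X1 z 1) = \<xi> z 1 *\<^sub>R cross3 (X z) (X1 z 2) + M z *\<^sub>R X z - r z *\<^sub>R m z"
    by (simp add: Cross3.right_diff_distrib cross_mult_right algebra_simps)
  have "cross3 (pd 1 f z) (pd 2 f z) = (s z)\<^sup>2 *\<^sub>R m z
     - (2 * s z ^ 3) *\<^sub>R (\<xi> z 1 *\<^sub>R cross3 (X z) (X1 z 2) - \<xi> z 2 *\<^sub>R cross3 (X z) (X1 z 1))"
    unfolding f_grad[OF z]
    by (simp add: Cross3.left_diff_distrib Cross3.right_diff_distrib cross_mult_left cross_mult_right m_def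
        cross_skew[of "X1 z 1" "X z"] scaleR_right_diff_distrib power2_eq_square power3_eq_cube mult_ac)
  also have "\<dots> = (s z)\<^sup>2 *\<^sub>R m z - (2 * s z ^ 3) *\<^sub>R (r z *\<^sub>R m z - M z *\<^sub>R X z)"
    unfolding e by simp
  also have "\<dots> = (s z)\<^sup>2 *\<^sub>R m z - (2 * (s z)\<^sup>2 * (s z * r z)) *\<^sub>R m z + (2 * s z ^ 3 * M z) *\<^sub>R X z"
    by (simp add: scaleR_right_diff_distrib power2_eq_square power3_eq_cube mult_ac)
  also have "\<dots> = - (s z)\<^sup>2 *\<^sub>R (m z - (2 * s z * M z) *\<^sub>R X z)"
    unfolding s_r[OF z]
    by (simp add: scaleR_right_diff_distrib power2_eq_square power3_eq_cube mult_ac vec_eq_iff algebra_simps)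
  finally show ?thesis .
qed

text \<open>The first term is the rescaled second fundamental form of \<open>X\<close>, trace-free
  by minimality; the second is a multiple of the metric. So the formula already separates the
  trace-free part from the mean curvature.\<close>

lemma f_second_ff:
  assumes z: "z \<in> V"
  shows "second_ff f z $ i $ j = - (s z * (X2 z i j \<bullet> m z) + 2 * (s z)\<^sup>2 * M z * (X1 z i \<bullet> X1 z j)) / \<rho> z"
proof -
  define N where "N = m z - (2 * s z * M z) *\<^sub>R X z"
  have sz: "s z \<noteq> 0" using s_r[OF z] by auto
  have g: "gauss_map f z = - (1 / \<rho> z) *\<^sub>R N"
    using sz by (simp add: conformal_gauss_map[OF conformal_f[OF z]] f_cross[OF z] N_def)
  have m1: "X1 z i \<bullet> m z = 0" for i
    using exhaust_2[of i] frame.frame_simps[OF frame_X[OF z]] by (auto simp: m_def)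
  have sr: "s z * (X z \<bullet> X z) = 1" using s_r[OF z] by (simp add: r_def)
  have XN: "X z \<bullet> N = M z - 2 * M z * (s z * (X z \<bullet> X z))" "X1 z i \<bullet> N = - 2 * s z * M z * \<xi> z i"
      "X2 z i j \<bullet> N = X2 z i j \<bullet> m z - 2 * s z * M z * (X z \<bullet> X2 z i j)" for i j
    by (simp_all add: N_def inner_diff_right M_def m1 inner_commute[of "X1 z i" "X z" for i] inner_commute[of "X2 z i j" "X z" for i j])
  have "pd i (pd j f) z \<bullet> N = s z * (X2 z i j \<bullet> m z) + 2 * (s z)\<^sup>2 * M z * (X1 z i \<bullet> X1 z j)"
    unfolding jet2_pd(2)[OF f_jet z] inner_add_left inner_diff_left inner_scaleR_left XN sr
    using exhaust_2[of i] exhaust_2[of j]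
    by (auto simp: inner_commute power2_eq_square power3_eq_cube algebra_simps)
  then show ?thesis by (simp add: second_ff_def g add_divide_distrib diff_divide_distrib)
qed

lemma f_mean_curvature:
  assumes z: "z \<in> V"
  shows "mean_curvature f z = - 2 * (M z * inverse (\<rho> z))"
proof -
  interpret F: frame "X1 z 1" "X1 z 2" "\<rho> z" by (rule frame_X[OF z])
  have sz: "s z \<noteq> 0" using s_r[OF z] by auto
  show ?thesis
    using F.pos sz
    by (simp add: mean_curvature_def conformal_trace[OF conformal_f[OF z]] f_second_ff[OF z] F.frame_simps
        power2_eq_square field_simps)
qed

lemma W_density_f:
  assumes z: "z \<in> V"
  shows "(mean_curvature f z)\<^sup>2 * area_density f z = Lap (\<lambda>z. ln (r z)) z"
  using \<rho>_pos[OF z] r_pos[OF z]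
  by (simp add: f_mean_curvature[OF z] conformal_metric[OF conformal_f[OF z]] Lap_ln_r[OF z nz] s_def
      power2_eq_square field_simps)

text \<open>Here \<open>|A|^2\<close> is the trace-free square plus \<open>2 H^2\<close>. The
  trace-free energy is a conformal invariant, hence the energy density of the minimal surface, and
  \<open>2 H^2\<close> contributes twice the Willmore density.\<close>

lemma E_density_f:
  assumes z: "z \<in> V"
  shows "tensor_norm_sq (metric f z) (second_ff f z) * area_density f z
    = 2 * Lap (\<lambda>z. ln (r z)) z + Lap (\<lambda>z. ln (\<rho> z)) z"
proof -
  interpret F: frame "X1 z 1" "X1 z 2" "\<rho> z" by (rule frame_X[OF z])
  show ?thesis
    using F.pos r_pos[OF z]
    by (simp add: f_second_ff[OF z] conformal_trace[OF conformal_f[OF z]] conformal_metric[OF conformal_f[OF z]]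
        Lap_ln_r[OF z nz] Lap_ln_\<rho>[OF z] s_def F.frame_simps power2_eq_square power3_eq_cube field_simps)
qed

lemma Lap_mean_curvature:
  assumes z: "z \<in> V"
  shows "Lap (mean_curvature f) z + Lap (\<lambda>z. ln (\<rho> z)) z * mean_curvature f z = 0"
proof -
  note j\<rho> = jet_inner[OF X1_jet[of 1] X1_jet[of 1], folded \<rho>_def]
  note jM = jet_inner[OF X_jet jet_cross[OF X1_jet[of 1] X1_jet[of 2], folded m_def], folded M_def]
  have "\<exists>g h. jet2 V (\<lambda>z. inverse (\<rho> z)) g h"
    using jet2_inverse[OF j\<rho>] \<rho>_pos by (metis less_irrefl)
  then obtain g h where "jet2 V (\<lambda>z. inverse (\<rho> z)) g h" by blast
  from jet_mult[OF jM this] obtain g h where gh: "jet2 V (\<lambda>z. M z * inverse (\<rho> z)) g h" by blast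
  have "jet2 V (\<lambda>z. - 2 * (M z * inverse (\<rho> z))) (\<lambda>z i. - 2 * g z i) (\<lambda>z i j. - 2 * h z i j)"
    using jet2_linear[OF bounded_linear_mult_right gh] .
  then have "jet2 V (mean_curvature f) (\<lambda>z i. - 2 * g z i) (\<lambda>z i j. - 2 * h z i j)"
    by (rule jet2_cong) (simp_all add: f_mean_curvature)
  then have "Lap (mean_curvature f) z = - 2 * Lap (\<lambda>z. M z * inverse (\<rho> z)) z"
    using jet2_Lap[OF gh z] by (simp add: jet2_Lap[OF _ z])
  then show ?thesis using Jacobi_equation[OF z] f_mean_curvature[OF z] by (simp add: algebra_simps)
qed

text \<open>The trace-free square is the Laplacian of \<open>ln \<rho>\<close> divided by the
  conformal factor of \<open>f\<close>, the same factor that turns the flat Laplacian into that of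
  \<open>f\<close>. The Willmore equation is thus the Jacobi equation divided by this
  factor.\<close>

lemma willmore_f:
  assumes z: "z \<in> V"
  shows "laplace_beltrami f (mean_curvature f) z
     + tensor_norm_sq (metric f z) (tracefree_ff f z) * mean_curvature f z = 0"
proof -
  interpret F: frame "X1 z 1" "X1 z 2" "\<rho> z" by (rule frame_X[OF z])
  have sz: "s z \<noteq> 0" using s_r[OF z] by auto
  have tf: "tracefree_ff f z $ i $ j = - s z * (X2 z i j \<bullet> m z) / \<rho> z" for i j
    using F.pos exhaust_2[of i] exhaust_2[of j]
    by (auto simp: tracefree_ff_def f_second_ff[OF z] f_mean_curvature[OF z] conformal_metric[OF conformal_f[OF z]]
        F.frame_simps field_simps)
  have t: "tensor_norm_sq (metric f z) (tracefree_ff f z) = Lap (\<lambda>z. ln (\<rho> z)) z / ((s z)\<^sup>2 * \<rho> z)"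
    using F.pos sz
    by (simp add: conformal_trace[OF conformal_f[OF z]] tf Lap_ln_\<rho>[OF z] power2_eq_square power3_eq_cube field_simps)
  have "laplace_beltrami f (mean_curvature f) z = Lap (mean_curvature f) z / ((s z)\<^sup>2 * \<rho> z)"
    using conformal_laplace_beltrami[OF V z conformal_f] .
  then show ?thesis unfolding t
    using Lap_mean_curvature[OF z] by (simp flip: add_divide_distrib)
qed

end

section \<open>Continuation across the ends\<close>

lemma continuous_eq_off_finite:
  fixes g h :: "complex \<Rightarrow> 'a::t2_space"
  assumes "finite S" "continuous_on UNIV g" "continuous_on UNIV h" "\<And>z. z \<notin> S \<Longrightarrow> g z = h z"
  shows "g z = h z"
proof -
  have "closed {z. g z = h z}"
    using assms(2,3) by (rule closed_Collect_eq)
  moreover have "- S \<subseteq> {z. g z = h z}" using assms(4) by auto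
  ultimately have "closure (- S) \<subseteq> {z. g z = h z}" by (rule closure_minimal[rotated])
  moreover have "closure (- S) = UNIV"
    using assms(1) by (simp add: closure_complement empty_interior_finite)
  ultimately show ?thesis by blast
qed

text \<open>\<open>S\<close> is the set of ends, which inversion turns into points of
  \<open>f\<close>. Positivity of the continuous extension \<open>\<mu>\<close> of the conformal
  factor there is what keeps \<open>f\<close> immersed.\<close>

locale branched_inverted_curve = inverted_minimal_curve V \<phi> f for V \<phi> f +
  fixes S :: "complex set" and \<mu> :: "complex \<Rightarrow> real"
  assumes S: "finite S" "V = - S"
    and f_smooth: "smooth UNIV f"
    and \<mu>: "continuous_on UNIV \<mu>" "\<And>z. 0 < \<mu> z" "\<And>z. z \<in> V \<Longrightarrow> \<mu> z = (s z)\<^sup>2 * \<rho> z"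
begin

lemma conformal: "conformal_at f (\<mu> z) z"
proof -
  have c: "continuous_on UNIV (\<lambda>z. pd i f z \<bullet> pd j f z)" for i j
    using f_smooth by (intro continuous_on_inner smooth_continuous_on smooth_pd)
  have "pd 1 f z \<bullet> pd 1 f z = \<mu> z" "pd 2 f z \<bullet> pd 2 f z = \<mu> z" "pd 1 f z \<bullet> pd 2 f z = 0"
  proof -
    have *: "conformal_at f (\<mu> z) z" if "z \<notin> S" for z
      using conformal_f[of z] \<mu>(3)[of z] that S(2) by simp
    show "pd 1 f z \<bullet> pd 1 f z = \<mu> z"
      by (rule continuous_eq_off_finite[OF S(1) c \<mu>(1)]) (use * in \<open>simp add: conformal_at_def\<close>)
    show "pd 2 f z \<bullet> pd 2 f z = \<mu> z"
      by (rule continuous_eq_off_finite[OF S(1) c \<mu>(1)]) (use * in \<open>simp add: conformal_at_def\<close>)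
    show "pd 1 f z \<bullet> pd 2 f z = 0"
      by (rule continuous_eq_off_finite[OF S(1) c continuous_on_const]) (use * in \<open>simp add: conformal_at_def\<close>)
  qed
  then show ?thesis using \<mu>(2) by (simp add: conformal_at_def)
qed

lemma smooth_\<mu>: "smooth UNIV \<mu>"
  by (rule smooth_cong[OF smooth_bilinear[OF bounded_bilinear_inner smooth_pd[OF f_smooth] smooth_pd[OF f_smooth]], of 1 1])
     (use conformal in \<open>simp add: conformal_at_def\<close>)

text \<open>The conformal formula contains no normalised normal vector: it is a quotient of smooth
  functions with a nonvanishing denominator.\<close>

lemma smooth_mean_curvature: "smooth UNIV (mean_curvature f)"
proof (rule smooth_cong)
  have \<mu>': "\<mu> z \<noteq> 0" for z using \<mu>(2)[of z] by simp
  show "smooth UNIV (\<lambda>z. ((pd 1 (pd 1 f) z + pd 2 (pd 2 f) z) \<bullet> cross3 (pd 1 f z) (pd 2 f z)) / (2 * (\<mu> z * \<mu> z)))"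
    by (intro smooth_divide smooth_bilinear[OF bounded_bilinear_inner] smooth_bilinear[OF bounded_bilinear_cross3]
        smooth_add smooth_pd f_smooth smooth_linear[OF bounded_linear_mult_right]
        smooth_bilinear[OF bounded_bilinear_mult] smooth_\<mu>) (simp add: \<mu>')
qed (simp add: conformal_mean_curvature[OF conformal] power2_eq_square)

theorem willmore: "willmore_on UNIV f"
proof -
  have cf: "continuous_on UNIV (pd i f)" "continuous_on UNIV (pd i (pd j f))" for i j
    using f_smooth by (auto intro!: smooth_continuous_on smooth_pd)
  have \<mu>': "\<mu> z \<noteq> 0" for z using \<mu>(2)[of z] by simp
  have cH: "continuous_on UNIV (mean_curvature f)" "continuous_on UNIV (Lap (mean_curvature f))"
    using smooth_mean_curvature unfolding Lap_def[abs_def]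
    by (auto intro!: smooth_continuous_on smooth_pd smooth_add)
  have lb: "laplace_beltrami f (mean_curvature f) = (\<lambda>z. Lap (mean_curvature f) z / \<mu> z)"
    using conformal_laplace_beltrami[of UNIV _ f \<mu>] conformal by auto
  have sf: "second_ff f z $ i $ j = pd i (pd j f) z \<bullet> cross3 (pd 1 f z) (pd 2 f z) / \<mu> z" for i j z
    by (simp add: second_ff_def conformal_gauss_map[OF conformal])
  have ctf: "continuous_on UNIV (\<lambda>z. tracefree_ff f z $ i $ j)" for i j
  proof -
    have eq: "(\<lambda>z. tracefree_ff f z $ i $ j) = (\<lambda>z. pd i (pd j f) z \<bullet> cross3 (pd 1 f z) (pd 2 f z) / \<mu> z -
       mean_curvature f z * (if i = j then \<mu> z else 0))"
      by (simp add: tracefree_ff_def sf conformal_metric[OF conformal])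
    have "continuous_on UNIV (\<lambda>z. if i = j then \<mu> z else 0)" using \<mu>(1) by (cases "i = j") auto
    then show ?thesis
      unfolding eq using cf cH \<mu>(1) \<mu>' by (auto intro!: continuous_intros continuous_on_cross)
  qed
  have "laplace_beltrami f (mean_curvature f) z
     + tensor_norm_sq (metric f z) (tracefree_ff f z) * mean_curvature f z = 0" for z
    unfolding lb conformal_trace[OF conformal]
  proof (rule continuous_eq_off_finite[OF S(1) _ continuous_on_const])
    show "continuous_on UNIV (\<lambda>z. Lap (mean_curvature f) z / \<mu> z +
      ((tracefree_ff f z $ 1 $ 1)\<^sup>2 + (tracefree_ff f z $ 1 $ 2)\<^sup>2 + (tracefree_ff f z $ 2 $ 1)\<^sup>2 +
       (tracefree_ff f z $ 2 $ 2)\<^sup>2) / (\<mu> z)\<^sup>2 * mean_curvature f z)"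
      using \<mu>' by (intro continuous_on_add continuous_on_divide continuous_on_mult continuous_on_power ctf cH \<mu>(1)) auto
    show "Lap (mean_curvature f) z / \<mu> z +
      ((tracefree_ff f z $ 1 $ 1)\<^sup>2 + (tracefree_ff f z $ 1 $ 2)\<^sup>2 + (tracefree_ff f z $ 2 $ 1)\<^sup>2 +
       (tracefree_ff f z $ 2 $ 2)\<^sup>2) / (\<mu> z)\<^sup>2 * mean_curvature f z = 0" if "z \<notin> S" for z
      using willmore_f[of z] that S(2) by (simp add: lb conformal_trace[OF conformal])
  qed
  moreover have "immersion_on UNIV f"
    using f_smooth conformal_inj[OF smooth_differentiable[OF f_smooth] conformal]
    by (auto simp: immersion_on_def smooth_imp_smooth_on)
  ultimately show ?thesis by (simp add: willmore_on_def)
qed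

end

section \<open>The flux of a gradient at infinity\<close>

text \<open>Agreement on boxes determines Lebesgue measure; this identification gives access to
  Fubini on the complex plane.\<close>

lemma lborel_complex: "lborel = distr lborel borel (\<lambda>(x, y). Complex x y)"
proof (rule lborel_eqI)
  have m [measurable]: "(\<lambda>(x, y). Complex x y) \<in> borel_measurable (lborel :: (real \<times> real) measure)"
    by (auto simp: Complex_eq split_beta' intro!: borel_measurable_continuous_onI continuous_intros)
  fix l u :: complex assume le: "\<And>b. b \<in> Basis \<Longrightarrow> l \<bullet> b \<le> u \<bullet> b"
  have le': "Re l \<le> Re u" "Im l \<le> Im u" using le[of 1] le[of \<i>] by (auto simp: Basis_complex_def inner_complex_def)
  have "(\<lambda>(x, y). Complex x y) -` box l u \<inter> space lborel = box (Re l, Im l) (Re u, Im u)"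
    by (auto simp: box_def Basis_prod_def Basis_complex_def inner_complex_def)
  then have "emeasure (distr lborel borel (\<lambda>(x, y). Complex x y)) (box l u) = emeasure lborel (box (Re l, Im l) (Re u, Im u))"
    by (subst emeasure_distr) auto
  also have "\<dots> = ennreal (\<Prod>b\<in>Basis. ((Re u, Im u) - (Re l, Im l)) \<bullet> b)"
    using le' by (intro emeasure_lborel_box) (auto simp: Basis_prod_def)
  also have "\<dots> = (\<Prod>b\<in>Basis. (u - l) \<bullet> b)"
    by (simp add: Basis_prod_def Basis_complex_def inner_complex_def mult.commute)
  finally show "emeasure (distr lborel borel (\<lambda>(x, y). Complex x y)) (box l u) = (\<Prod>b\<in>Basis. (u - l) \<bullet> b)" .
qed simp

lemma nn_integral_complex:
  assumes "f \<in> borel_measurable (borel :: complex measure)"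
  shows "(\<integral>\<^sup>+ z. f z \<partial>lborel) = (\<integral>\<^sup>+ (x, y). f (Complex x y) \<partial>lborel)"
proof -
  have "(\<lambda>(x, y). Complex x y) \<in> borel_measurable (lborel :: (real \<times> real) measure)"
    by (auto simp: Complex_eq split_beta' intro!: borel_measurable_continuous_onI continuous_intros)
  then show ?thesis
    using assms by (subst lborel_complex, subst nn_integral_distr) (auto simp: split_beta')
qed

abbreviation square :: "real \<Rightarrow> complex set" where
  "square R \<equiv> cbox (Complex (- R) (- R)) (Complex R R)"

lemma has_grad_horizontal:
  assumes "has_grad u d (Complex x y)"
  shows "((\<lambda>x. u (Complex x y)) has_vector_derivative d 1) (at x within T)"
proof -
  have "((\<lambda>x. Complex x y) has_derivative (\<lambda>h. of_real h)) (at x within T)"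
    unfolding Complex_eq by (auto intro!: derivative_eq_intros)
  then have "((\<lambda>x. u (Complex x y)) has_derivative (\<lambda>h. Re (of_real h) *\<^sub>R d 1 + Im (of_real h) *\<^sub>R d 2)) (at x within T)"
    using assms unfolding has_grad_def by (rule has_derivative_compose)
  then show ?thesis by (simp add: has_vector_derivative_def)
qed

lemma has_grad_vertical:
  assumes "has_grad u d (Complex x y)"
  shows "((\<lambda>y. u (Complex x y)) has_vector_derivative d 2) (at y within T)"
proof -
  have "((\<lambda>y. Complex x y) has_derivative (\<lambda>h. \<i> * of_real h)) (at y within T)"
    unfolding Complex_eq by (auto intro!: derivative_eq_intros)
  then have "((\<lambda>y. u (Complex x y)) has_derivative (\<lambda>h. Re (\<i> * of_real h) *\<^sub>R d 1 + Im (\<i> * of_real h) *\<^sub>R d 2)) (at y within T)"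
    using assms unfolding has_grad_def by (rule has_derivative_compose)
  then show ?thesis by (simp add: has_vector_derivative_def)
qed

lemma continuous_Complex [continuous_intros]:
  "continuous_on S f \<Longrightarrow> continuous_on S g \<Longrightarrow> continuous_on S (\<lambda>x. Complex (f x) (g x))"
  unfolding Complex_eq by (intro continuous_intros)

text \<open>The divergence theorem for a gradient. On a square it amounts to Fubini and the
  fundamental theorem of calculus along each line.\<close>

lemma nn_integral_Lap_square:
  fixes u :: "complex \<Rightarrow> real"
  assumes u: "smooth UNIV u" and nonneg: "\<And>z. 0 \<le> Lap u z" and R: "0 \<le> R"
  shows "(\<integral>\<^sup>+ z. ennreal (Lap u z) * indicator (square R) z \<partial>lborel) =
    ennreal (integral {-R..R} (\<lambda>y. pd 1 u (Complex R y) - pd 1 u (Complex (-R) y)) +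
             integral {-R..R} (\<lambda>x. pd 2 u (Complex x R) - pd 2 u (Complex x (-R))))"
proof -
  have c2: "continuous_on UNIV (pd i (pd j u))" for i j
    using u by (intro smooth_continuous_on smooth_pd)
  have cC: "continuous_on S (\<lambda>(x, y). pd i (pd j u) (Complex x y))" for i j S
    unfolding split_beta' by (rule continuous_on_compose2[OF c2]) (auto intro!: continuous_intros)
  have cL: "continuous_on UNIV (Lap u)" unfolding Lap_def[abs_def] by (intro continuous_intros c2)
  have [measurable]: "Lap u \<in> borel_measurable borel" using cL by (rule borel_measurable_continuous_onI)
  have g: "has_grad (pd j u) (\<lambda>i. pd i (pd j u) z) z" for j z
    using u by (intro has_grad_if_differentiable smooth_differentiable[of UNIV] smooth_pd) auto
  let ?Q = "cbox (-R, -R) (R, R) :: (real \<times> real) set"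
  have "(\<integral>\<^sup>+ z. ennreal (Lap u z) * indicator (square R) z \<partial>lborel) =
      (\<integral>\<^sup>+ p. ennreal (case p of (x, y) \<Rightarrow> Lap u (Complex x y)) * indicator ?Q p \<partial>lborel)"
    by (subst nn_integral_complex, measurable)
       (auto intro!: nn_integral_cong simp: indicator_def in_cbox_complex_iff cbox_Pair_eq)
  also have "\<dots> = ennreal (integral ?Q (\<lambda>(x, y). Lap u (Complex x y)))"
  proof (rule nn_integral_has_integral_lebesgue')
    show "((\<lambda>(x, y). Lap u (Complex x y)) has_integral integral ?Q (\<lambda>(x, y). Lap u (Complex x y))) ?Q"
      unfolding split_beta'
      by (intro integrable_integral integrable_continuous continuous_on_compose2[OF cL])
         (auto intro!: continuous_intros)
  qed (auto simp: nonneg)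
  also have "integral ?Q (\<lambda>(x, y). Lap u (Complex x y)) =
      integral ?Q (\<lambda>(x, y). pd 1 (pd 1 u) (Complex x y)) + integral ?Q (\<lambda>(x, y). pd 2 (pd 2 u) (Complex x y))"
    by (subst integral_add[symmetric])
       (auto intro!: integrable_continuous cC[unfolded split_beta'] simp: Lap_def split_beta')
  also have "integral ?Q (\<lambda>(x, y). pd 2 (pd 2 u) (Complex x y)) =
      integral {-R..R} (\<lambda>x. integral {-R..R} (\<lambda>y. pd 2 (pd 2 u) (Complex x y)))"
    by (simp add: integral_prod_continuous[OF cC])
  also have "\<dots> = integral {-R..R} (\<lambda>x. pd 2 u (Complex x R) - pd 2 u (Complex x (-R)))"
  proof (rule integral_cong)
    fix x
    have "((\<lambda>y. pd 2 (pd 2 u) (Complex x y)) has_integral (pd 2 u (Complex x R) - pd 2 u (Complex x (-R)))) {-R..R}"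
      using R by (intro fundamental_theorem_of_calculus) (auto intro: has_grad_vertical[OF g])
    then show "integral {-R..R} (\<lambda>y. pd 2 (pd 2 u) (Complex x y)) = pd 2 u (Complex x R) - pd 2 u (Complex x (-R))"
      by (rule integral_unique)
  qed
  also have "integral ?Q (\<lambda>(x, y). pd 1 (pd 1 u) (Complex x y)) =
      integral {-R..R} (\<lambda>x. integral {-R..R} (\<lambda>y. pd 1 (pd 1 u) (Complex x y)))"
    by (simp add: integral_prod_continuous[OF cC])
  \<comment> \<open>The order is exchanged so that the second derivative in \<open>x\<close> is
    integrated along \<open>x\<close> first.\<close>
  also have "\<dots> = integral {-R..R} (\<lambda>y. integral {-R..R} (\<lambda>x. pd 1 (pd 1 u) (Complex x y)))"
    using integral_swap_continuous[OF cC, of "-R" R "-R" R 1 1] by simp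
  also have "\<dots> = integral {-R..R} (\<lambda>y. pd 1 u (Complex R y) - pd 1 u (Complex (-R) y))"
  proof (rule integral_cong)
    fix y
    have "((\<lambda>x. pd 1 (pd 1 u) (Complex x y)) has_integral (pd 1 u (Complex R y) - pd 1 u (Complex (-R) y))) {-R..R}"
      using R by (intro fundamental_theorem_of_calculus) (auto intro: has_grad_horizontal[OF g])
    then show "integral {-R..R} (\<lambda>x. pd 1 (pd 1 u) (Complex x y)) = pd 1 u (Complex R y) - pd 1 u (Complex (-R) y)"
      by (rule integral_unique)
  qed
  finally show ?thesis .
qed

text \<open>\<open>R / (R^2 + y^2)\<close> is the outward flux density of the gradient of
  \<open>ln |z|\<close> through an edge of the square, and the origin sees the edge under the angle
  \<open>pi / 2\<close>.\<close>

lemma has_integral_Cauchy_density: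
  assumes "R > 0"
  shows "((\<lambda>y. R / (R\<^sup>2 + y\<^sup>2)) has_integral (pi / 2)) {-R..R}"
proof -
  have "((\<lambda>y. arctan (y / R)) has_vector_derivative (R / (R\<^sup>2 + y\<^sup>2))) (at y within {-R..R})" for y
  proof -
    have "R\<^sup>2 + y\<^sup>2 \<noteq> 0" using assms by (simp add: sum_power2_eq_zero_iff)
    then have "((\<lambda>y. arctan (y / R)) has_real_derivative (R / (R\<^sup>2 + y\<^sup>2))) (at y within {-R..R})"
      using assms by (auto intro!: derivative_eq_intros simp: divide_simps power2_eq_square)
    then show ?thesis by (simp add: has_real_derivative_iff_has_vector_derivative)
  qed
  from fundamental_theorem_of_calculus[OF _ this] assms
  have "((\<lambda>y. R / (R\<^sup>2 + y\<^sup>2)) has_integral (arctan (R / R) - arctan (- R / R))) {-R..R}" by simp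
  moreover have "arctan (R / R) - arctan (- R / R) = pi / 2"
    using assms by (simp add: arctan_minus arctan_one)
  ultimately show ?thesis by (simp only:)
qed

text \<open>Meant for a pair of opposite edges: each carries \<open>c\<close> times the flux density
  of \<open>ln |z|\<close>, hence the factor 2 and the value \<open>c * pi\<close>, half of the
  total flux.\<close>

lemma integral_near_Cauchy:
  fixes h :: "real \<Rightarrow> real"
  assumes R: "R > 0" and c: "continuous_on {-R..R} h"
    and B: "\<And>y. y \<in> {-R..R} \<Longrightarrow> \<bar>h y - 2 * c * (R / (R\<^sup>2 + y\<^sup>2))\<bar> \<le> B"
  shows "\<bar>integral {-R..R} h - c * pi\<bar> \<le> B * (2 * R)"
proof -
  have "((\<lambda>y. 2 * c * (R / (R\<^sup>2 + y\<^sup>2))) has_integral (2 * c * (pi / 2))) {-R..R}"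
    by (rule has_integral_mult_right[OF has_integral_Cauchy_density[OF R]])
  moreover have "(h has_integral integral {-R..R} h) {-R..R}"
    using c by (intro integrable_integral integrable_continuous_interval)
  ultimately have "((\<lambda>y. h y - 2 * c * (R / (R\<^sup>2 + y\<^sup>2))) has_integral (integral {-R..R} h - 2 * c * (pi / 2))) {-R..R}"
    by (rule has_integral_diff[rotated])
  from has_integral_bound_real[OF _ finite.emptyI this, of B] B R B[of 0]
  show ?thesis by simp
qed

lemma has_grad_norm_power2: "has_grad (\<lambda>z. (cmod z)\<^sup>2) (\<lambda>i. if i = 1 then 2 * Re z else 2 * Im z) z"
proof -
  have "((\<lambda>z. (cmod z)\<^sup>2) has_derivative (\<lambda>v. 2 * (z \<bullet> v))) (at z)"
    unfolding power2_norm_eq_inner by (auto intro!: derivative_eq_intros simp: inner_commute)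
  then show ?thesis by (simp add: has_grad_def inner_complex_def algebra_simps)
qed

text \<open>The correction \<open>v (1 / z)\<close> has a gradient of order \<open>|z|^(-2)\<close>,
  so through a boundary of length \<open>8 R\<close> its flux is of order \<open>1 / R\<close>, and
  only the flux of \<open>c ln |z|\<close> survives. Nonnegativity allows monotone convergence along
  growing squares.\<close>

theorem nn_integral_Lap:
  fixes u v :: "complex \<Rightarrow> real"
  assumes u: "smooth UNIV u" and v: "smooth UNIV v"
    and uv: "\<And>z. z \<noteq> 0 \<Longrightarrow> u z = c * ln (cmod z) + v (1 / z)"
    and nonneg: "\<And>z. 0 \<le> Lap u z"
  shows "(\<integral>\<^sup>+ z. ennreal (Lap u z) \<partial>lborel) = ennreal (2 * pi * c)"
proof -
  have cv: "continuous_on (cball 0 1) (\<lambda>w. \<bar>pd 1 v w\<bar> + \<bar>pd 2 v w\<bar>)"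
    using v by (intro continuous_intros continuous_on_subset[OF smooth_continuous_on[OF smooth_pd[of UNIV]]]) auto
  have "\<exists>B>0. \<forall>w\<in>cball 0 1. norm (\<bar>pd 1 v w\<bar> + \<bar>pd 2 v w\<bar>) \<le> B"
    using compact_imp_bounded[OF compact_continuous_image[OF cv compact_cball]] by (auto simp: bounded_pos)
  then obtain B where B: "B > 0" "\<And>w. cmod w \<le> 1 \<Longrightarrow> \<bar>pd 1 v w\<bar> + \<bar>pd 2 v w\<bar> \<le> B"
    by force
  have est: "\<bar>pd i u z - c * (if i = 1 then Re z else Im z) / (cmod z)\<^sup>2\<bar> \<le> B / (cmod z)\<^sup>2"
    if z: "cmod z \<ge> 1" for z i
  proof -
    have nz: "z \<noteq> 0" using z by auto
    \<comment> \<open>The gradient of \<open>v (1 / z)\<close> by the chain rule; the factor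
      \<open>-1 / z^2\<close> is the source of the decay.\<close>
    define d where "d i = Re (- coord_vec i / z\<^sup>2) * pd 1 v (1/z) + Im (- coord_vec i / z\<^sup>2) * pd 2 v (1/z)" for i
    have "has_grad v (\<lambda>i. pd i v (1/z)) (1/z)"
      using v by (intro has_grad_if_differentiable smooth_differentiable[of UNIV]) auto
    then have V: "(v has_derivative (\<lambda>h. Re h *\<^sub>R pd 1 v (1/z) + Im h *\<^sub>R pd 2 v (1/z))) (at (1/z))"
      by (simp add: has_grad_def)
    have I: "((\<lambda>w. 1 / w) has_derivative (\<lambda>h. - h / z\<^sup>2)) (at z)"
      using nz by (auto intro!: derivative_eq_intros simp: power2_eq_square divide_simps)
    have "((\<lambda>w. v (1/w)) has_derivative (\<lambda>h. Re (- h / z\<^sup>2) *\<^sub>R pd 1 v (1/z) + Im (- h / z\<^sup>2) *\<^sub>R pd 2 v (1/z))) (at z)"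
      by (rule has_derivative_compose[OF I V])
    moreover have "Re (- h / z\<^sup>2) *\<^sub>R pd 1 v (1/z) + Im (- h / z\<^sup>2) *\<^sub>R pd 2 v (1/z) = Re h *\<^sub>R d 1 + Im h *\<^sub>R d 2" for h
    proof -
      have e: "- h / z\<^sup>2 = Re h *\<^sub>R (- coord_vec 1 / z\<^sup>2) + Im h *\<^sub>R (- coord_vec 2 / z\<^sup>2)"
        by (subst (1) complex_eq[of h]) (simp add: scaleR_conv_of_real diff_divide_distrib mult.commute)
      have "Re (- h / z\<^sup>2) = Re h * Re (- coord_vec 1 / z\<^sup>2) + Im h * Re (- coord_vec 2 / z\<^sup>2)"
        "Im (- h / z\<^sup>2) = Re h * Im (- coord_vec 1 / z\<^sup>2) + Im h * Im (- coord_vec 2 / z\<^sup>2)"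
        by (subst e, simp only: plus_complex.sel scaleR_complex.sel)+
      then show ?thesis unfolding d_def by (simp only: real_scaleR_def distrib_left distrib_right mult_ac add_ac)
    qed
    ultimately have V': "has_grad (\<lambda>w. v (1/w)) d z" by (simp add: has_grad_def)
    have "has_grad (\<lambda>z. ln ((cmod z)\<^sup>2)) (\<lambda>i. inverse ((cmod z)\<^sup>2) * (if i = 1 then 2 * Re z else 2 * Im z)) z"
      using has_grad_ln[OF has_grad_norm_power2] nz by simp
    from has_grad_add[OF has_grad_linear[OF bounded_linear_mult_right this, of "c/2"] V']
    have "has_grad (\<lambda>z. c/2 * ln ((cmod z)\<^sup>2) + v (1/z))
        (\<lambda>i. c/2 * (inverse ((cmod z)\<^sup>2) * (if i = 1 then 2 * Re z else 2 * Im z)) + d i) z" .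
    then have "has_grad u (\<lambda>i. c/2 * (inverse ((cmod z)\<^sup>2) * (if i = 1 then 2 * Re z else 2 * Im z)) + d i) z"
      by (rule has_grad_cong[of _ _ _ "- {0}"]) (use nz in \<open>auto simp: uv ln_realpow\<close>)
    from has_grad_pd[OF this, of i]
    have "pd i u z - c * (if i = 1 then Re z else Im z) / (cmod z)\<^sup>2 = d i"
      by (cases "i = 1") (simp_all add: inverse_eq_divide)
    moreover have "\<bar>d i\<bar> \<le> B / (cmod z)\<^sup>2"
    proof -
      have n: "cmod (- coord_vec i / z\<^sup>2) = 1 / (cmod z)\<^sup>2"
        by (simp add: norm_divide norm_power coord_vec_def)
      have "\<bar>d i\<bar> \<le> \<bar>Re (- coord_vec i / z\<^sup>2)\<bar> * \<bar>pd 1 v (1/z)\<bar> + \<bar>Im (- coord_vec i / z\<^sup>2)\<bar> * \<bar>pd 2 v (1/z)\<bar>"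
        unfolding d_def abs_mult[symmetric] by (rule abs_triangle_ineq)
      also have "\<dots> \<le> (1 / (cmod z)\<^sup>2) * \<bar>pd 1 v (1/z)\<bar> + (1 / (cmod z)\<^sup>2) * \<bar>pd 2 v (1/z)\<bar>"
        by (intro add_mono mult_right_mono) (metis n abs_Re_le_cmod, simp, metis n abs_Im_le_cmod, simp)
      also have "\<dots> = (\<bar>pd 1 v (1/z)\<bar> + \<bar>pd 2 v (1/z)\<bar>) / (cmod z)\<^sup>2" by (simp add: add_divide_distrib)
      also have "\<dots> \<le> B / (cmod z)\<^sup>2"
        using z by (intro divide_right_mono B(2)) (auto simp: norm_divide divide_le_eq_1)
      finally show ?thesis .
    qed
    ultimately show ?thesis by simp
  qed
  have cu: "continuous_on T (\<lambda>x. pd i u (g x))" if "continuous_on T g" for i T and g :: "real \<Rightarrow> complex"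
    using smooth_continuous_on[OF smooth_pd[OF u]] that by (rule continuous_on_compose2) auto
  define I where "I R = integral {-R..R} (\<lambda>y. pd 1 u (Complex R y) - pd 1 u (Complex (-R) y)) +
             integral {-R..R} (\<lambda>x. pd 2 u (Complex x R) - pd 2 u (Complex x (-R)))" for R
  have I: "\<bar>I R - 2 * pi * c\<bar> \<le> 8 * B / R" if R: "R \<ge> 1" for R
  proof -
    have dn: "(cmod (Complex x y))\<^sup>2 \<ge> R\<^sup>2" "cmod (Complex x y) \<ge> 1" if "\<bar>x\<bar> = R \<or> \<bar>y\<bar> = R" for x y
    proof -
      have "R \<le> cmod (Complex x y)"
        using that abs_Re_le_cmod[of "Complex x y"] abs_Im_le_cmod[of "Complex x y"] by auto
      then show "(cmod (Complex x y))\<^sup>2 \<ge> R\<^sup>2" "cmod (Complex x y) \<ge> 1" using R by (auto intro: power_mono)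
    qed
    have est': "\<bar>pd i u (Complex x y) - c * (if i = 1 then x else y) / (x\<^sup>2 + y\<^sup>2)\<bar> \<le> B / R\<^sup>2"
      if "\<bar>x\<bar> = R \<or> \<bar>y\<bar> = R" for x y i
    proof -
      have "B / (cmod (Complex x y))\<^sup>2 \<le> B / R\<^sup>2"
        using dn(1)[OF that] B(1) R by (intro divide_left_mono mult_pos_pos) (auto intro: less_le_trans[of 0 "R\<^sup>2"])
      then show ?thesis using est[OF dn(2)[OF that], of i] by (cases "i = 1") (simp_all add: cmod_power2)
    qed
    \<comment> \<open>On opposite edges the outer normals are opposite, so the two partial
      derivatives are close to \<open>k\<close> and \<open>-k\<close> and their difference to
      \<open>2 k\<close>.\<close>
    have tri: "\<bar>p - q - 2 * k\<bar> \<le> 2 * b" if "\<bar>p - k\<bar> \<le> b" "\<bar>q + k\<bar> \<le> b" for p q k b :: real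
      using that by linarith
    have 1: "\<bar>integral {-R..R} (\<lambda>y. pd 1 u (Complex R y) - pd 1 u (Complex (-R) y)) - c * pi\<bar> \<le> 2 * B / R\<^sup>2 * (2 * R)"
    proof (rule integral_near_Cauchy)
      show "continuous_on {-R..R} (\<lambda>y. pd 1 u (Complex R y) - pd 1 u (Complex (-R) y))"
        by (intro continuous_intros cu)
      show "\<bar>pd 1 u (Complex R y) - pd 1 u (Complex (-R) y) - 2 * c * (R / (R\<^sup>2 + y\<^sup>2))\<bar> \<le> 2 * B / R\<^sup>2" for y
        using tri[OF est'[of R y 1], of "pd 1 u (Complex (-R) y)"] est'[of "-R" y 1] R by (simp add: mult.assoc)
    qed (use R in auto)
    have 2: "\<bar>integral {-R..R} (\<lambda>x. pd 2 u (Complex x R) - pd 2 u (Complex x (-R))) - c * pi\<bar> \<le> 2 * B / R\<^sup>2 * (2 * R)"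
    proof (rule integral_near_Cauchy)
      show "continuous_on {-R..R} (\<lambda>x. pd 2 u (Complex x R) - pd 2 u (Complex x (-R)))"
        by (intro continuous_intros cu)
      show "\<bar>pd 2 u (Complex x R) - pd 2 u (Complex x (-R)) - 2 * c * (R / (R\<^sup>2 + x\<^sup>2))\<bar> \<le> 2 * B / R\<^sup>2" for x
        using tri[OF est'[of x R 2], of "pd 2 u (Complex x (-R))"] est'[of x "-R" 2] R by (simp add: mult.assoc add.commute)
    qed (use R in auto)
    have e: "2 * B / R\<^sup>2 * (2 * R) = 4 * (B / R)" using R by (simp add: power2_eq_square)
    have sum: "\<bar>p + q - 2 * pi * c\<bar> \<le> 8 * b" if "\<bar>p - c * pi\<bar> \<le> 4 * b" "\<bar>q - c * pi\<bar> \<le> 4 * b" for p q b :: real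
      using that by (simp add: abs_le_iff algebra_simps)
    show ?thesis using sum[OF 1[unfolded e] 2[unfolded e]] by (simp add: I_def)
  qed
  have lim: "(\<lambda>n. I (real (Suc n))) \<longlonglongrightarrow> 2 * pi * c"
  proof (rule LIM_zero_cancel, rule Lim_null_comparison)
    show "\<forall>\<^sub>F n in sequentially. norm (I (real (Suc n)) - 2 * pi * c) \<le> 8 * B * (1 / real (Suc n))"
      using I by (intro always_eventually allI) simp
    show "(\<lambda>n. 8 * B * (1 / real (Suc n))) \<longlonglongrightarrow> 0"
      using tendsto_mult_right_zero[OF lim_1_over_n[THEN LIMSEQ_Suc]] by simp
  qed
  have cL: "continuous_on UNIV (Lap u)"
    unfolding Lap_def[abs_def] using u by (intro smooth_continuous_on smooth_add smooth_pd)
  have [measurable]: "Lap u \<in> borel_measurable borel" using cL by (rule borel_measurable_continuous_onI)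
  have "(\<lambda>n. \<integral>\<^sup>+ z. ennreal (Lap u z) * indicator (square (real (Suc n))) z \<partial>lborel) \<longlonglongrightarrow>
      (\<integral>\<^sup>+ z. ennreal (Lap u z) \<partial>lborel)"
  proof (rule nn_integral_LIMSEQ)
    show "incseq (\<lambda>n z. ennreal (Lap u z) * indicator (square (real (Suc n))) z)"
      by (auto simp: incseq_def le_fun_def indicator_def in_cbox_complex_iff)
    show "(\<lambda>n. ennreal (Lap u z) * indicator (square (real (Suc n))) z) \<longlonglongrightarrow> ennreal (Lap u z)" for z
    proof (rule tendsto_eventually)
      obtain N where N: "cmod z \<le> real N" using real_arch_simple by blast
      have "z \<in> square (real (Suc n))" if "n \<ge> N" for n
      proof -
        have "cmod z \<le> real (Suc n)" using N that by simp
        then show ?thesis using abs_Re_le_cmod[of z] abs_Im_le_cmod[of z] by (auto simp: in_cbox_complex_iff)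
      qed
      then show "\<forall>\<^sub>F n in sequentially. ennreal (Lap u z) * indicator (square (real (Suc n))) z = ennreal (Lap u z)"
        by (auto simp: eventually_sequentially intro!: exI[of _ N])
    qed
  qed measurable
  moreover have "(\<integral>\<^sup>+ z. ennreal (Lap u z) * indicator (square (real (Suc n))) z \<partial>lborel) = ennreal (I (real (Suc n)))" for n
    unfolding I_def by (rule nn_integral_Lap_square[OF u nonneg]) simp
  ultimately have "(\<lambda>n. ennreal (I (real (Suc n)))) \<longlonglongrightarrow> (\<integral>\<^sup>+ z. ennreal (Lap u z) \<partial>lborel)" by simp
  then show ?thesis using tendsto_ennrealI[OF lim] LIMSEQ_unique by blast
qed

section \<open>Energies of inverted minimal surfaces in Weierstrass form\<close>

text \<open>Locally \<open>ln |D|\<close> is the real part of a logarithm of \<open>D\<close>, whose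
  derivative \<open>D' / D\<close> exists on all of \<open>V\<close> without choosing a branch.
  Harmonicity is visible in the second-order part.\<close>

lemma ln_norm_jet:
  assumes V: "open V" and D: "D holomorphic_on V" "\<And>z. z \<in> V \<Longrightarrow> D z \<noteq> 0"
  shows "jet2 V (\<lambda>z. ln (cmod (D z))) (\<lambda>z i. Re (coord_vec i * (deriv D z / D z)))
    (\<lambda>z i j. Re (coord_vec i * coord_vec j * deriv (\<lambda>z. deriv D z / D z) z))"
  unfolding jet2_def
proof (intro conjI ballI allI V)
  fix z i assume z: "z \<in> V"
  have "((\<lambda>w. D w) has_field_derivative deriv D z) (at z)"
    using D(1) V z by (rule holomorphic_derivI)
  then have "(D has_derivative (\<lambda>h. deriv D z * h)) (at z)" by (simp add: has_field_derivative_def)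
  then have "((\<lambda>w. (cmod (D w))\<^sup>2) has_derivative (\<lambda>h. 2 * (D z \<bullet> (deriv D z * h)))) (at z)"
    unfolding power2_norm_eq_inner by (auto intro!: derivative_eq_intros simp: inner_commute)
  from has_derivative_ln[OF _ this] D(2)[OF z]
  have "((\<lambda>w. ln ((cmod (D w))\<^sup>2)) has_derivative (\<lambda>h. 2 * (D z \<bullet> (deriv D z * h)) * inverse ((cmod (D z))\<^sup>2))) (at z)"
    by simp
  then have "((\<lambda>w. 1/2 * ln ((cmod (D w))\<^sup>2)) has_derivative (\<lambda>h. 1/2 * (2 * (D z \<bullet> (deriv D z * h)) * inverse ((cmod (D z))\<^sup>2)))) (at z)"
    by (rule has_derivative_mult_right)
  moreover have "1/2 * (2 * (D z \<bullet> (deriv D z * h)) * inverse ((cmod (D z))\<^sup>2)) =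
      Re h *\<^sub>R Re (coord_vec 1 * (deriv D z / D z)) + Im h *\<^sub>R Re (coord_vec 2 * (deriv D z / D z))" for h
  proof -
    have "D z \<bullet> (deriv D z * h) = Re (h * (deriv D z / D z)) * (cmod (D z))\<^sup>2"
    proof -
      have "h * (deriv D z / D z) = h * deriv D z * cnj (D z) / of_real ((cmod (D z))\<^sup>2)"
        by (simp add: complex_div_cnj[of "deriv D z"])
      then have "Re (h * (deriv D z / D z)) * (cmod (D z))\<^sup>2 = Re (h * deriv D z * cnj (D z))"
        using D(2)[OF z] by (simp only: Re_divide_of_real) simp
      then show ?thesis by (simp add: inner_complex_def algebra_simps)
    qed
    then have "1/2 * (2 * (D z \<bullet> (deriv D z * h)) * inverse ((cmod (D z))\<^sup>2)) = Re (h * (deriv D z / D z))"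
      using D(2)[OF z] by simp
    moreover have "Re (h * k) = Re h *\<^sub>R Re (1 * k) + Im h *\<^sub>R Re (\<i> * k)" for k by simp
    ultimately show ?thesis by (simp only: coord_vec_simps)
  qed
  ultimately have "has_grad (\<lambda>w. 1/2 * ln ((cmod (D w))\<^sup>2)) (\<lambda>i. Re (coord_vec i * (deriv D z / D z))) z"
    by (simp add: has_grad_def)
  then show "has_grad (\<lambda>w. ln (cmod (D w))) (\<lambda>i. Re (coord_vec i * (deriv D z / D z))) z"
    by (rule has_grad_cong[OF _ V z]) (use D(2) in \<open>simp add: ln_realpow\<close>)
  have "(\<lambda>z. deriv D z / D z) holomorphic_on V"
    using D V by (intro holomorphic_intros holomorphic_deriv) auto
  from has_grad_Re_holomorphic[OF holomorphic_derivI[OF this V z], of "coord_vec i"]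
  show "has_grad (\<lambda>w. Re (coord_vec i * (deriv D w / D w)))
     (\<lambda>j. Re (coord_vec i * coord_vec j * deriv (\<lambda>z. deriv D z / D z) z)) z" .
qed

lemma Lap_mult_norm_power:
  assumes V: "open V" and D: "D holomorphic_on V" "\<And>z. z \<in> V \<Longrightarrow> D z \<noteq> 0"
    and u: "smooth UNIV u" "\<And>z. u z > 0"
    and r: "\<And>z. z \<in> V \<Longrightarrow> r z = u z ^ n / cmod (D z) ^ m" and z: "z \<in> V"
  shows "Lap (\<lambda>z. ln (r z)) z = n * Lap (\<lambda>z. ln (u z)) z"
proof -
  have "smooth UNIV (\<lambda>z. ln (u z))" using u by (intro smooth_ln) auto
  from jet2_if_smooth[OF this] have "jet2 V (\<lambda>z. ln (u z)) (\<lambda>z i. pd i (\<lambda>z. ln (u z)) z)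
     (\<lambda>z i j. pd j (pd i (\<lambda>z. ln (u z))) z)"
    using V by (auto simp: jet2_def)
  from jet2_add[OF jet2_linear[OF bounded_linear_mult_right this, of "real n"]
      jet2_linear[OF bounded_linear_mult_right ln_norm_jet[OF V D], of "- real m"]]
  have j: "jet2 V (\<lambda>z. ln (r z)) (\<lambda>z i. real n * pd i (\<lambda>z. ln (u z)) z + - real m * Re (coord_vec i * (deriv D z / D z)))
     (\<lambda>z i j. real n * pd j (pd i (\<lambda>z. ln (u z))) z + - real m * Re (coord_vec i * coord_vec j * deriv (\<lambda>z. deriv D z / D z) z))"
    by (rule jet2_cong) (use D(2) in \<open>simp_all add: r ln_div ln_realpow u(2) less_imp_neq[OF u(2), symmetric]\<close>)
  show ?thesis unfolding jet2_Lap[OF j z] by (simp add: Lap_def distrib_left)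
qed

text \<open>Weierstrass data in terms of the spinors \<open>S / D\<close> and \<open>t / D\<close>:
  the null condition becomes an algebraic identity, and regularity says that \<open>S\<close> and
  \<open>t\<close> have no common zero.\<close>

locale spinor_curve =
  fixes V :: "complex set" and \<phi> :: "3 \<Rightarrow> complex \<Rightarrow> complex" and S t D :: "complex \<Rightarrow> complex"
  assumes V: "open V" and D: "\<And>z. z \<in> V \<Longrightarrow> D z \<noteq> 0" and St: "\<And>z. z \<in> V \<Longrightarrow> S z \<noteq> 0 \<or> t z \<noteq> 0"
    and \<phi>1: "\<And>z. z \<in> V \<Longrightarrow> (\<phi> 1 has_field_derivative ((S z)\<^sup>2 - (t z)\<^sup>2) / (D z)\<^sup>2) (at z)"
    and \<phi>2: "\<And>z. z \<in> V \<Longrightarrow> (\<phi> 2 has_field_derivative \<i> * ((S z)\<^sup>2 + (t z)\<^sup>2) / (D z)\<^sup>2) (at z)"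
    and \<phi>3: "\<And>z. z \<in> V \<Longrightarrow> (\<phi> 3 has_field_derivative 2 * S z * t z / (D z)\<^sup>2) (at z)"
begin

lemma deriv_\<phi>:
  assumes "z \<in> V"
  shows "deriv (\<phi> 1) z = ((S z)\<^sup>2 - (t z)\<^sup>2) / (D z)\<^sup>2" "deriv (\<phi> 2) z = \<i> * ((S z)\<^sup>2 + (t z)\<^sup>2) / (D z)\<^sup>2"
    "deriv (\<phi> 3) z = 2 * S z * t z / (D z)\<^sup>2"
  using \<phi>1[OF assms] \<phi>2[OF assms] \<phi>3[OF assms] by (auto intro: DERIV_imp_deriv)

sublocale minimal_curve V \<phi>
proof
  show "\<phi> k holomorphic_on V" for k
    using exhaust_3[of k] \<phi>1 \<phi>2 \<phi>3 V by (auto simp: holomorphic_on_open)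
  fix z assume z: "z \<in> V"
  note d = deriv_\<phi>[OF z]
  show "(\<Sum>k\<in>UNIV. (deriv (\<phi> k) z)\<^sup>2) = 0"
    using D[OF z] unfolding sum_3 d power_divide
    by (simp add: power2_eq_square field_simps)
  show "\<exists>k. deriv (\<phi> k) z \<noteq> 0"
  proof (rule ccontr)
    assume "\<not> ?thesis"
    then have "(S z)\<^sup>2 - (t z)\<^sup>2 = 0" "(S z)\<^sup>2 + (t z)\<^sup>2 = 0"
      using d(1,2) D[OF z] by auto
    then have "2 * (S z)\<^sup>2 = 0" "2 * (t z)\<^sup>2 = 0" by (algebra, algebra)
    then show False using St[OF z] by simp
  qed
qed (rule V)

definition "q z = (cmod (S z))\<^sup>2 + (cmod (t z))\<^sup>2"

text \<open>By conformality \<open>2 \<rho>\<close> is the sum of the \<open>|\<phi>_k'|^2\<close>;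
  the parallelogram law for \<open>S^2\<close> and \<open>t^2\<close> then completes the
  square.\<close>

lemma \<rho>_eq:
  assumes z: "z \<in> V"
  shows "\<rho> z = q z ^ 2 / cmod (D z) ^ 4"
proof -
  have "2 * \<rho> z = X1 z 1 \<bullet> X1 z 1 + X1 z 2 \<bullet> X1 z 2"
    using frame_X[OF z] by (simp add: frame_def)
  also have "\<dots> = (\<Sum>k\<in>UNIV. (cmod (deriv (\<phi> k) z))\<^sup>2)"
    unfolding cmod_power2 by (simp add: X1_def inner_vec_def sum.distrib power2_eq_square)
  also have "\<dots> = ((cmod ((S z)\<^sup>2 - (t z)\<^sup>2))\<^sup>2 + (cmod ((S z)\<^sup>2 + (t z)\<^sup>2))\<^sup>2 + (cmod (2 * S z * t z))\<^sup>2) / cmod (D z) ^ 4"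
    by (simp add: sum_3 deriv_\<phi>[OF z] norm_divide norm_mult norm_power power_divide power_mult_distrib add_divide_distrib
        flip: power_mult)
  also have "(cmod ((S z)\<^sup>2 - (t z)\<^sup>2))\<^sup>2 + (cmod ((S z)\<^sup>2 + (t z)\<^sup>2))\<^sup>2 =
      2 * (cmod ((S z)\<^sup>2))\<^sup>2 + 2 * (cmod ((t z)\<^sup>2))\<^sup>2"
    unfolding cmod_power2[of "(S z)\<^sup>2 - _"] cmod_power2[of "(S z)\<^sup>2 + _"] cmod_power2[of "(S z)\<^sup>2"] cmod_power2[of "(t z)\<^sup>2"]
    by (simp del: Re_power2 Im_power2 add: power2_eq_square algebra_simps)
  also have "2 * (cmod ((S z)\<^sup>2))\<^sup>2 + 2 * (cmod ((t z)\<^sup>2))\<^sup>2 + (cmod (2 * S z * t z))\<^sup>2 = 2 * q z ^ 2"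
    by (simp add: q_def norm_power norm_mult power2_eq_square algebra_simps)
  finally show ?thesis by simp
qed

end

lemma W_energy_eq:
  assumes "finite S" "\<And>z. z \<notin> S \<Longrightarrow> (mean_curvature f z)\<^sup>2 * area_density f z = g z"
  shows "W_energy f = (\<integral>\<^sup>+ z. ennreal (g z) \<partial>lborel)"
  unfolding W_energy_def
  by (intro nn_integral_cong_AE eventually_mono[OF AE_not_in[OF finite_imp_null_set_lborel[OF assms(1)]]])
     (simp add: assms(2))

lemma E_energy_eq:
  assumes "finite S" "\<And>z. z \<notin> S \<Longrightarrow> tensor_norm_sq (metric f z) (second_ff f z) * area_density f z = g z"
  shows "E_energy f = (\<integral>\<^sup>+ z. ennreal (g z) \<partial>lborel)"
  unfolding E_energy_def
  by (intro nn_integral_cong_AE eventually_mono[OF AE_not_in[OF finite_imp_null_set_lborel[OF assms(1)]]])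
     (simp add: assms(2))

text \<open>Nonnegativity is the equation \<open>g = |g|\<close>, so it passes from a dense set to
  the plane.\<close>

lemma continuous_nonneg_off_finite:
  fixes g :: "complex \<Rightarrow> real"
  assumes "finite S" "continuous_on UNIV g" "\<And>z. z \<notin> S \<Longrightarrow> 0 \<le> g z"
  shows "0 \<le> g z"
  using continuous_eq_off_finite[OF assms(1,2) continuous_on_rabs[OF assms(2)], of z] assms(3) by simp

lemma continuous_Lap: "smooth UNIV u \<Longrightarrow> continuous_on UNIV (Lap u)"
  unfolding Lap_def[abs_def] by (intro smooth_continuous_on smooth_add smooth_pd)

lemma nn_integral_Lap_ln:
  assumes u: "smooth UNIV u" "\<And>z. u z > 0" and v: "smooth UNIV v" "\<And>z. v z > (0::real)"
    and uv: "\<And>z. z \<noteq> 0 \<Longrightarrow> u z = cmod z ^ m * v (1 / z)"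
    and S: "finite S" "\<And>z. z \<notin> S \<Longrightarrow> 0 \<le> Lap (\<lambda>z. ln (u z)) z"
  shows "(\<integral>\<^sup>+ z. ennreal (Lap (\<lambda>z. ln (u z)) z) \<partial>lborel) = ennreal (2 * pi * real m)"
proof (rule nn_integral_Lap)
  show su: "smooth UNIV (\<lambda>z. ln (u z))" and "smooth UNIV (\<lambda>z. ln (v z))"
    using u v by (auto intro: smooth_ln)
  show "ln (u z) = real m * ln (cmod z) + ln (v (1 / z))" if "z \<noteq> 0" for z
    using that by (simp add: uv ln_mult ln_realpow v(2) less_imp_neq[OF v(2), symmetric])
  show "0 \<le> Lap (\<lambda>z. ln (u z)) z" for z
    using S(1) continuous_Lap[OF su] S(2) by (rule continuous_nonneg_off_finite)
qed

lemma Lap_ln_mult: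
  assumes "smooth UNIV u" "\<And>z. u z > (0::real)" "smooth UNIV v" "\<And>z. v z > (0::real)"
  shows "Lap (\<lambda>z. ln (u z ^ m * v z ^ n)) z = real m * Lap (\<lambda>z. ln (u z)) z + real n * Lap (\<lambda>z. ln (v z)) z"
proof -
  have "smooth UNIV (\<lambda>z. ln (u z))" "smooth UNIV (\<lambda>z. ln (v z))" using assms by (auto intro: smooth_ln)
  note j = jet2_add[OF jet2_linear[OF bounded_linear_mult_right jet2_if_smooth[OF this(1)], of "real m"]
      jet2_linear[OF bounded_linear_mult_right jet2_if_smooth[OF this(2)], of "real n"]]
  have "(\<lambda>z. ln (u z ^ m * v z ^ n)) = (\<lambda>z. real m * ln (u z) + real n * ln (v z))"
    by (rule ext) (simp add: ln_mult ln_realpow assms(2,4) less_imp_neq[OF assms(2), symmetric] less_imp_neq[OF assms(4), symmetric])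
  then show ?thesis using jet2_Lap[OF j, of z] by (simp add: Lap_def distrib_left)
qed

lemma smooth_mult: "smooth U f \<Longrightarrow> smooth U g \<Longrightarrow> smooth U (\<lambda>z. f z * g z :: real)"
  by (rule smooth_bilinear[OF bounded_bilinear_mult])

lemma smooth_power: "smooth U f \<Longrightarrow> smooth U (\<lambda>z. f z ^ n :: real)"
  unfolding smooth_def using smooth_conv_power[of U "\<lambda>_. f" f n] by blast

context inverted_minimal_curve
begin

text \<open>\<open>D\<close> is the denominator of \<open>X\<close>, \<open>D'\<close> that of the
  spinors; they differ for the Lopez surface. Without their harmonic logarithms, \<open>ln r\<close>
  and \<open>ln \<rho>\<close> become \<open>ln P\<close> and \<open>2 ln Q\<close>, so
  \<open>2 ln r + ln \<rho>\<close> has growth degree \<open>2 dP + 2 dQ\<close>.\<close>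

lemma energies:
  fixes D D' :: "complex \<Rightarrow> complex"
  assumes S: "finite S" "V = - S"
    and D: "D holomorphic_on V" "D' holomorphic_on V" "\<And>z. z \<in> V \<Longrightarrow> D z \<noteq> 0" "\<And>z. z \<in> V \<Longrightarrow> D' z \<noteq> 0"
    and r: "\<And>z. z \<in> V \<Longrightarrow> r z = P z / cmod (D z) ^ 2" and \<rho>: "\<And>z. z \<in> V \<Longrightarrow> \<rho> z = Q z ^ 2 / cmod (D' z) ^ 4"
    and P: "smooth UNIV P" "\<And>z. P z > 0" "smooth UNIV P'" "\<And>z. P' z > 0"
    and Q: "smooth UNIV Q" "\<And>z. Q z > 0" "smooth UNIV Q'" "\<And>z. Q' z > 0"
    and PP: "\<And>z. z \<noteq> 0 \<Longrightarrow> P z = cmod z ^ dP * P' (1 / z)" and QQ: "\<And>z. z \<noteq> 0 \<Longrightarrow> Q z = cmod z ^ dQ * Q' (1 / z)"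
  shows "W_energy f = ennreal (2 * pi * real dP)" "E_energy f = ennreal (2 * pi * real (2 * dP + 2 * dQ))"
proof -
  have V': "z \<in> V \<longleftrightarrow> z \<notin> S" for z using S by simp
  have Lr: "Lap (\<lambda>z. ln (r z)) z = Lap (\<lambda>z. ln (P z)) z" if "z \<in> V" for z
    using Lap_mult_norm_power[OF V D(1,3) P(1,2), of r 1 2 z] r that by simp
  have L\<rho>: "Lap (\<lambda>z. ln (\<rho> z)) z = 2 * Lap (\<lambda>z. ln (Q z)) z" if "z \<in> V" for z
    using Lap_mult_norm_power[OF V D(2,4) Q(1,2), of \<rho> 2 4 z] \<rho> that by simp
  have nonneg: "0 \<le> Lap (\<lambda>z. ln (P z)) z" "0 \<le> Lap (\<lambda>z. ln (\<rho> z)) z" if "z \<in> V" for z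
    using Lap_ln_r[OF that nz] Lap_ln_\<rho>[OF that] \<rho>_pos[OF that] by (simp_all add: Lr[OF that])
  show "W_energy f = ennreal (2 * pi * real dP)"
    by (subst W_energy_eq[OF S(1)])
       (use V' W_density_f Lr nonneg in \<open>auto intro!: nn_integral_Lap_ln[OF P PP S(1)]\<close>)
  have L: "Lap (\<lambda>z. ln (P z ^ 2 * Q z ^ 2)) z = 2 * Lap (\<lambda>z. ln (P z)) z + 2 * Lap (\<lambda>z. ln (Q z)) z" for z
    using Lap_ln_mult[OF P(1,2) Q(1,2), of 2 2 z] by simp
  show "E_energy f = ennreal (2 * pi * real (2 * dP + 2 * dQ))"
  proof (subst E_energy_eq[OF S(1)])
    show "tensor_norm_sq (metric f z) (second_ff f z) * area_density f z = Lap (\<lambda>z. ln (P z ^ 2 * Q z ^ 2)) z" if "z \<notin> S" for z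
      using E_density_f[of z] that V' Lr L\<rho> L by simp
    show "(\<integral>\<^sup>+ z. ennreal (Lap (\<lambda>z. ln (P z ^ 2 * Q z ^ 2)) z) \<partial>lborel) = ennreal (2 * pi * real (2 * dP + 2 * dQ))"
    proof (rule nn_integral_Lap_ln[OF _ _ _ _ _ S(1)])
      show "smooth UNIV (\<lambda>z. P z ^ 2 * Q z ^ 2)" "smooth UNIV (\<lambda>z. P' z ^ 2 * Q' z ^ 2)"
        by (intro smooth_mult smooth_power P Q)+
      show "P z ^ 2 * Q z ^ 2 > 0" "P' z ^ 2 * Q' z ^ 2 > 0" for z
        using P Q by (simp_all add: less_imp_neq[symmetric])
      show "P z ^ 2 * Q z ^ 2 = cmod z ^ (2 * dP + 2 * dQ) * (P' (1 / z) ^ 2 * Q' (1 / z) ^ 2)" if "z \<noteq> 0" for z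
        using that by (simp add: PP QQ power_mult_distrib power_add power_mult[symmetric] mult_ac)
      show "0 \<le> Lap (\<lambda>z. ln (P z ^ 2 * Q z ^ 2)) z" if "z \<notin> S" for z
        using nonneg[of z] L\<rho>[of z] L[of z] that V' by simp
    qed
  qed
qed

end

section \<open>Inverted surfaces with planar ends\<close>

text \<open>For \<open>X = 2 Re ((A (1, \<i>, 0) + B (1, -\<i>, 0) + C (0, 0, 1)) / D) - (0, 0, 6)\<close> these are \<open>|D|\<^sup>2 X\<close> and
  \<open>|D|\<^sup>2 |X|\<^sup>2\<close>. The latter has no denominator because at planar ends \<open>D\<close> divides \<open>4 A B + C\<^sup>2\<close>, with quotient \<open>G\<close>.\<close>

definition ends_num :: "complex \<Rightarrow> complex \<Rightarrow> complex \<Rightarrow> complex \<Rightarrow> real^3" where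
  "ends_num A B C D = vector [2 * Re ((A + B) * cnj D), 2 * Re (\<i> * (A - B) * cnj D), 2 * Re (C * cnj D) - 6 * (cmod D)\<^sup>2]"

definition ends_den :: "complex \<Rightarrow> complex \<Rightarrow> complex \<Rightarrow> complex \<Rightarrow> complex \<Rightarrow> real" where
  "ends_den A B C D G = 4 * (cmod A)\<^sup>2 + 4 * (cmod B)\<^sup>2 + 2 * (cmod C)\<^sup>2 + 2 * Re (G * cnj D)
     - 24 * Re (C * cnj D) + 36 * (cmod D)\<^sup>2"

text \<open>For \<open>v = (A + B, \<i> (A - B), C) / D\<close> one has
  \<open>|2 Re v|^2 = 2 |v|^2 + 2 Re (v \<bullet> v)\<close> with the complex bilinear product, and
  \<open>v \<bullet> v = (4 A B + C^2) / D^2 = G / D\<close>. Multiplication by \<open>|D|^2\<close>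
  then clears all denominators.\<close>

lemma ends_num_den:
  assumes "4 * A * B + C\<^sup>2 = G * D"
  shows "ends_num A B C D \<bullet> ends_num A B C D = ends_den A B C D G * (cmod D)\<^sup>2"
proof -
  have r: "4 * (Re A * Re B - Im A * Im B) + ((Re C)\<^sup>2 - (Im C)\<^sup>2) = Re G * Re D - Im G * Im D"
    using arg_cong[OF assms, of Re] by (simp add: Re_power2 algebra_simps)
  have i: "4 * (Re A * Im B + Im A * Re B) + 2 * Re C * Im C = Re G * Im D + Im G * Re D"
    using arg_cong[OF assms, of Im] by (simp add: Im_power2 algebra_simps)
  show ?thesis
    using r i unfolding ends_num_def ends_den_def inner_vec_def sum_3 vector_3 inner_real_def cmod_power2
    by simp algebra
qed

text \<open>A common factor of the data does not affect the surface, so numerator and denominator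
  scale alike; with \<open>c = z^4\<close> this is the change of chart.\<close>

lemma ends_num_scale: "ends_num (c * A) (c * B) (c * C) (c * D) = (cmod c)\<^sup>2 *\<^sub>R ends_num A B C D"
proof -
  have "Re (c * a * cnj (c * b)) = (cmod c)\<^sup>2 * Re (a * cnj b)" for a b
  proof -
    have "c * a * cnj (c * b) = (c * cnj c) * (a * cnj b)" by simp
    also have "c * cnj c = of_real ((cmod c)\<^sup>2)" using complex_norm_square[of c] by simp
    finally have e: "c * a * cnj (c * b) = of_real ((cmod c)\<^sup>2) * (a * cnj b)" .
    have "Re (of_real x * w) = x * Re w" for x w by simp
    then show ?thesis unfolding e .
  qed
  note R = this
  have "Re ((c * A + c * B) * cnj (c * D)) = (cmod c)\<^sup>2 * Re ((A + B) * cnj D)"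
    "Re (\<i> * (c * A - c * B) * cnj (c * D)) = (cmod c)\<^sup>2 * Re (\<i> * (A - B) * cnj D)"
    using R[of "A + B" D] R[of "\<i> * (A - B)" D] by (simp_all add: algebra_simps)
  then show ?thesis
    unfolding ends_num_def vec_eq_iff forall_3 vector_scaleR_component vector_3 real_scaleR_def R[of C D]
      norm_mult power_mult_distrib
    by (simp only: algebra_simps)
qed

lemma ends_den_scale: "ends_den (c * A) (c * B) (c * C) (c * D) (c * G) = (cmod c)\<^sup>2 * ends_den A B C D G"
proof -
  have "Re (c * a * cnj (c * b)) = (cmod c)\<^sup>2 * Re (a * cnj b)" for a b
  proof -
    have "c * a * cnj (c * b) = (c * cnj c) * (a * cnj b)" by simp
    also have "c * cnj c = of_real ((cmod c)\<^sup>2)" using complex_norm_square[of c] by simp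
    finally have e: "c * a * cnj (c * b) = of_real ((cmod c)\<^sup>2) * (a * cnj b)" .
    have "Re (of_real x * w) = x * Re w" for x w by simp
    then show ?thesis unfolding e .
  qed
  then show ?thesis unfolding ends_den_def
    by (simp only: norm_mult power_mult_distrib) (simp add: algebra_simps)
qed

text \<open>The denominator \<open>E\<close> of the spinors differs from \<open>D\<close> where common factors cancel, as for the Lopez surface.\<close>

locale planar_ends =
  fixes V :: "complex set" and A B C D G S t E :: "complex \<Rightarrow> complex"
  assumes V: "open V" and D_nz: "\<And>z. z \<in> V \<Longrightarrow> D z \<noteq> 0" and E: "\<And>z. z \<in> V \<Longrightarrow> E z \<noteq> 0"
    and St: "\<And>z. z \<in> V \<Longrightarrow> S z \<noteq> 0 \<or> t z \<noteq> 0"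
    and quadric: "\<And>z. z \<in> V \<Longrightarrow> 4 * A z * B z + (C z)\<^sup>2 = G z * D z"
    and A: "\<And>z. z \<in> V \<Longrightarrow> ((\<lambda>z. A z / D z) has_field_derivative (S z)\<^sup>2 / (2 * (E z)\<^sup>2)) (at z)"
    and B: "\<And>z. z \<in> V \<Longrightarrow> ((\<lambda>z. B z / D z) has_field_derivative - (t z)\<^sup>2 / (2 * (E z)\<^sup>2)) (at z)"
    and C: "\<And>z. z \<in> V \<Longrightarrow> ((\<lambda>z. C z / D z) has_field_derivative S z * t z / (E z)\<^sup>2) (at z)"
    and pos: "\<And>z. z \<in> V \<Longrightarrow> ends_den (A z) (B z) (C z) (D z) (G z) > 0"
begin

definition "P z = ends_den (A z) (B z) (C z) (D z) (G z)"
definition "f z = (1 / P z) *\<^sub>R ends_num (A z) (B z) (C z) (D z)"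

text \<open>Subtracting 6 moves the centre of inversion to the origin.\<close>

definition \<phi> :: "3 \<Rightarrow> complex \<Rightarrow> complex" where
  "\<phi> k z = (if k = 1 then 2 * (A z / D z + B z / D z) else if k = 2 then 2 * \<i> * (A z / D z - B z / D z)
     else 2 * (C z / D z) - 6)"

sublocale spinor_curve V \<phi> S t E
proof
  fix z assume z: "z \<in> V"
  have \<phi>: "\<phi> 1 = (\<lambda>z. 2 * (A z / D z + B z / D z))" "\<phi> 2 = (\<lambda>z. 2 * \<i> * (A z / D z - B z / D z))"
    "\<phi> 3 = (\<lambda>z. 2 * (C z / D z) - 6)"
    by (simp_all add: \<phi>_def[abs_def])
  note d = A[OF z] B[OF z] C[OF z]
  show "(\<phi> 1 has_field_derivative ((S z)\<^sup>2 - (t z)\<^sup>2) / (E z)\<^sup>2) (at z)"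
    using DERIV_cmult[OF DERIV_add[OF d(1,2)], of 2] E[OF z] unfolding \<phi>
    by (elim DERIV_cong) (simp add: field_simps)
  show "(\<phi> 2 has_field_derivative \<i> * ((S z)\<^sup>2 + (t z)\<^sup>2) / (E z)\<^sup>2) (at z)"
    using DERIV_cmult[OF DERIV_diff[OF d(1,2)], of "2 * \<i>"] E[OF z] unfolding \<phi>
    by (elim DERIV_cong) (simp add: field_simps)
  show "(\<phi> 3 has_field_derivative 2 * S z * t z / (E z)\<^sup>2) (at z)"
    using DERIV_diff[OF DERIV_cmult[OF d(3), of 2] DERIV_const[of 6]] unfolding \<phi>
    by (rule DERIV_cong) simp
qed (use V E St in auto)

lemma X_eq:
  assumes z: "z \<in> V"
  shows "X z = (1 / (cmod (D z))\<^sup>2) *\<^sub>R ends_num (A z) (B z) (C z) (D z)"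
proof -
  have R: "Re (2 * (a / D z)) = 2 * Re (a * cnj (D z)) / (cmod (D z))\<^sup>2" for a
    by (simp add: complex_div_cnj[of a] Re_divide_of_real del: of_real_power)
  have "\<phi> 1 z = 2 * ((A z + B z) / D z)" "\<phi> 2 z = 2 * (\<i> * (A z - B z) / D z)" "\<phi> 3 z = 2 * (C z / D z) - 6"
    by (simp_all add: \<phi>_def add_divide_distrib diff_divide_distrib algebra_simps)
  then show ?thesis
    using D_nz[OF z] unfolding X_def vec_eq_iff forall_3
    by (simp only: vec_lambda_beta minus_complex.sel R ends_num_def vector_3 vector_scaleR_component)
       (simp add: diff_divide_distrib)
qed

lemma r_eq': "z \<in> V \<Longrightarrow> r z = P z / cmod (D z) ^ 2"
  using D_nz by (simp add: r_def X_eq ends_num_den[OF quadric] P_def power2_eq_square field_simps)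

sublocale inverted_minimal_curve V \<phi> f
proof
  fix z assume z: "z \<in> V"
  have "P z > 0" using pos[OF z] by (simp add: P_def)
  then have "r z \<noteq> 0" using r_eq'[OF z] D_nz[OF z] by simp
  then show "X z \<noteq> 0" by (auto simp: r_def)
  show "f z = inverse (r z) *\<^sub>R X z"
    using D_nz[OF z] \<open>P z > 0\<close> by (simp add: f_def r_eq'[OF z] X_eq[OF z])
qed

text \<open>The conformal factor \<open>s^2 \<rho>\<close> is
  \<open>(|D|^2 / P)^2 * (q^2 / |E|^4)\<close>; for \<open>E = D\<close> the zeros and poles cancel,
  and \<open>q^2 / P^2\<close> is positive across the ends.\<close>

lemma willmore_f_UNIV:
  assumes ED: "E = D" and S: "finite S'" "V = - S'" and f: "smooth UNIV f" and P: "smooth UNIV P" "\<And>z. P z > 0"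
    and q: "continuous_on UNIV q" "\<And>z. q z > 0"
  shows "willmore_on UNIV f"
proof -
  have "branched_inverted_curve V \<phi> f S' (\<lambda>z. (q z)\<^sup>2 / (P z)\<^sup>2)"
  proof
    show "continuous_on UNIV (\<lambda>z. (q z)\<^sup>2 / (P z)\<^sup>2)"
      using q P smooth_continuous_on[OF P(1)] by (intro continuous_intros) (auto simp: less_imp_neq[symmetric])
    show "0 < (q z)\<^sup>2 / (P z)\<^sup>2" for z using P(2)[of z] q(2)[of z] by simp
    show "(q z)\<^sup>2 / (P z)\<^sup>2 = (s z)\<^sup>2 * \<rho> z" if z: "z \<in> V" for z
      using D_nz[OF z] P(2)[of z]
      by (simp add: s_def r_eq'[OF z] \<rho>_eq[OF z] ED power_divide power2_eq_square power4_eq_xxxx field_simps)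
  qed (use S f in auto)
  then show ?thesis by (rule branched_inverted_curve.willmore)
qed

end

section \<open>The degenerating family\<close>

text \<open>A spinor \<open>S / D\<close> with \<open>D\<close> having simple roots leads to residue-free \<open>S\<^sup>2 / D\<^sup>2\<close> if \<open>2 S' D' - S D''\<close> vanishes
  modulo \<open>D\<close>. For \<open>D = z\<^sup>3 - e\<close> and \<open>S\<close> of degree at most three, the solutions are spanned by \<open>z\<close> and \<open>z\<^sup>3 + 2 e\<close>.
  For \<open>e = 0\<close> the resulting surface is the Lopez surface with \<open>a = 2\<close>.

  The index \<open>0\<close> refers to the coordinate \<open>z\<close>, the index \<open>1\<close> to \<open>w = 1 / z\<close>, where all data are multiplied by \<open>w\<^sup>4\<close>.\<close>

definition B0 :: "real \<Rightarrow> complex \<Rightarrow> complex" where "B0 e z = (z ^ 4 - 4 * of_real e * z) / 2"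
definition D0 :: "real \<Rightarrow> complex \<Rightarrow> complex" where "D0 e z = z ^ 3 - of_real e"
definition B1 :: "real \<Rightarrow> complex \<Rightarrow> complex" where "B1 e w = (1 - 4 * of_real e * w ^ 3) / 2"
definition D1 :: "real \<Rightarrow> complex \<Rightarrow> complex" where "D1 e w = w * (1 - of_real e * w ^ 3)"

definition P0 :: "real \<Rightarrow> complex \<Rightarrow> real" where "P0 e z = ends_den (3/2) (B0 e z) (3 * z\<^sup>2) (D0 e z) (12 * z)"
definition P1 :: "real \<Rightarrow> complex \<Rightarrow> real" where "P1 e w = ends_den (3/2 * w ^ 4) (B1 e w) (3 * w\<^sup>2) (D1 e w) (12 * w ^ 3)"
definition f0 :: "real \<Rightarrow> complex \<Rightarrow> real^3" where
  "f0 e z = (1 / P0 e z) *\<^sub>R ends_num (3/2) (B0 e z) (3 * z\<^sup>2) (D0 e z)"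
definition f1 :: "real \<Rightarrow> complex \<Rightarrow> real^3" where
  "f1 e w = (1 / P1 e w) *\<^sub>R ends_num (3/2 * w ^ 4) (B1 e w) (3 * w\<^sup>2) (D1 e w)"

lemma chart_change:
  assumes "z \<noteq> 0"
  shows "P0 e z = cmod z ^ 8 * P1 e (1 / z)" "f0 e z = f1 e (1 / z)"
proof -
  have s: "3/2 = z ^ 4 * (3/2 * (1/z) ^ 4)" "B0 e z = z ^ 4 * B1 e (1/z)" "3 * z\<^sup>2 = z ^ 4 * (3 * (1/z)\<^sup>2)"
    "D0 e z = z ^ 4 * D1 e (1/z)" "12 * z = z ^ 4 * (12 * (1/z) ^ 3)"
    using assms by (simp_all add: B0_def B1_def D0_def D1_def field_simps eval_nat_numeral)
  have "P0 e z = (cmod (z ^ 4))\<^sup>2 * P1 e (1 / z)"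
    unfolding P0_def P1_def by (subst s(1), subst s(2), subst s(3), subst s(4), subst s(5)) (rule ends_den_scale)
  moreover have n: "(cmod (z ^ 4))\<^sup>2 = cmod z ^ 8" by (simp add: norm_power flip: power_mult)
  ultimately show P: "P0 e z = cmod z ^ 8 * P1 e (1 / z)" by simp
  have "ends_num (3/2) (B0 e z) (3 * z\<^sup>2) (D0 e z) = (cmod (z ^ 4))\<^sup>2 *\<^sub>R ends_num (3/2 * (1/z) ^ 4) (B1 e (1/z)) (3 * (1/z)\<^sup>2) (D1 e (1/z))"
    by (subst s(1), subst s(2), subst s(3), subst s(4)) (rule ends_num_scale)
  then show "f0 e z = f1 e (1 / z)"
    using assms by (simp add: f0_def f1_def P n)
qed

lemma quadric0: "4 * (3/2) * B0 e z + (3 * z\<^sup>2)\<^sup>2 = 12 * z * D0 e z"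
  by (simp add: B0_def D0_def field_simps eval_nat_numeral)

lemma quadric1: "4 * (3/2 * w ^ 4) * B1 e w + (3 * w\<^sup>2)\<^sup>2 = 12 * w ^ 3 * D1 e w"
  by (simp add: B1_def D1_def field_simps eval_nat_numeral)

text \<open>A zero would put the centre \<open>(0, 0, 6)\<close> on the minimal surface. Lying on
  the axis forces \<open>|B0| = 3/2\<close>, hence \<open>|z| > 6/5\<close>; having height 6 forces
  \<open>|D0| \<le> |z|^2\<close>, hence \<open>|z|^3 - |z|^2 \<le> 1/8\<close>. These bounds are
  incompatible.\<close>

lemma ends_num_nonzero:
  assumes e: "0 \<le> e" "e \<le> 1/8" and D: "D0 e z \<noteq> 0"
  shows "ends_num (3/2) (B0 e z) (3 * z\<^sup>2) (D0 e z) \<noteq> 0"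
proof
  assume "ends_num (3/2) (B0 e z) (3 * z\<^sup>2) (D0 e z) = 0"
  then have n: "Re ((3/2 + B0 e z) * cnj (D0 e z)) = 0" "Re (\<i> * (3/2 - B0 e z) * cnj (D0 e z)) = 0"
    "Re (3 * z\<^sup>2 * cnj (D0 e z)) = 3 * (cmod (D0 e z))\<^sup>2"
    by (simp_all add: ends_num_def vec_eq_iff forall_3)
  \<comment> \<open>Vanishing of the two horizontal components means that \<open>B0 / D0\<close> is
    minus the conjugate of \<open>(3/2) / D0\<close>.\<close>
  have "B0 e z * cnj (D0 e z) = - (3/2 * D0 e z)"
    using n(1,2) by (simp add: complex_eq_iff algebra_simps)
  from arg_cong[OF this, of cmod] D have Bn: "cmod (B0 e z) = 3/2" by (simp add: norm_mult)
  define R where "R = cmod z"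
  have "3 * (cmod (D0 e z))\<^sup>2 \<le> cmod (3 * z\<^sup>2 * cnj (D0 e z))"
    using complex_Re_le_cmod[of "3 * z\<^sup>2 * cnj (D0 e z)"] n(3) by simp
  also have "\<dots> = 3 * R\<^sup>2 * cmod (D0 e z)" by (simp add: norm_mult norm_power R_def)
  finally have "cmod (D0 e z) * cmod (D0 e z) \<le> R\<^sup>2 * cmod (D0 e z)" by (simp add: power2_eq_square)
  then have "cmod (D0 e z) \<le> R\<^sup>2" using D by (simp add: mult_le_cancel_right)
  moreover have "R ^ 3 - 1/8 \<le> cmod (D0 e z)"
    using norm_triangle_ineq2[of "z ^ 3" "of_real e"] e by (simp add: D0_def R_def norm_power)
  ultimately have 1: "R ^ 3 - 1/8 \<le> R\<^sup>2" by simp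
  have "z ^ 4 - 4 * of_real e * z = 2 * B0 e z" by (simp add: B0_def)
  from arg_cong[OF this, of cmod] have "3 = cmod (z ^ 4 - 4 * of_real e * z)" using Bn by (simp add: norm_mult)
  also have "\<dots> \<le> R ^ 4 + 4 * e * R"
    using norm_triangle_ineq4[of "z ^ 4" "4 * of_real e * z"] e by (simp add: norm_mult norm_power R_def)
  also have "\<dots> \<le> R ^ 4 + 4 * (1/8) * R"
    using e by (intro add_left_mono mult_right_mono mult_left_mono) (auto simp: R_def)
  finally have 2: "3 \<le> R ^ 4 + R / 2" by simp
  have R0: "R \<ge> 0" by (simp add: R_def)
  \<comment> \<open>At \<open>6/5\<close> the quantity \<open>R^4 + R / 2\<close> is still below 3,
    while \<open>R^2 (R - 1)\<close> is \<open>0.288\<close> and exceeds \<open>1/8\<close>.\<close>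
  have "R > 6/5"
  proof (rule ccontr)
    assume "\<not> ?thesis"
    then have "R \<le> 6/5" by simp
    then have "R ^ 4 \<le> (6/5) ^ 4" using R0 by (intro power_mono)
    with 2 \<open>R \<le> 6/5\<close> show False by (simp add: eval_nat_numeral)
  qed
  then have "(6/5)\<^sup>2 * (1/5) \<le> R\<^sup>2 * (R - 1)" by (intro mult_mono power_mono) auto
  moreover have "R\<^sup>2 * (R - 1) = R ^ 3 - R\<^sup>2" by (simp add: eval_nat_numeral algebra_simps)
  ultimately show False using 1 by (simp add: eval_nat_numeral)
qed

text \<open>At a root of \<open>D0\<close> the constant \<open>A = 3/2\<close> keeps the value
  positive; elsewhere it is the squared norm of the numerator over \<open>|D0|^2\<close>.\<close>

lemma P0_pos:
  assumes e: "0 \<le> e" "e \<le> 1/8"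
  shows "P0 e z > 0"
proof (cases "D0 e z = 0")
  case True
  have "0 \<le> (cmod (B0 e z))\<^sup>2" "0 \<le> (cmod (3 * z\<^sup>2))\<^sup>2" by simp_all
  then show ?thesis by (simp add: P0_def ends_den_def True power2_eq_square add_pos_nonneg)
next
  case False
  have "0 < ends_num (3/2) (B0 e z) (3 * z\<^sup>2) (D0 e z) \<bullet> ends_num (3/2) (B0 e z) (3 * z\<^sup>2) (D0 e z)"
    using ends_num_nonzero[OF e False] by simp
  also have "\<dots> = P0 e z * (cmod (D0 e z))\<^sup>2"
    unfolding P0_def by (rule ends_num_den[OF quadric0])
  finally show ?thesis using False by (simp add: zero_less_mult_iff)
qed

lemma P1_pos:
  assumes e: "0 \<le> e" "e \<le> 1/8"
  shows "P1 e w > 0"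
proof (cases "w = 0")
  case True
  then show ?thesis by (simp add: P1_def ends_den_def B1_def D1_def norm_divide power2_eq_square)
next
  case False
  then show ?thesis using P0_pos[OF e, of "1 / w"] chart_change(1)[of "1 / w" e] by (simp add: zero_less_mult_iff)
qed

lemma smooth_conv_num_den:
  assumes U: "open U" and c: "smooth_conv U A A'" "smooth_conv U B B'" "smooth_conv U C C'" "smooth_conv U D D'" "smooth_conv U G G'"
  shows "smooth_conv U (\<lambda>k z. ends_den (A k z) (B k z) (C k z) (D k z) (G k z)) (\<lambda>z. ends_den (A' z) (B' z) (C' z) (D' z) (G' z))"
    "smooth_conv U (\<lambda>k z. ends_num (A k z) (B k z) (C k z) (D k z)) (\<lambda>z. ends_num (A' z) (B' z) (C' z) (D' z))"
proof -
  show "smooth_conv U (\<lambda>k z. ends_den (A k z) (B k z) (C k z) (D k z) (G k z)) (\<lambda>z. ends_den (A' z) (B' z) (C' z) (D' z) (G' z))"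
    unfolding ends_den_def cmod_power2 by (intro smooth_conv_arith c U)
  have "smooth_conv U (\<lambda>k z. ends_num (A k z) (B k z) (C k z) (D k z) $ i) (\<lambda>z. ends_num (A' z) (B' z) (C' z) (D' z) $ i)" for i
    using exhaust_3[of i] unfolding ends_num_def cmod_power2
    by (elim disjE; simp only: vector_3; intro smooth_conv_arith c U)
  then show "smooth_conv U (\<lambda>k z. ends_num (A k z) (B k z) (C k z) (D k z)) (\<lambda>z. ends_num (A' z) (B' z) (C' z) (D' z))"
    by (rule smooth_conv_vec3[OF U])
qed

context
  fixes U :: "complex set" and e :: "nat \<Rightarrow> real" and e' :: real
  assumes U: "open U" and e: "e \<longlonglongrightarrow> e'" "\<And>k. 0 \<le> e k" "\<And>k. e k \<le> 1/8" "0 \<le> e'" "e' \<le> 1/8"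
begin

lemma smooth_conv_e: "smooth_conv U (\<lambda>k z. complex_of_real (e k)) (\<lambda>z. complex_of_real e')"
  by (intro smooth_conv_const tendsto_of_real e)

text \<open>The parameter enters the data polynomially, and the denominators are positive for the
  limit parameter as well, so smooth convergence passes to the quotients.\<close>

lemma smooth_conv_family:
  "smooth_conv U (\<lambda>k. P0 (e k)) (P0 e')" "smooth_conv U (\<lambda>k. P1 (e k)) (P1 e')"
  "smooth_conv U (\<lambda>k. f0 (e k)) (f0 e')" "smooth_conv U (\<lambda>k. f1 (e k)) (f1 e')"
proof -
  have c0: "smooth_conv U (\<lambda>k. B0 (e k)) (B0 e')" "smooth_conv U (\<lambda>k. D0 (e k)) (D0 e')"
    unfolding B0_def[abs_def] D0_def[abs_def] divide_complex_def
    by (intro smooth_conv_e smooth_conv_arith U)+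
  have c1: "smooth_conv U (\<lambda>k. B1 (e k)) (B1 e')" "smooth_conv U (\<lambda>k. D1 (e k)) (D1 e')"
    unfolding B1_def[abs_def] D1_def[abs_def] divide_complex_def
    by (intro smooth_conv_e smooth_conv_arith U)+
  have c: "smooth_conv U (\<lambda>k z. 3/2) (\<lambda>z. 3/2 :: complex)" "smooth_conv U (\<lambda>k z. 3 * z\<^sup>2) (\<lambda>z. 3 * z\<^sup>2)"
    "smooth_conv U (\<lambda>k z. 12 * z) (\<lambda>z. 12 * z)" "smooth_conv U (\<lambda>k z. 3/2 * z ^ 4) (\<lambda>z. 3/2 * z ^ 4)"
    "smooth_conv U (\<lambda>k z. 12 * z ^ 3) (\<lambda>z. 12 * z ^ 3)"
    by (intro smooth_conv_arith U)+
  note 0 = smooth_conv_num_den[OF U c(1) c0(1) c(2) c0(2) c(3)]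
  note 1 = smooth_conv_num_den[OF U c(4) c1(1) c(2) c1(2) c(5)]
  show P: "smooth_conv U (\<lambda>k. P0 (e k)) (P0 e')" "smooth_conv U (\<lambda>k. P1 (e k)) (P1 e')"
    using 0(1) 1(1) by (simp_all add: P0_def[abs_def] P1_def[abs_def])
  have nz: "P0 (e k) z \<noteq> 0" "P1 (e k) z \<noteq> 0" "P0 e' z \<noteq> 0" "P1 e' z \<noteq> 0" for k z
    using P0_pos[of "e k" z] P1_pos[of "e k" z] P0_pos[of e' z] P1_pos[of e' z] e by auto
  show "smooth_conv U (\<lambda>k. f0 (e k)) (f0 e')"
    unfolding f0_def[abs_def]
    by (intro smooth_conv_scaleR[OF U smooth_conv_divide[OF U smooth_conv_const' P(1)] 0(2)] nz)
  show "smooth_conv U (\<lambda>k. f1 (e k)) (f1 e')"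
    unfolding f1_def[abs_def]
    by (intro smooth_conv_scaleR[OF U smooth_conv_divide[OF U smooth_conv_const' P(2)] 1(2)] nz)
qed

end

lemma smooth_family:
  assumes "0 \<le> e" "e \<le> 1/8"
  shows "smooth UNIV (P0 e)" "smooth UNIV (P1 e)" "smooth UNIV (f0 e)" "smooth UNIV (f1 e)"
  using smooth_conv_family[of UNIV "\<lambda>_. e" e] assms by (simp_all add: smooth_def)

section \<open>Weierstrass data in both charts and for the limit\<close>

lemma DERIV_quotient':
  fixes a d :: "complex \<Rightarrow> complex"
  assumes "(a has_field_derivative a') (at z)" "(d has_field_derivative d') (at z)" "d z \<noteq> 0"
    and "(a' * d z - a z * d') * k = n * (d z)\<^sup>2" "k \<noteq> 0"
  shows "((\<lambda>z. a z / d z) has_field_derivative n / k) (at z)"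
proof (rule DERIV_cong[OF DERIV_divide[OF assms(1-3)]])
  show "(a' * d z - a z * d') / (d z * d z) = n / k"
    using assms(3-5) by (simp add: frac_eq_eq power2_eq_square mult_ac)
qed

text \<open>Both are \<open>|S|^2 + |t|^2\<close>; in the coordinate \<open>w = 1 / z\<close> the
  spinors are multiplied by \<open>w^3\<close>, up to a factor of modulus one.\<close>

definition q0 :: "real \<Rightarrow> complex \<Rightarrow> real" where
  "q0 e z = (cmod (3 * \<i> * z))\<^sup>2 + (cmod (\<i> * (z ^ 3 + 2 * of_real e)))\<^sup>2"
definition q1 :: "real \<Rightarrow> complex \<Rightarrow> real" where
  "q1 e w = (cmod (3 * w\<^sup>2))\<^sup>2 + (cmod (1 + 2 * of_real e * w ^ 3))\<^sup>2"

lemma q0_q1: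
  assumes "z \<noteq> 0"
  shows "q0 e z = cmod z ^ 6 * q1 e (1 / z)"
proof -
  have "3 * z = z ^ 3 * (3 * (1 / z)\<^sup>2)" "z ^ 3 + 2 * of_real e = z ^ 3 * (1 + 2 * of_real e * (1/z) ^ 3)"
    using assms by (simp_all add: field_simps eval_nat_numeral)
  note s = this
  have "q0 e z = (cmod (3 * z))\<^sup>2 + (cmod (z ^ 3 + 2 * of_real e))\<^sup>2" by (simp add: q0_def norm_mult)
  also have "\<dots> = (cmod (z ^ 3))\<^sup>2 * q1 e (1 / z)"
    by (subst s(1), subst s(2))
       (simp only: norm_mult[of "z ^ 3"] power_mult_distrib q1_def distrib_left[of "(cmod (z ^ 3))\<^sup>2"])
  also have "(cmod (z ^ 3))\<^sup>2 = cmod z ^ 6" by (simp add: norm_power flip: power_mult)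
  finally show ?thesis .
qed

text \<open>The spinors \<open>z\<close> and \<open>z^3 + 2 e\<close> have a common zero only for
  \<open>e = 0\<close>; it is the branch point of the inverted Lopez surface.\<close>

lemma q0_pos: assumes "e > 0" shows "q0 e z > 0"
proof (cases "z = 0")
  case True
  then show ?thesis using assms by (simp add: q0_def norm_mult)
next
  case False
  then have "0 < (cmod (3 * \<i> * z))\<^sup>2" by simp
  then show ?thesis unfolding q0_def by (rule add_pos_nonneg) simp
qed

lemma q1_pos: "q1 e w > 0"
proof (cases "w = 0")
  case True
  then show ?thesis by (simp add: q1_def)
next
  case False
  then have "0 < (cmod (3 * w\<^sup>2))\<^sup>2" by simp
  then show ?thesis unfolding q1_def by (rule add_pos_nonneg) simp
qed

lemma smooth_q: "smooth UNIV (q0 e)" "smooth UNIV (q1 e)"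
  unfolding smooth_def q0_def[abs_def] q1_def[abs_def] cmod_power2
  by (auto intro!: smooth_conv_arith)

lemma finite_D0: "finite {z. D0 e z = 0}"
proof -
  have "{z. D0 e z = 0} = {z. poly [:- of_real e, 0, 0, 1:] z = 0}"
    by (auto simp: D0_def power3_eq_cube mult.assoc)
  then show ?thesis by (simp only:) (rule poly_roots_finite, simp)
qed

lemma finite_D1: "finite {w. D1 e w = 0}"
proof -
  have "{w. D1 e w = 0} = {w. poly [:0, 1, 0, 0, - of_real e:] w = 0}"
    by (auto simp: D1_def power3_eq_cube mult.assoc algebra_simps)
  then show ?thesis by (simp only:) (rule poly_roots_finite, simp)
qed

lemma DERIV_B0: "(B0 e has_field_derivative 2 * z ^ 3 - 2 * of_real e) (at z)"
  unfolding B0_def by (auto intro!: derivative_eq_intros simp: field_simps)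

lemma DERIV_D0: "(D0 e has_field_derivative 3 * z\<^sup>2) (at z)"
  unfolding D0_def by (auto intro!: derivative_eq_intros)

lemma DERIV_B1: "(B1 e has_field_derivative - 6 * of_real e * w\<^sup>2) (at w)"
  unfolding B1_def by (auto intro!: derivative_eq_intros simp: field_simps)

lemma DERIV_D1: "(D1 e has_field_derivative 1 - 4 * of_real e * w ^ 3) (at w)"
  unfolding D1_def by (auto intro!: derivative_eq_intros simp: field_simps eval_nat_numeral)

lemma planar_ends0:
  assumes e: "0 < e" "e \<le> 1/8"
  shows "planar_ends (- {z. D0 e z = 0}) (\<lambda>_. 3/2) (B0 e) (\<lambda>z. 3 * z\<^sup>2) (D0 e) (\<lambda>z. 12 * z)
    (\<lambda>z. 3 * \<i> * z) (\<lambda>z. \<i> * (z ^ 3 + 2 * of_real e)) (D0 e)"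
proof
  show "open (- {z. D0 e z = 0})" using finite_imp_closed[OF finite_D0] by blast
  fix z assume z: "z \<in> - {z. D0 e z = 0}"
  then show D: "D0 e z \<noteq> 0" by simp
  show "3 * \<i> * z \<noteq> 0 \<or> \<i> * (z ^ 3 + 2 * of_real e) \<noteq> 0" using e by auto
  show "4 * (3/2) * B0 e z + (3 * z\<^sup>2)\<^sup>2 = 12 * z * D0 e z" by (rule quadric0)
  show "((\<lambda>z. (3/2) / D0 e z) has_field_derivative (3 * \<i> * z)\<^sup>2 / (2 * (D0 e z)\<^sup>2)) (at z)"
    by (rule DERIV_quotient'[OF DERIV_const DERIV_D0]) (use D in \<open>simp_all add: power_mult_distrib\<close>)
  show "((\<lambda>z. B0 e z / D0 e z) has_field_derivative - (\<i> * (z ^ 3 + 2 * of_real e))\<^sup>2 / (2 * (D0 e z)\<^sup>2)) (at z)"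
    by (rule DERIV_quotient'[OF DERIV_B0 DERIV_D0])
       (use D in \<open>simp_all add: power_mult_distrib\<close>, simp add: B0_def D0_def field_simps eval_nat_numeral)
  show "((\<lambda>z. 3 * z\<^sup>2 / D0 e z) has_field_derivative 3 * \<i> * z * (\<i> * (z ^ 3 + 2 * of_real e)) / (D0 e z)\<^sup>2) (at z)"
    by (rule DERIV_quotient'[OF _ DERIV_D0, where a' = "6 * z"])
       (use D in \<open>auto intro!: derivative_eq_intros\<close>, simp add: D0_def field_simps eval_nat_numeral)
  show "ends_den (3/2) (B0 e z) (3 * z\<^sup>2) (D0 e z) (12 * z) > 0"
    using P0_pos[of e z] e by (simp add: P0_def)
qed

text \<open>Since \<open>dz = -dw / w^2\<close>, the squares of the spinors change sign; this
  absorbs the factor \<open>\<i>\<close> that both carry in the coordinate \<open>z\<close>.\<close>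

lemma planar_ends1:
  assumes e: "0 < e" "e \<le> 1/8"
  shows "planar_ends (- {z. D1 e z = 0}) (\<lambda>w. 3/2 * w ^ 4) (B1 e) (\<lambda>z. 3 * z\<^sup>2) (D1 e) (\<lambda>w. 12 * w ^ 3)
    (\<lambda>w. 3 * w\<^sup>2) (\<lambda>w. 1 + 2 * of_real e * w ^ 3) (D1 e)"
proof
  show "open (- {z. D1 e z = 0})" using finite_imp_closed[OF finite_D1] by blast
  fix z assume z: "z \<in> - {z. D1 e z = 0}"
  then show D: "D1 e z \<noteq> 0" by simp
  show "3 * z\<^sup>2 \<noteq> 0 \<or> 1 + 2 * of_real e * z ^ 3 \<noteq> 0" by auto
  show "4 * (3/2 * z ^ 4) * B1 e z + (3 * z\<^sup>2)\<^sup>2 = 12 * z ^ 3 * D1 e z" by (rule quadric1)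
  show "((\<lambda>z. 3/2 * z ^ 4 / D1 e z) has_field_derivative (3 * z\<^sup>2)\<^sup>2 / (2 * (D1 e z)\<^sup>2)) (at z)"
    by (rule DERIV_quotient'[OF _ DERIV_D1, where a' = "6 * z ^ 3"])
       (use D in \<open>auto intro!: derivative_eq_intros\<close>, simp add: D1_def field_simps eval_nat_numeral)
  show "((\<lambda>z. B1 e z / D1 e z) has_field_derivative - (1 + 2 * of_real e * z ^ 3)\<^sup>2 / (2 * (D1 e z)\<^sup>2)) (at z)"
    by (rule DERIV_quotient'[OF DERIV_B1 DERIV_D1])
       (use D in simp_all, simp add: B1_def D1_def field_simps eval_nat_numeral)
  show "((\<lambda>z. 3 * z\<^sup>2 / D1 e z) has_field_derivative 3 * z\<^sup>2 * (1 + 2 * of_real e * z ^ 3) / (D1 e z)\<^sup>2) (at z)"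
    by (rule DERIV_quotient'[OF _ DERIV_D1, where a' = "6 * z"])
       (use D in \<open>auto intro!: derivative_eq_intros\<close>, simp add: D1_def field_simps eval_nat_numeral)
  show "ends_den (3/2 * z ^ 4) (B1 e z) (3 * z\<^sup>2) (D1 e z) (12 * z ^ 3) > 0"
    using P1_pos[of e z] e by (simp add: P1_def)
qed

text \<open>The common factor \<open>z\<close> has been cancelled from the spinors and their
  denominator, now \<open>z^2\<close>, while the surface itself keeps the denominator
  \<open>D0 0 = z^3\<close>.\<close>

lemma planar_ends_lopez:
  "planar_ends (- {0}) (\<lambda>_. 3/2) (B0 0) (\<lambda>z. 3 * z\<^sup>2) (D0 0) (\<lambda>z. 12 * z)
    (\<lambda>z. 3 * \<i>) (\<lambda>z. \<i> * z\<^sup>2) (\<lambda>z. z\<^sup>2)"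
proof
  fix z :: complex assume z: "z \<in> - {0}"
  then show D: "D0 0 z \<noteq> 0" "z\<^sup>2 \<noteq> 0" by (simp_all add: D0_def)
  show "3 * \<i> \<noteq> 0 \<or> \<i> * z\<^sup>2 \<noteq> 0" by auto
  show "4 * (3/2) * B0 0 z + (3 * z\<^sup>2)\<^sup>2 = 12 * z * D0 0 z" by (rule quadric0)
  show "((\<lambda>z. (3/2) / D0 0 z) has_field_derivative (3 * \<i>)\<^sup>2 / (2 * (z\<^sup>2)\<^sup>2)) (at z)"
    by (rule DERIV_quotient'[OF DERIV_const DERIV_D0])
       (use D z in \<open>simp_all add: power_mult_distrib\<close>, simp add: D0_def field_simps eval_nat_numeral)
  show "((\<lambda>z. B0 0 z / D0 0 z) has_field_derivative - (\<i> * z\<^sup>2)\<^sup>2 / (2 * (z\<^sup>2)\<^sup>2)) (at z)"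
    by (rule DERIV_quotient'[OF DERIV_B0 DERIV_D0])
       (use D z in \<open>simp_all add: power_mult_distrib\<close>, simp add: B0_def D0_def field_simps eval_nat_numeral)
  show "((\<lambda>z. 3 * z\<^sup>2 / D0 0 z) has_field_derivative 3 * \<i> * (\<i> * z\<^sup>2) / (z\<^sup>2)\<^sup>2) (at z)"
    by (rule DERIV_quotient'[OF _ DERIV_D0, where a' = "6 * z"])
       (use D z in \<open>auto intro!: derivative_eq_intros\<close>, simp add: D0_def field_simps eval_nat_numeral)
  show "ends_den (3/2) (B0 0 z) (3 * z\<^sup>2) (D0 0 z) (12 * z) > 0"
    using P0_pos[of 0 z] by (simp add: P0_def)
qed auto

lemma holomorphic_D: "D0 e holomorphic_on U" "D1 e holomorphic_on U"
  unfolding D0_def[abs_def] D1_def[abs_def] by (intro holomorphic_intros)+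

section \<open>Energies from growth degrees\<close>

lemma family0:
  assumes e: "0 < e" "e \<le> 1/8"
  shows "willmore_on UNIV (f0 e)" "W_energy (f0 e) = ennreal (16 * pi)" "E_energy (f0 e) = ennreal (56 * pi)"
proof -
  interpret planar_ends "- {z. D0 e z = 0}" "\<lambda>_. 3/2" "B0 e" "\<lambda>z. 3 * z\<^sup>2" "D0 e" "\<lambda>z. 12 * z"
    "\<lambda>z. 3 * \<i> * z" "\<lambda>z. \<i> * (z ^ 3 + 2 * of_real e)" "D0 e"
    by (rule planar_ends0[OF e])
  have P: "P = P0 e" and q: "q = q0 e" by (auto simp: P_def[abs_def] P0_def q_def q0_def)
  have f: "f = f0 e" by (auto simp: f_def[abs_def] f0_def P)
  have e': "0 \<le> e" using e by simp
  note sm = smooth_family[OF e' e(2)] smooth_q[of e]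
  show "willmore_on UNIV (f0 e)"
    using willmore_f_UNIV[OF refl finite_D0 refl] sm P0_pos[OF e' e(2)] q0_pos[OF e(1)]
    by (simp add: P q f smooth_continuous_on)
  \<comment> \<open>The growth degrees are 8 from \<open>chart_change\<close> and 6 from
    \<open>q0_q1\<close>, hence \<open>2 pi * 8\<close> and \<open>2 pi * (16 + 12)\<close>.\<close>
  note en = energies[OF finite_D0 refl holomorphic_D(1) holomorphic_D(1) D_nz E r_eq' \<rho>_eq, unfolded P q f,
      OF _ _ _ _ sm(1) P0_pos[OF e' e(2)] sm(2) P1_pos[OF e' e(2)] sm(5) q0_pos[OF e(1)] sm(6) q1_pos
         chart_change(1) q0_q1]
  show "W_energy (f0 e) = ennreal (16 * pi)" "E_energy (f0 e) = ennreal (56 * pi)"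
    using en by (simp_all add: mult.commute)
qed

lemma family1:
  assumes e: "0 < e" "e \<le> 1/8"
  shows "willmore_on UNIV (f1 e)"
proof -
  interpret planar_ends "- {z. D1 e z = 0}" "\<lambda>w. 3/2 * w ^ 4" "B1 e" "\<lambda>z. 3 * z\<^sup>2" "D1 e" "\<lambda>w. 12 * w ^ 3"
    "\<lambda>w. 3 * w\<^sup>2" "\<lambda>w. 1 + 2 * of_real e * w ^ 3" "D1 e"
    by (rule planar_ends1[OF e])
  have P: "P = P1 e" and q: "q = q1 e" by (rule ext, simp only: P_def P1_def q_def q1_def)+
  have f: "f = f1 e" by (rule ext) (simp only: f_def f1_def P)
  have e': "0 \<le> e" using e by simp
  show "willmore_on UNIV (f1 e)"
    using willmore_f_UNIV[OF refl finite_D1 refl, unfolded P q f, OF smooth_family(4,2)[OF e' e(2)] P1_pos[OF e' e(2)]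
      smooth_continuous_on[OF smooth_q(2)] q1_pos] .
qed

text \<open>The reduced spinors have squared norm of degree 4, giving
  \<open>2 pi * (16 + 8)\<close>; the \<open>8 pi\<close> missing from the family is the energy of
  the bubble.\<close>

lemma lopez_energy: "E_energy (f0 0) = ennreal (48 * pi)"
proof -
  interpret planar_ends "- {0}" "\<lambda>_. 3/2" "B0 0" "\<lambda>z. 3 * z\<^sup>2" "D0 0" "\<lambda>z. 12 * z"
    "\<lambda>z. 3 * \<i>" "\<lambda>z. \<i> * z\<^sup>2" "\<lambda>z. z\<^sup>2"
    by (rule planar_ends_lopez)
  have P: "P = P0 0" by (auto simp: P_def[abs_def] P0_def)
  have f: "f = f0 0" by (auto simp: f_def[abs_def] f0_def P)
  have q: "q = (\<lambda>z. (cmod (3 * \<i>))\<^sup>2 + (cmod (\<i> * z\<^sup>2))\<^sup>2)" by (auto simp: q_def)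
  have sq: "smooth UNIV q" unfolding q smooth_def cmod_power2 by (auto intro!: smooth_conv_arith)
  have qp: "q z > 0" for z by (simp add: q norm_mult add_pos_nonneg)
  have qq: "q z = cmod z ^ 4 * q1 0 (1 / z)" if "z \<noteq> 0" for z
    using that by (simp add: q q1_def norm_mult norm_divide norm_power power_mult_distrib power_divide distrib_left flip: power_mult)
  have sm: "smooth UNIV (P0 0)" "smooth UNIV (P1 0)" by (auto intro: smooth_family)
  have pp: "P0 0 z > 0" "P1 0 z > 0" for z by (auto intro: P0_pos P1_pos)
  have h: "(\<lambda>z. z\<^sup>2) holomorphic_on - {0}" by (intro holomorphic_intros)
  note en = energies(2)[OF _ refl holomorphic_D(1) h D_nz E r_eq' \<rho>_eq, unfolded P f,
      OF _ _ _ _ _ sm(1) pp(1) sm(2) pp(2) sq qp smooth_q(2) q1_pos chart_change(1) qq]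
  show ?thesis using en by (simp add: mult.commute)
qed

text \<open>The spinors are 1 and \<open>z\<close> over the denominator 1, so
  \<open>\<rho> = (1 + |z|^2)^2\<close> has growth degree 4. The surface is not inverted, and its
  energy density is the Laplacian of \<open>ln \<rho>\<close> alone.\<close>

lemma enneper_energy: "E_energy enneper = ennreal (8 * pi)"
proof -
  define \<phi> :: "3 \<Rightarrow> complex \<Rightarrow> complex" where
    "\<phi> k z = (if k = 1 then z - z ^ 3 / 3 else if k = 2 then \<i> * (z + z ^ 3 / 3) else z\<^sup>2)" for k z
  interpret spinor_curve UNIV \<phi> "\<lambda>_. 1" "\<lambda>z. z" "\<lambda>_. 1"
  proof
    have "\<phi> 1 = (\<lambda>z. z - z ^ 3 / 3)" "\<phi> 2 = (\<lambda>z. \<i> * (z + z ^ 3 / 3))" "\<phi> 3 = (\<lambda>z. z\<^sup>2)"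
      by (simp_all add: \<phi>_def[abs_def])
    note \<phi> = this
    fix z :: complex
    show "(\<phi> 1 has_field_derivative (1\<^sup>2 - z\<^sup>2) / 1\<^sup>2) (at z)" "(\<phi> 2 has_field_derivative \<i> * (1\<^sup>2 + z\<^sup>2) / 1\<^sup>2) (at z)"
      "(\<phi> 3 has_field_derivative 2 * 1 * z / 1\<^sup>2) (at z)"
      unfolding \<phi> by (auto intro!: derivative_eq_intros)
  qed auto
  have X: "X = enneper"
    by (auto simp: X_def[abs_def] enneper_def[abs_def] Re_vec_def vec_eq_iff forall_3 \<phi>_def algebra_simps)
  have q: "q = (\<lambda>z. 1 + (cmod z)\<^sup>2)" by (auto simp: q_def)
  have sq: "smooth UNIV q" "smooth UNIV (\<lambda>z. q z ^ 2)"
    unfolding q smooth_def cmod_power2 by (auto intro!: smooth_conv_arith)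
  have qp: "q z > 0" for z by (simp add: q add_pos_nonneg)
  have \<rho>: "\<rho> = (\<lambda>z. q z ^ 2)" by (auto simp: \<rho>_eq)
  show ?thesis
  proof (subst E_energy_eq[OF finite.emptyI])
    show "tensor_norm_sq (metric enneper z) (second_ff enneper z) * area_density enneper z = Lap (\<lambda>z. ln (q z ^ 2)) z" for z
      using E_density_X[of z] by (simp add: X \<rho>)
    have "(\<integral>\<^sup>+ z. ennreal (Lap (\<lambda>z. ln (q z ^ 2)) z) \<partial>lborel) = ennreal (2 * pi * real 4)"
    proof (rule nn_integral_Lap_ln[OF sq(2) _ sq(2) _ _ finite.emptyI])
      show "q z ^ 2 = cmod z ^ 4 * q (1 / z) ^ 2" if "z \<noteq> 0" for z
        using that by (simp add: q norm_divide field_simps eval_nat_numeral)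
      show "0 \<le> Lap (\<lambda>z. ln (q z ^ 2)) z" for z
        using Lap_ln_\<rho>[of z] \<rho>_pos[of z] by (simp add: \<rho>)
    qed (use qp in \<open>auto simp: less_imp_neq[symmetric]\<close>)
    then show "(\<integral>\<^sup>+ z. ennreal (Lap (\<lambda>z. ln (q z ^ 2)) z) \<partial>lborel) = ennreal (8 * pi)"
      by (simp add: mult.commute)
  qed
qed


section \<open>Maps on the sphere\<close>

lemma stereo_components:
  "stereo z $ 1 = 2 * Re z / (1 + (cmod z)\<^sup>2)" "stereo z $ 2 = 2 * Im z / (1 + (cmod z)\<^sup>2)"
  "stereo z $ 3 = ((cmod z)\<^sup>2 - 1) / (1 + (cmod z)\<^sup>2)"
  by (simp_all add: stereo_def)

lemma stereo_inf_components:
  "stereo_inf z $ 1 = 2 * Re z / (1 + (cmod z)\<^sup>2)" "stereo_inf z $ 2 = - 2 * Im z / (1 + (cmod z)\<^sup>2)"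
  "stereo_inf z $ 3 = (1 - (cmod z)\<^sup>2) / (1 + (cmod z)\<^sup>2)"
  by (simp_all add: stereo_inf_def)

lemma one_plus_norm_power2: "1 + (cmod z)\<^sup>2 > 0"
  by (simp add: add_pos_nonneg)

definition unstereo :: "real^3 \<Rightarrow> complex" where
  "unstereo x = Complex (x $ 1 / (1 - x $ 3)) (x $ 2 / (1 - x $ 3))"
definition unstereo_inf :: "real^3 \<Rightarrow> complex" where
  "unstereo_inf x = Complex (x $ 1 / (1 + x $ 3)) (- x $ 2 / (1 + x $ 3))"

lemma stereo_nz: "1 - stereo z $ 3 \<noteq> 0" "1 + stereo_inf z $ 3 \<noteq> 0"
  using one_plus_norm_power2[of z] by (simp_all add: stereo_components stereo_inf_components field_simps)

lemma unstereo_stereo [simp]: "unstereo (stereo z) = z"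
proof -
  have "1 - stereo z $ 3 = 2 / (1 + (cmod z)\<^sup>2)"
    using one_plus_norm_power2[of z] by (simp add: stereo_components field_simps)
  then show ?thesis
    using one_plus_norm_power2[of z] by (simp add: unstereo_def stereo_components complex_eq_iff)
qed

lemma unstereo_inf_stereo_inf [simp]: "unstereo_inf (stereo_inf z) = z"
proof -
  have "1 + stereo_inf z $ 3 = 2 / (1 + (cmod z)\<^sup>2)"
    using one_plus_norm_power2[of z] by (simp add: stereo_inf_components field_simps)
  then show ?thesis
    using one_plus_norm_power2[of z] by (simp add: unstereo_inf_def stereo_inf_components complex_eq_iff)
qed

text \<open>On the sphere only the north pole is missed by \<open>stereo\<close>; its value comes
  from the other chart.\<close>

definition glue :: "(complex \<Rightarrow> real^3) \<Rightarrow> (complex \<Rightarrow> real^3) \<Rightarrow> real^3 \<Rightarrow> real^3" where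
  "glue g h x = (if x = stereo_inf 0 then h 0 else g (unstereo x))"

lemma stereo_neq: "stereo z \<noteq> stereo_inf 0" "stereo_inf w \<noteq> stereo 0"
proof -
  have "stereo_inf 0 $ 3 = 1" "stereo 0 $ 3 = - 1" by (simp_all add: stereo_components stereo_inf_components)
  then show "stereo z \<noteq> stereo_inf 0" "stereo_inf w \<noteq> stereo 0"
    using stereo_nz(1)[of z] stereo_nz(2)[of w] by auto
qed

lemma glue_stereo: "glue g h \<circ> stereo = g"
  by (auto simp: glue_def stereo_neq)

lemma glue_stereo_inf:
  assumes "\<And>z. z \<noteq> 0 \<Longrightarrow> g z = h (1 / z)"
  shows "glue g h \<circ> stereo_inf = h"
proof
  fix w
  show "(glue g h \<circ> stereo_inf) w = h w"
  proof (cases "w = 0")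
    case True
    then show ?thesis by (simp add: glue_def)
  next
    case False
    then have "(glue g h \<circ> stereo_inf) w = (glue g h \<circ> stereo) (1 / w)"
      by (simp add: stereo_inf_eq_stereo)
    also have "\<dots> = h w" using False by (simp only: glue_stereo) (simp add: assms)
    finally show ?thesis .
  qed
qed

lemma continuous_on_sphere_charts:
  fixes F :: "real^3 \<Rightarrow> real^3"
  assumes "continuous_on UNIV (F \<circ> stereo)" "continuous_on UNIV (F \<circ> stereo_inf)"
  shows "continuous_on (sphere 0 1) F"
proof -
  let ?N = "stereo_inf 0" and ?S = "stereo 0"
  have pt: "x \<in> range stereo" if "x \<in> sphere 0 1 - {?N}" for x
    using that by (auto simp: sphere_eq_charts)
  have pt': "x \<in> range stereo_inf" if "x \<in> sphere 0 1 - {?S}" for x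
  proof (cases "x = ?N")
    case False
    have "x \<in> insert ?N (range stereo)" using that unfolding sphere_eq_charts by blast
    then obtain z where z: "x = stereo z" using False by blast
    then have "z \<noteq> 0" using that by auto
    then have "x = stereo_inf (1 / z)" by (simp add: z stereo_inf_eq_stereo)
    then show ?thesis by blast
  qed auto
  have 1: "continuous_on (sphere 0 1 - {?N}) F"
  proof (rule continuous_on_eq)
    show "continuous_on (sphere 0 1 - {?N}) (\<lambda>x. (F \<circ> stereo) (unstereo x))"
      unfolding unstereo_def
      by (rule continuous_on_compose2[OF assms(1)])
         (use pt stereo_nz(1) in \<open>fastforce intro!: continuous_intros\<close>)+
  qed (use pt in force)
  have 2: "continuous_on (sphere 0 1 - {?S}) F"
  proof (rule continuous_on_eq)
    show "continuous_on (sphere 0 1 - {?S}) (\<lambda>x. (F \<circ> stereo_inf) (unstereo_inf x))"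
      unfolding unstereo_inf_def
      by (rule continuous_on_compose2[OF assms(2)])
         (use pt' stereo_nz(2) in \<open>fastforce intro!: continuous_intros\<close>)+
  qed (use pt' in force)
  have "continuous_on (sphere 0 1 - {?N} \<union> (sphere 0 1 - {?S})) F"
    by (rule continuous_on_Un_local_open[OF _ _ 1 2])
       (use stereo_neq(1)[of 0] in \<open>auto simp: openin_open intro: exI[of _ "- {?N}"] exI[of _ "- {?S}"]\<close>)
  moreover have "sphere 0 1 - {?N} \<union> (sphere 0 1 - {?S}) = sphere 0 1"
    using stereo_neq(1)[of 0] by auto
  ultimately show ?thesis by simp
qed

section \<open>The family on the sphere and its Lopez limit\<close>

definition inverted_family :: "real \<Rightarrow> real^3 \<Rightarrow> real^3" where "inverted_family e = glue (f0 e) (f1 e)"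

lemma inverted_family_charts: "inverted_family e \<circ> stereo = f0 e" "inverted_family e \<circ> stereo_inf = f1 e"
  unfolding inverted_family_def by (rule glue_stereo, rule glue_stereo_inf, rule chart_change(2))

text \<open>The point 0 is the south pole, outside the chart at infinity, so convergence in that
  chart concerns the whole plane.\<close>

lemma vimage_stereo: "stereo -` (sphere 0 1 - {stereo 0}) = - {0}"
  "stereo_inf -` (sphere 0 1 - {stereo 0}) = UNIV"
proof -
  have "stereo z = stereo 0 \<longleftrightarrow> z = 0" for z by (metis unstereo_stereo)
  then show "stereo -` (sphere 0 1 - {stereo 0}) = - {0}" using stereo_in_sphere by auto
  have "stereo_inf z \<in> sphere 0 1" for z
    using stereo_in_sphere[of "1 / z"] by (cases "z = 0") (simp_all add: stereo_inf_eq_stereo stereo_inf_0 norm_axis_1)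
  then show "stereo_inf -` (sphere 0 1 - {stereo 0}) = UNIV" using stereo_neq by auto
qed

lemma inverted_family_smooth_convergence:
  assumes "e \<longlonglongrightarrow> 0" "\<And>k. 0 \<le> e k" "\<And>k. e k \<le> 1/8"
  shows "smooth_convergence_sphere (sphere 0 1 - {stereo 0}) (\<lambda>k. inverted_family (e k)) (inverted_family 0)"
  unfolding smooth_convergence_sphere_def sphere_charts_def ball_simps inverted_family_charts vimage_stereo
  by (intro conjI Cinf_loc_tendsto_if_smooth_conv smooth_conv_family assms) auto

lemma f0_lopez:
  assumes "z \<noteq> 0"
  shows "f0 0 z = inversion (vector [0, 0, 6]) (lopez 2 z)"
proof -
  interpret planar_ends "- {0}" "\<lambda>_. 3/2" "B0 0" "\<lambda>z. 3 * z\<^sup>2" "D0 0" "\<lambda>z. 12 * z"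
    "\<lambda>z. 3 * \<i>" "\<lambda>z. \<i> * z\<^sup>2" "\<lambda>z. z\<^sup>2"
    by (rule planar_ends_lopez)
  have "P = P0 0" by (auto simp: P_def[abs_def] P0_def)
  then have f': "f = f0 0" by (auto simp: f_def[abs_def] f0_def)
  have X: "X z = lopez 2 z - vector [0, 0, 6]"
  proof -
    \<comment> \<open>For \<open>a = 2\<close> the Lopez coefficients \<open>a^2 / 8\<close> and
      \<open>3 a / 2\<close> are \<open>1/2\<close> and 3.\<close>
    define u v w where "u = 3 / (2 * z ^ 3)" and "v = z / 2" and "w = 3 / z"
    have "\<phi> 1 z = 2 * (u + v)" "\<phi> 2 z = 2 * (\<i> * (u - v))" "\<phi> 3 z = 2 * w - 6"
      unfolding \<phi>_def B0_def D0_def u_def v_def w_def using assms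
      by (simp_all add: field_simps eval_nat_numeral)
    moreover have "lopez 2 z = 2 *\<^sub>R Re_vec (u *s vector [1, \<i>, 0] + v *s vector [1, - \<i>, 0] + w *s vector [0, 0, 1])"
      by (simp add: lopez_def u_def v_def w_def)
    ultimately show ?thesis
      unfolding X_def Re_vec_def by (simp add: vec_eq_iff forall_3)
  qed
  have "f z = inverse (r z) *\<^sub>R X z" using f[of z] assms by simp
  then show ?thesis
    by (simp add: f' X inversion_def r_def power2_norm_eq_inner inverse_eq_divide)
qed

text \<open>The positive distance of the centre from the surface is dual to a bound on the inverted
  surface: norm at most \<open>M\<close> after inversion means distance at least
  \<open>1 / M\<close> before, and \<open>M\<close> exists by compactness of the sphere.\<close>

lemma inverted_family_lopez: "is_inverted_lopez (inverted_family 0)"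
proof -
  let ?p = "vector [0, 0, 6] :: real^3"
  have c: "continuous_on (sphere 0 1) (inverted_family 0)"
    by (intro continuous_on_sphere_charts) (auto simp: inverted_family_charts intro!: smooth_continuous_on smooth_family)
  have eq: "inverted_family 0 (stereo z) = inversion ?p (lopez 2 z)" if "z \<noteq> 0" for z
    using fun_cong[OF inverted_family_charts(1)[of 0], of z] f0_lopez[OF that] by simp
  obtain M where M: "M > 0" "\<And>x. x \<in> sphere 0 1 \<Longrightarrow> norm (inverted_family 0 x) \<le> M"
    using compact_imp_bounded[OF compact_continuous_image[OF c compact_sphere]] by (auto simp: bounded_pos)
  have "1 / M \<le> dist ?p y" if "y \<in> lopez 2 ` (- {0})" for y
  proof -
    from that obtain z where z: "z \<noteq> 0" "y = lopez 2 z" by auto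
    have n: "norm (inverted_family 0 (stereo z)) = norm (y - ?p) / (norm (y - ?p))\<^sup>2"
      unfolding eq[OF z(1)] z(2) inversion_def by simp
    \<comment> \<open>As division by zero yields 0, \<open>inversion p p = 0\<close>: a point of the
      surface at the centre would be a zero of \<open>f0 0\<close>.\<close>
    have "f0 0 z \<noteq> 0"
      using ends_num_nonzero[of 0 z] P0_pos[of 0 z] z(1) by (auto simp: f0_def D0_def)
    then have "y - ?p \<noteq> 0" using f0_lopez[OF z(1)] by (auto simp: inversion_def z(2))
    then have p: "norm (y - ?p) > 0" by simp
    have "1 / norm (y - ?p) \<le> M" using M(2)[OF stereo_in_sphere, of z] p by (simp add: n power2_eq_square)
    then have "1 / M \<le> norm (y - ?p)" using p M(1) by (simp add: field_simps)
    then show ?thesis by (simp add: dist_norm norm_minus_commute)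
  qed
  then have "1 / M \<le> infdist ?p (lopez 2 ` (- {0}))"
    by (subst infdist_notempty) (auto intro!: cINF_greatest)
  then have "infdist ?p (lopez 2 ` (- {0})) > 0" using M(1) by (meson divide_pos_pos less_le_trans zero_less_one)
  then show ?thesis unfolding is_inverted_lopez_def using eq c
    by (intro exI[of _ 2] exI[of _ ?p]) auto
qed

theorem theorem1p3:
  shows "\<exists>(\<Phi> :: nat \<Rightarrow> real^3 \<Rightarrow> real^3) (\<Phi>inf :: real^3 \<Rightarrow> real^3) (\<Psi>inf :: complex \<Rightarrow> real^3).
    (\<forall>k. willmore_immersion_sphere (\<Phi> k)) \<and>
    (\<forall>k. W_sphere (\<Phi> k) = ennreal (16 * pi)) \<and>
    is_inverted_lopez \<Phi>inf \<and>
    smooth_convergence_sphere (sphere 0 1 - {stereo 0}) \<Phi> \<Phi>inf \<and>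
    is_enneper \<Psi>inf \<and>
    (\<lambda>k. E_sphere (\<Phi> k)) \<longlonglongrightarrow> E_sphere \<Phi>inf + E_energy \<Psi>inf"
proof -
  \<comment> \<open>\<open>1/8\<close> is the bound under which the centre of inversion was shown to
    avoid the surface; every \<open>e k\<close> is positive, so no member of the sequence is
    branched.\<close>
  define e where "e k = 1/8 * (1 / real (Suc k))" for k
  have e: "0 < e k" "e k \<le> 1/8" "0 \<le> e k" for k by (simp_all add: e_def)
  have lim: "e \<longlonglongrightarrow> 0"
    unfolding e_def by (rule tendsto_mult_right_zero[OF LIMSEQ_Suc[OF lim_1_over_n]])
  have "willmore_immersion_sphere (inverted_family (e k))" for k
    using family0(1)[OF e(1,2)] family1[OF e(1,2)]
    by (simp add: willmore_immersion_sphere_def sphere_charts_def inverted_family_charts)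
  moreover have "W_sphere (inverted_family (e k)) = ennreal (16 * pi)" for k
    using family0(2)[OF e(1,2)] by (simp add: W_sphere_def inverted_family_charts)
  moreover have "smooth_convergence_sphere (sphere 0 1 - {stereo 0}) (\<lambda>k. inverted_family (e k)) (inverted_family 0)"
    by (intro inverted_family_smooth_convergence lim e)
  moreover have "is_enneper enneper"
    unfolding is_enneper_def
    by (intro exI[of _ 1] exI[of _ "\<lambda>x. x"] exI[of _ 0]) (auto simp: orthogonal_transformation_id[unfolded id_def])
  \<comment> \<open>The sequence of energies is constant, and \<open>56 = 48 + 8\<close>.\<close>
  moreover have "(\<lambda>k. E_sphere (inverted_family (e k))) \<longlonglongrightarrow> E_sphere (inverted_family 0) + E_energy enneper"
    using family0(3)[OF e(1,2)]
    by (simp add: E_sphere_def inverted_family_charts lopez_energy enneper_energy flip: ennreal_plus)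
  ultimately show ?thesis
    using inverted_family_lopez by (intro exI[of _ "\<lambda>k. inverted_family (e k)"] exI[of _ "inverted_family 0"] exI[of _ enneper]) simp
qed

end
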